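(* The map $\kappa^\sharp$ (pullback of modules via $\kappa$) gives a bijection between the following two sets: (i) the isomorphism classes of finite-dimensional irreducible $\square_q$-modules of type $1$; (ii) the isomorphism classes of NonNil finite-dimensional irreducible $U_q^+$-modules of type $(1,1)$.
   Context: $\mathbb{F}$ is an algebraically closed field of characteristic $0$, and $0\neq q\in\mathbb{F}$ is not a root of unity. $[3]_q=(q^3-q^{-3})/(q-q^{-1})$. All algebras are associative with $1$. $\mathbb{Z}_4=\mathbb{Z}/4\mathbb{Z}$. $\square_q$ is the $\mathbb{F}$-algebra with generators $\{x_i\}_{i\in\mathbb{Z}_4}$ and relations, for $i\in\mathbb{Z}_4$, $$\frac{qx_ix_{i+1}-q^{-1}x_{i+1}x_i}{q-q^{-1}}=1,\qquad x_i^3x_{i+2}-[3]_qx_i^2x_{i+2}x_i+[3]_qx_ix_{i+2}x_i^2-x_{i+2}x_i^3=0.$$ On a finite-dimensional irreducible $\square_q$-module $V$ every $x_i$ is semisimple, and there are an integer $d\ge0$ (the diameter) and nonzero $\gamma\in\mathbb{F}$ (the type) such that the set of distinct eigenvalues of $x_0$ and of $x_2$ is $\{\gamma q^{d-2n}\}_{n=0}^d$, and that of $x_1$ and of $x_3$ is $\{\gamma^{-1}q^{d-2n}\}_{n=0}^d$. Type $1$ means $\gamma=1$. $U_q^+$ is the $\mathbb{F}$-algebra with generators $x,y$ (the standard generators) and relations $x^3y-[3]_qx^2yx+[3]_qxyx^2-yx^3=0$ and $y^3x-[3]_qy^2xy+[3]_qyxy^2-xy^3=0$. A finite-dimensional $U_q^+$-module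 is NonNil if neither $x$ nor $y$ is nilpotent on it. On a NonNil finite-dimensional irreducible $U_q^+$-module, $x$ and $y$ are semisimple and there are $d\in\mathbb{N}$ (the diameter) and nonzero $\gamma,\gamma'\in\mathbb{F}$ such that the set of distinct eigenvalues of $x$ (resp. $y$) is $\{\gamma q^{d-2i}\}_{i=0}^d$ (resp. $\{\gamma'q^{d-2i}\}_{i=0}^d$); the type is $(\gamma,\gamma')$. $\kappa:U_q^+\to\square_q$ is the algebra homomorphism with $x\mapsto x_0$, $y\mapsto x_2$. $\kappa^\sharp$ sends each $\square_q$-module to its pullback via $\kappa$ (same space, $a\in U_q^+$ acting as $\kappa(a)$). *)

theory Defs
  imports
    "HOL-Algebra.QuotRing"
    "HOL-Algebra.Module"
    "HOL-Library.Poly_Mapping"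
    "HOL-Library.Numeral_Type"
    "HOL-Computational_Algebra.Polynomial"
begin

section \<open>Algebras given by generators and relations\<close>

text \<open>
  The free algebra on a type \<open>'g\<close> of generators over a field \<open>'f\<close> is the monoid algebra of the free
  monoid on \<open>'g\<close>: finitely supported functions \<open>'g monomial \<Rightarrow>\<^sub>0 'f\<close> with convolution as product.
  The wrapper type around lists is needed because the product on \<open>\<Rightarrow>\<^sub>0\<close> expects the monoid operation
  on the exponents to be written additively.
\<close>

datatype 'g monomial = Monomial (letters: "'g list")

instantiation monomial :: (type) monoid_add
begin

definition zero_monomial :: "'a monomial" where
  "zero_monomial = Monomial []"

definition plus_monomial :: "'a monomial \<Rightarrow> 'a monomial \<Rightarrow> 'a monomial" where
  "plus_monomial u v = Monomial (letters u @ letters v)"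

instance
  by standard (simp_all add: zero_monomial_def plus_monomial_def)

end

type_synonym ('g, 'f) free_alg = "'g monomial \<Rightarrow>\<^sub>0 'f"

definition gen :: "'g \<Rightarrow> ('g, 'f::field) free_alg" where
  "gen g = Poly_Mapping.single (Monomial [g]) 1"

definition scalar :: "'f::field \<Rightarrow> ('g, 'f) free_alg" where
  "scalar c = Poly_Mapping.single 0 c"

text \<open>
  An algebra over \<open>'f\<close> is represented by the record type of \<^theory>\<open>HOL-Algebra.Module\<close>, which extends
  the ring operations by a scalar multiplication.
\<close>

definition free_algebra :: "('f::field, ('g, 'f) free_alg) module" where
  "free_algebra =
     \<lparr>carrier = UNIV, monoid.mult = (*), one = 1, zero = 0, add = (+),
      module.smult = (\<lambda>c p. scalar c * p)\<rparr>"

lemma free_algebra_simps [simp]: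
  "carrier free_algebra = UNIV" "monoid.mult free_algebra = (*)" "one free_algebra = 1"
  "zero free_algebra = 0" "add free_algebra = (+)"
  "module.smult free_algebra = (\<lambda>c p. scalar c * p)"
  by (simp_all add: free_algebra_def)

lemma free_alg_sum_single:
  "p = (\<Sum>w\<in>Poly_Mapping.keys p. Poly_Mapping.single w (Poly_Mapping.lookup p w))"
  by (rule poly_mapping_eqI)
    (auto simp: lookup_sum lookup_single when_def in_keys_iff)

lemma free_alg_induct [case_names zero single add]:
  assumes "P 0" "\<And>w c. P (Poly_Mapping.single w c)" "\<And>a b. P a \<Longrightarrow> P b \<Longrightarrow> P (a + b)"
  shows "P (p :: ('g, 'f::field) free_alg)"
proof -
  have "P (\<Sum>w\<in>K. Poly_Mapping.single w (Poly_Mapping.lookup p w))" if "finite K" for K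
    using that by (induction K) (auto intro: assms)
  then show ?thesis using free_alg_sum_single[of p] by (metis finite_keys)
qed

lemma scalar_commute: "scalar c * p = p * scalar c" for p :: "('g, 'f::field) free_alg"
  by (induction p rule: free_alg_induct)
    (simp_all add: scalar_def mult_single mult.commute ring_distribs)

lemma ring_free_algebra: "ring (free_algebra :: ('f::field, ('g, 'f) free_alg) module)"
proof (rule ringI)
  show "abelian_group (free_algebra :: ('f::field, ('g, 'f) free_alg) module)"
  proof (rule abelian_groupI)
    fix x :: "('g, 'f) free_alg"
    show "\<exists>y\<in>carrier free_algebra. y \<oplus>\<^bsub>free_algebra\<^esub> x = \<zero>\<^bsub>free_algebra\<^esub>"
      by (rule bexI[of _ "- x"]) (simp_all add: free_algebra_def)
  qed (simp_all add: free_algebra_def algebra_simps)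
  show "Group.monoid (free_algebra :: ('f::field, ('g, 'f) free_alg) module)"
    by (rule monoidI) (simp_all add: free_algebra_def algebra_simps)
qed (simp_all add: free_algebra_def algebra_simps)

text \<open>
  The two-sided ideal generated by a set of relators, i.e. the free-algebra elements that are
  set to zero.
\<close>

definition relation_ideal :: "('g, 'f::field) free_alg set \<Rightarrow> ('g, 'f) free_alg set" where
  "relation_ideal R = Idl\<^bsub>free_algebra\<^esub> R"

abbreviation residue_class ::
    "('g, 'f::field) free_alg set \<Rightarrow> ('g, 'f) free_alg \<Rightarrow> ('g, 'f) free_alg set" where
  "residue_class R p \<equiv> relation_ideal R +>\<^bsub>free_algebra\<^esub> p"

text \<open>
  The quotient ring by this ideal, together with the induced scalar multiplication. The union
  over all representatives of a residue class is the common residue class of their multiples.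
\<close>

definition presented_algebra ::
    "('g, 'f::field) free_alg set \<Rightarrow> ('f, ('g, 'f) free_alg set) module" where
  "presented_algebra R =
     ring.extend (free_algebra Quot relation_ideal R)
       (module.fields (\<lambda>c C. \<Union>p\<in>C. residue_class R (scalar c * p)))"

lemma ideal_relation_ideal: "ideal (relation_ideal R) free_algebra"
  unfolding relation_ideal_def by (rule ring.genideal_ideal[OF ring_free_algebra]) simp

lemma residue_class_eq_iff: "residue_class R p = residue_class R p' \<longleftrightarrow> p - p' \<in> relation_ideal R"
proof -
  interpret ring "free_algebra :: ('b, ('a, 'b) free_alg) module" by (rule ring_free_algebra)
  have "\<ominus>\<^bsub>free_algebra\<^esub> p' = - p'"
    using minus_equality[of "- p'" p'] by simp
  then have "p \<ominus>\<^bsub>free_algebra\<^esub> p' = p - p'"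
    by (simp add: a_minus_def)
  then show ?thesis
    using quotient_eq_iff_same_a_r_cos[OF ideal_relation_ideal, of p p' R] by simp
qed

lemma residue_class_mem_iff: "p \<in> residue_class R p' \<longleftrightarrow> residue_class R p = residue_class R p'"
proof -
  interpret ideal "relation_ideal R" free_algebra by (rule ideal_relation_ideal)
  show ?thesis
    using a_repr_independence'[of p p'] a_rcos_self[of p] by auto
qed

lemma presented_algebra_simps:
  "carrier (presented_algebra R) = range (residue_class R)"
  "residue_class R p \<otimes>\<^bsub>presented_algebra R\<^esub> residue_class R p' = residue_class R (p * p')"
  "residue_class R p \<oplus>\<^bsub>presented_algebra R\<^esub> residue_class R p' = residue_class R (p + p')"
  "\<one>\<^bsub>presented_algebra R\<^esub> = residue_class R 1"
  "\<zero>\<^bsub>presented_algebra R\<^esub> = residue_class R 0"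
  "c \<odot>\<^bsub>presented_algebra R\<^esub> residue_class R p = residue_class R (scalar c * p)"
proof -
  interpret ideal "relation_ideal R" free_algebra by (rule ideal_relation_ideal)
  note defs = presented_algebra_def ring.defs module.defs FactRing_def
  show "carrier (presented_algebra R) = range (residue_class R)"
    by (auto simp: defs A_RCOSETS_defs a_r_coset_def)
  show "residue_class R p \<otimes>\<^bsub>presented_algebra R\<^esub> residue_class R p' = residue_class R (p * p')"
    using rcoset_mult_add[of p p'] by (simp add: defs)
  show "residue_class R p \<oplus>\<^bsub>presented_algebra R\<^esub> residue_class R p' = residue_class R (p + p')"
    using a_rcos_sum[of p p'] by (simp add: defs)
  show "\<one>\<^bsub>presented_algebra R\<^esub> = residue_class R 1"
    by (simp add: defs)
  show "\<zero>\<^bsub>presented_algebra R\<^esub> = residue_class R 0"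
    by (simp add: defs a_r_coset_def r_coset_def)
  have *: "residue_class R (scalar c * p') = residue_class R (scalar c * p)"
    if "p' \<in> residue_class R p" for p'
  proof -
    have "p' - p \<in> relation_ideal R"
      using that unfolding residue_class_mem_iff residue_class_eq_iff .
    then have "scalar c * (p' - p) \<in> relation_ideal R"
      using I_l_closed[of "p' - p" "scalar c"] by simp
    then show ?thesis unfolding residue_class_eq_iff right_diff_distrib .
  qed
  have "p \<in> residue_class R p" unfolding residue_class_mem_iff ..
  then have "(\<Union>p'\<in>residue_class R p. residue_class R (scalar c * p')) =
      residue_class R (scalar c * p)"
    using * by blast
  then show "c \<odot>\<^bsub>presented_algebra R\<^esub> residue_class R p = residue_class R (scalar c * p)"
    by (simp add: defs)
qed

text \<open>The algebra homomorphism between free algebras that extends a map on the generators.\<close>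

definition free_ext :: "('g \<Rightarrow> ('h, 'f::field) free_alg) \<Rightarrow> ('g, 'f) free_alg \<Rightarrow> ('h, 'f) free_alg"
  where "free_ext h p =
    (\<Sum>w\<in>Poly_Mapping.keys p.
       scalar (Poly_Mapping.lookup p w) * prod_list (map h (letters w)))"

lemma scalar_add: "scalar (a + b) = scalar a + scalar b"
  by (simp add: scalar_def single_add)

lemma scalar_mult: "scalar (a * b) = scalar a * scalar b"
  by (simp add: scalar_def mult_single)

lemma scalar_0 [simp]: "scalar 0 = 0" and scalar_1 [simp]: "scalar 1 = 1"
  by (simp_all add: scalar_def)

lemma free_ext_0 [simp]: "free_ext h 0 = 0"
  by (simp add: free_ext_def)

lemma free_ext_single: "free_ext h (Poly_Mapping.single w c) = scalar c * prod_list (map h (letters w))"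
  by (cases "c = 0") (simp_all add: free_ext_def)

lemma free_ext_gen [simp]: "free_ext h (gen g) = h g"
  by (simp add: gen_def free_ext_single)

lemma free_ext_scalar [simp]: "free_ext h (scalar c) = scalar c"
  using free_ext_single[of h 0 c] by (simp add: zero_monomial_def scalar_def)

lemma free_ext_1 [simp]: "free_ext h 1 = 1"
  using free_ext_scalar[of h 1] by simp

lemma free_ext_add: "free_ext h (a + b) = free_ext h a + free_ext h b"
proof -
  have *: "free_ext h p =
      (\<Sum>w\<in>K. scalar (Poly_Mapping.lookup p w) * prod_list (map h (letters w)))"
    if "finite K" "Poly_Mapping.keys p \<subseteq> K" for K p
    unfolding free_ext_def
    by (rule sum.mono_neutral_left) (use that in \<open>auto simp: in_keys_iff\<close>)
  let ?K = "Poly_Mapping.keys a \<union> Poly_Mapping.keys b"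
  have K: "finite ?K" "Poly_Mapping.keys a \<subseteq> ?K" "Poly_Mapping.keys b \<subseteq> ?K"
    "Poly_Mapping.keys (a + b) \<subseteq> ?K"
    by (simp_all add: Poly_Mapping.keys_add)
  show ?thesis
    unfolding *[OF K(1,2)] *[OF K(1,3)] *[OF K(1,4)]
    by (simp only: lookup_add scalar_add distrib_right sum.distrib)
qed

lemma free_ext_mult: "free_ext h (a * b) = free_ext h a * free_ext h b"
proof (induction a rule: free_alg_induct)
  case (single u c)
  show ?case
  proof (induction b rule: free_alg_induct)
    case (single v d)
    have "scalar c * scalar d * (prod_list (map h (letters u)) * prod_list (map h (letters v))) =
          scalar c * prod_list (map h (letters u)) * (scalar d * prod_list (map h (letters v)))"
      by (simp only: mult.assoc)
        (simp only: mult.assoc[symmetric] scalar_commute[of d "prod_list (map h (letters u))"])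
    then show ?case
      by (simp add: mult_single free_ext_single plus_monomial_def scalar_mult)
  qed (simp_all add: distrib_left free_ext_add)
qed (simp_all add: distrib_right free_ext_add)

lemma free_ext_uminus: "free_ext h (- a) = - free_ext h a"
  using minus_unique[of "free_ext h a" "free_ext h (- a)"] by (simp flip: free_ext_add)

lemma free_ext_diff: "free_ext h (a - b) = free_ext h a - free_ext h b"
  using free_ext_add[of h a "- b"] by (simp add: free_ext_uminus)

lemma free_ext_power: "free_ext h (a ^ n) = free_ext h a ^ n"
  by (induction n) (simp_all add: free_ext_mult)

text \<open>A map of generators that respects the relators respects the ideals they generate.\<close>

lemma free_ext_relation_ideal:
  assumes "\<And>r. r \<in> R \<Longrightarrow> free_ext h r \<in> relation_ideal S" and "p \<in> relation_ideal R"
  shows "free_ext h p \<in> relation_ideal S"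
proof -
  interpret S: ideal "relation_ideal S" free_algebra by (rule ideal_relation_ideal)
  let ?K = "{p. free_ext h p \<in> relation_ideal S}"
  have zero: "0 \<in> relation_ideal S"
    and add: "\<And>a b. a \<in> relation_ideal S \<Longrightarrow> b \<in> relation_ideal S \<Longrightarrow> a + b \<in> relation_ideal S"
    using additive_subgroup.zero_closed[OF S.is_additive_subgroup]
      additive_subgroup.a_closed[OF S.is_additive_subgroup] by simp_all
  have left: "\<And>a b. b \<in> relation_ideal S \<Longrightarrow> a * b \<in> relation_ideal S"
    and right: "\<And>a b. b \<in> relation_ideal S \<Longrightarrow> b * a \<in> relation_ideal S"
    using S.I_l_closed S.I_r_closed by simp_all
  have inv: "inv\<^bsub>add_monoid free_algebra\<^esub> a = - a" for a :: "('a, 'b) free_alg"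
  proof -
    interpret ring "free_algebra :: ('b, ('a, 'b) free_alg) module" by (rule ring_free_algebra)
    show ?thesis using minus_equality[of "- a" a] by (simp add: a_inv_def)
  qed
  have "ideal ?K free_algebra"
  proof (rule idealI)
    show "subgroup ?K (add_monoid free_algebra)"
    proof (rule group.subgroupI)
      show "Group.group (add_monoid (free_algebra :: ('b, ('a, 'b) free_alg) module))"
        using ring_free_algebra ring.is_abelian_group abelian_group.a_group by blast
      show "?K \<noteq> {}" using zero by (auto intro!: exI[of _ 0])
      show "inv\<^bsub>add_monoid free_algebra\<^esub> a \<in> ?K" if "a \<in> ?K" for a
        unfolding inv using left[of "free_ext h a" "-1"] that by (simp add: free_ext_uminus)
    qed (simp_all add: add free_ext_add)
  qed (simp_all add: ring_free_algebra left right free_ext_mult)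
  then have "relation_ideal R \<subseteq> ?K"
    using assms(1) unfolding relation_ideal_def[of R]
    by (intro ring.genideal_minimal[OF ring_free_algebra]) auto
  then show ?thesis using assms(2) by auto
qed

lemma relator_in_ideal: "r \<in> R \<Longrightarrow> r \<in> relation_ideal R"
  unfolding relation_ideal_def using ring.genideal_self[OF ring_free_algebra, of R] by auto

section \<open>The algebras \<open>\<box>\<^sub>q\<close> and \<open>U\<^sub>q\<^sup>+\<close>\<close>

definition not_root_of_unity :: "'f::field \<Rightarrow> bool" where
  "not_root_of_unity q \<longleftrightarrow> (\<forall>n>0. q ^ n \<noteq> 1)"

definition q3 :: "'f::field \<Rightarrow> 'f" where
  "q3 q = (q ^ 3 - inverse q ^ 3) / (q - inverse q)"

definition q_serre ::
    "'f::field \<Rightarrow> ('g, 'f) free_alg \<Rightarrow> ('g, 'f) free_alg \<Rightarrow> ('g, 'f) free_alg" where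
  "q_serre q a b =
     a ^ 3 * b - scalar (q3 q) * a ^ 2 * b * a + scalar (q3 q) * a * b * a ^ 2 - b * a ^ 3"

text \<open>
  The generators of \<open>\<box>\<^sub>q\<close> are indexed by the numeral type \<open>4\<close>, on which addition is addition
  modulo 4.
\<close>

definition square_relators :: "'f::field \<Rightarrow> (4, 'f) free_alg set" where
  "square_relators q =
     (\<Union>i. {scalar (1 / (q - inverse q)) *
              (scalar q * gen i * gen (i + 1) - scalar (inverse q) * gen (i + 1) * gen i) - 1,
            q_serre q (gen i) (gen (i + 2))})"

abbreviation square_q :: "'f::field \<Rightarrow> ('f, (4, 'f) free_alg set) module" where
  "square_q q \<equiv> presented_algebra (square_relators q)"

definition square_gen :: "'f::field \<Rightarrow> 4 \<Rightarrow> (4, 'f) free_alg set" where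
  "square_gen q i = residue_class (square_relators q) (gen i)"

datatype uq_generator = GenX | GenY

definition uq_relators :: "'f::field \<Rightarrow> (uq_generator, 'f) free_alg set" where
  "uq_relators q = {q_serre q (gen GenX) (gen GenY), q_serre q (gen GenY) (gen GenX)}"

abbreviation uq_plus :: "'f::field \<Rightarrow> ('f, (uq_generator, 'f) free_alg set) module" where
  "uq_plus q \<equiv> presented_algebra (uq_relators q)"

definition uq_gen :: "'f::field \<Rightarrow> uq_generator \<Rightarrow> (uq_generator, 'f) free_alg set" where
  "uq_gen q g = residue_class (uq_relators q) (gen g)"

definition kappa_gen :: "uq_generator \<Rightarrow> (4, 'f::field) free_alg" where
  "kappa_gen g = (case g of GenX \<Rightarrow> gen 0 | GenY \<Rightarrow> gen 2)"

text \<open>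
  The homomorphism \<open>U\<^sub>q\<^sup>+ \<rightarrow> \<box>\<^sub>q\<close> induced by \<open>x \<mapsto> x\<^sub>0\<close>, \<open>y \<mapsto> x\<^sub>2\<close>. The image of a residue class is the
  union (in fact the common value) over its representatives, see \<open>kappa_residue_class\<close> below.
\<close>

definition kappa :: "'f::field \<Rightarrow> (uq_generator, 'f) free_alg set \<Rightarrow> (4, 'f) free_alg set" where
  "kappa q C = (\<Union>p\<in>C. residue_class (square_relators q) (free_ext kappa_gen p))"

lemma free_ext_q_serre: "free_ext h (q_serre q a b) = q_serre q (free_ext h a) (free_ext h b)"
  by (simp add: q_serre_def free_ext_add free_ext_diff free_ext_mult free_ext_power)

lemma kappa_gen_relators:
  assumes "r \<in> uq_relators q"
  shows "free_ext kappa_gen r \<in> relation_ideal (square_relators q)"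
proof -
  have "q_serre q (gen i) (gen (i + 2)) \<in> square_relators q" for i
    by (auto simp: square_relators_def)
  moreover have "(2 :: 4) + 2 = 0"
    using bit0.of_int_eq[of 4, where 'a = 2] bit0.of_int_eq[of 0, where 'a = 2] by simp
  ultimately have "q_serre q (gen 0) (gen 2) \<in> square_relators q"
    "q_serre q (gen 2) (gen 0) \<in> square_relators q"
    by (metis add_0)+
  then show ?thesis
    using assms by (auto simp: uq_relators_def free_ext_q_serre kappa_gen_def intro: relator_in_ideal)
qed

lemma kappa_residue_class:
  "kappa q (residue_class (uq_relators q) p) =
   residue_class (square_relators q) (free_ext kappa_gen p)"
proof -
  have *: "residue_class (square_relators q) (free_ext kappa_gen p') =
        residue_class (square_relators q) (free_ext kappa_gen p)"
    if "p' \<in> residue_class (uq_relators q) p" for p'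
    using that free_ext_relation_ideal[OF kappa_gen_relators, where p = "p' - p"]
    unfolding residue_class_mem_iff residue_class_eq_iff free_ext_diff by blast
  have "p \<in> residue_class (uq_relators q) p" unfolding residue_class_mem_iff ..
  then show ?thesis unfolding kappa_def using * by blast
qed

lemma kappa_generators:
  "kappa q (uq_gen q GenX) = square_gen q 0" "kappa q (uq_gen q GenY) = square_gen q 2"
  by (simp_all add: uq_gen_def square_gen_def kappa_residue_class kappa_gen_def)

lemma kappa_hom:
  "kappa q \<in> ring_hom (uq_plus q) (square_q q)"
  "a \<in> carrier (uq_plus q) \<Longrightarrow> kappa q (c \<odot>\<^bsub>uq_plus q\<^esub> a) = c \<odot>\<^bsub>square_q q\<^esub> kappa q a"
  by (auto simp: ring_hom_def presented_algebra_simps kappa_residue_class free_ext_add free_ext_mult)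

section \<open>Modules\<close>

text \<open>
  The underlying vector space of a module is a subspace of an ambient vector space
  over \<open>'f\<close> with vectors of type \<open>'v\<close> and scalar multiplication \<open>scale\<close>. Once the ambient
  space is infinite-dimensional, every finite-dimensional module is isomorphic to one of this form.
  The values of the action outside the algebra and the space are irrelevant.
\<close>

record ('a, 'v) alg_module =
  vspace :: "'v set"
  action :: "'a \<Rightarrow> 'v \<Rightarrow> 'v"

definition is_module ::
    "('f::field \<Rightarrow> 'v::ab_group_add \<Rightarrow> 'v) \<Rightarrow> ('f, 'a) module \<Rightarrow> ('a, 'v) alg_module \<Rightarrow> bool" where
  "is_module scale A M \<longleftrightarrow>
     Modules.module.subspace scale (vspace M) \<and>
     (\<forall>a\<in>carrier A. \<forall>v\<in>vspace M. action M a v \<in> vspace M) \<and>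
     (\<forall>a\<in>carrier A. \<forall>v\<in>vspace M. \<forall>w\<in>vspace M. action M a (v + w) = action M a v + action M a w) \<and>
     (\<forall>a\<in>carrier A. \<forall>c. \<forall>v\<in>vspace M. action M a (scale c v) = scale c (action M a v)) \<and>
     (\<forall>a\<in>carrier A. \<forall>b\<in>carrier A. \<forall>v\<in>vspace M.
        action M (a \<oplus>\<^bsub>A\<^esub> b) v = action M a v + action M b v) \<and>
     (\<forall>c. \<forall>a\<in>carrier A. \<forall>v\<in>vspace M. action M (c \<odot>\<^bsub>A\<^esub> a) v = scale c (action M a v)) \<and>
     (\<forall>a\<in>carrier A. \<forall>b\<in>carrier A. \<forall>v\<in>vspace M. action M (a \<otimes>\<^bsub>A\<^esub> b) v = action M a (action M b v)) \<and>
     (\<forall>v\<in>vspace M. action M \<one>\<^bsub>A\<^esub> v = v)"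

definition fin_dim :: "('f::field \<Rightarrow> 'v::ab_group_add \<Rightarrow> 'v) \<Rightarrow> ('a, 'v) alg_module \<Rightarrow> bool" where
  "fin_dim scale M \<longleftrightarrow> (\<exists>B. finite B \<and> Modules.module.span scale B = vspace M)"

definition irreducible_module ::
    "('f::field \<Rightarrow> 'v::ab_group_add \<Rightarrow> 'v) \<Rightarrow> ('f, 'a) module \<Rightarrow> ('a, 'v) alg_module \<Rightarrow> bool" where
  "irreducible_module scale A M \<longleftrightarrow>
     vspace M \<noteq> {0} \<and>
     (\<forall>W. Modules.module.subspace scale W \<and> W \<subseteq> vspace M \<and>
          (\<forall>a\<in>carrier A. \<forall>w\<in>W. action M a w \<in> W) \<longrightarrow> W = {0} \<or> W = vspace M)"

definition module_iso ::
    "('f::field \<Rightarrow> 'v::ab_group_add \<Rightarrow> 'v) \<Rightarrow> ('f, 'a) module \<Rightarrow>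
     ('a, 'v) alg_module \<Rightarrow> ('a, 'v) alg_module \<Rightarrow> bool" where
  "module_iso scale A M N \<longleftrightarrow>
     (\<exists>f. bij_betw f (vspace M) (vspace N) \<and>
          (\<forall>v\<in>vspace M. \<forall>w\<in>vspace M. f (v + w) = f v + f w) \<and>
          (\<forall>c. \<forall>v\<in>vspace M. f (scale c v) = scale c (f v)) \<and>
          (\<forall>a\<in>carrier A. \<forall>v\<in>vspace M. f (action M a v) = action N a (f v)))"

definition iso_class ::
    "('f::field \<Rightarrow> 'v::ab_group_add \<Rightarrow> 'v) \<Rightarrow> ('f, 'a) module \<Rightarrow>
     ('a, 'v) alg_module \<Rightarrow> ('a, 'v) alg_module set" where
  "iso_class scale A M = {N. is_module scale A N \<and> module_iso scale A M N}"

definition pullback :: "('b \<Rightarrow> 'a) \<Rightarrow> ('a, 'v) alg_module \<Rightarrow> ('b, 'v) alg_module" where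
  "pullback \<phi> M = \<lparr>vspace = vspace M, action = (\<lambda>b. action M (\<phi> b))\<rparr>"

definition eigenvalues ::
    "('f::field \<Rightarrow> 'v::ab_group_add \<Rightarrow> 'v) \<Rightarrow> ('a, 'v) alg_module \<Rightarrow> 'a \<Rightarrow> 'f set" where
  "eigenvalues scale M a = {\<theta>. \<exists>v\<in>vspace M. v \<noteq> 0 \<and> action M a v = scale \<theta> v}"

definition nilpotent_on :: "('a, 'v::ab_group_add) alg_module \<Rightarrow> 'a \<Rightarrow> bool" where
  "nilpotent_on M a \<longleftrightarrow> (\<exists>n. \<forall>v\<in>vspace M. (action M a ^^ n) v = 0)"

definition q_string :: "'f::field \<Rightarrow> nat \<Rightarrow> 'f \<Rightarrow> 'f set" where
  "q_string q d \<gamma> = {\<gamma> * q powi (int d - 2 * int n) | n. n \<le> d}"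

definition square_type ::
    "('f::field \<Rightarrow> 'v::ab_group_add \<Rightarrow> 'v) \<Rightarrow> 'f \<Rightarrow> ((4, 'f) free_alg set, 'v) alg_module \<Rightarrow>
     'f \<Rightarrow> bool" where
  "square_type scale q M \<gamma> \<longleftrightarrow> \<gamma> \<noteq> 0 \<and>
     (\<exists>d. eigenvalues scale M (square_gen q 0) = q_string q d \<gamma> \<and>
          eigenvalues scale M (square_gen q 2) = q_string q d \<gamma> \<and>
          eigenvalues scale M (square_gen q 1) = q_string q d (inverse \<gamma>) \<and>
          eigenvalues scale M (square_gen q 3) = q_string q d (inverse \<gamma>))"

definition NonNil :: "'f::field \<Rightarrow> ((uq_generator, 'f) free_alg set, 'v::ab_group_add) alg_module \<Rightarrow> bool"
  where "NonNil q M \<longleftrightarrow> \<not> nilpotent_on M (uq_gen q GenX) \<and> \<not> nilpotent_on M (uq_gen q GenY)"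

definition uq_type ::
    "('f::field \<Rightarrow> 'v::ab_group_add \<Rightarrow> 'v) \<Rightarrow> 'f \<Rightarrow>
     ((uq_generator, 'f) free_alg set, 'v) alg_module \<Rightarrow> 'f \<times> 'f \<Rightarrow> bool" where
  "uq_type scale q M = (\<lambda>(\<gamma>, \<gamma>'). \<gamma> \<noteq> 0 \<and> \<gamma>' \<noteq> 0 \<and>
     (\<exists>d. eigenvalues scale M (uq_gen q GenX) = q_string q d \<gamma> \<and>
          eigenvalues scale M (uq_gen q GenY) = q_string q d \<gamma>'))"

definition square_classes ::
    "('f::field \<Rightarrow> 'v::ab_group_add \<Rightarrow> 'v) \<Rightarrow> 'f \<Rightarrow> ((4, 'f) free_alg set, 'v) alg_module set set"
  where "square_classes scale q =
    {iso_class scale (square_q q) M | M.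
       is_module scale (square_q q) M \<and> fin_dim scale M \<and>
       irreducible_module scale (square_q q) M \<and> square_type scale q M 1}"

definition uq_classes ::
    "('f::field \<Rightarrow> 'v::ab_group_add \<Rightarrow> 'v) \<Rightarrow> 'f \<Rightarrow>
     ((uq_generator, 'f) free_alg set, 'v) alg_module set set"
  where "uq_classes scale q =
    {iso_class scale (uq_plus q) M | M.
       is_module scale (uq_plus q) M \<and> fin_dim scale M \<and>
       irreducible_module scale (uq_plus q) M \<and> NonNil q M \<and> uq_type scale q M (1, 1)}"

text \<open>
  The map on isomorphism classes induced by the pullback along \<open>\<kappa>\<close>. The union over all
  representatives is a single isomorphism class precisely because the class of the
  pullback does not depend on the representative.
\<close>

definition kappa_sharp ::
    "('f::field \<Rightarrow> 'v::ab_group_add \<Rightarrow> 'v) \<Rightarrow> 'f \<Rightarrow> ((4, 'f) free_alg set, 'v) alg_module set \<Rightarrow>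
     ((uq_generator, 'f) free_alg set, 'v) alg_module set" where
  "kappa_sharp scale q C = (\<Union>M\<in>C. iso_class scale (uq_plus q) (pullback (kappa q) M))"

end

theory Submission
  imports Defs
begin

text \<open>
  Let \<open>A\<close>, \<open>X\<close>, \<open>B\<close>, \<open>Y\<close> be the actions of \<open>x\<^sub>0\<close>, \<open>x\<^sub>1\<close>, \<open>x\<^sub>2\<close>, \<open>x\<^sub>3\<close> on a module \<open>V\<close>, put
  \<open>\<theta> i = q\<^bsup>d - 2i\<^esup>\<close> for \<open>i \<in> \<int>\<close>, and write \<open>E T I\<close> for the sum of the eigenspaces of an operator \<open>T\<close>
  with eigenvalue \<open>\<theta> i\<close> (if \<open>T\<close> is \<open>A\<close> or \<open>B\<close>) or \<open>1 / \<theta> i\<close> (if \<open>T\<close> is \<open>X\<close> or \<open>Y\<close>), \<open>i \<in> I\<close>.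

  On an irreducible module, \<open>A\<close> and \<open>B\<close> are diagonalizable, because the relations make the sum of
  the eigenspaces of either operator a submodule (\<open>diagonalizable_if_irreducible\<close>). Given this, the
  cubic relation between \<open>A\<close> and \<open>B\<close> says exactly that \<open>B\<close> maps \<open>E A {i}\<close> into
  \<open>E A {i - 1..i + 1}\<close>, and vice versa. The quadratic relations for \<open>A, X\<close> and \<open>X, B\<close> say that
  \<open>X - 1 / \<theta> i\<close> maps \<open>E A {i}\<close> into \<open>E A {i + 1}\<close> and \<open>E B {i}\<close> into \<open>E B {i - 1}\<close>. Consequently
  \<open>E A {j..} = E X {j..}\<close> and \<open>E B {..j} = E X {..j}\<close>: the eigenspaces of \<open>X\<close> are the intersections
  \<open>U i = E B {..i} \<inter> E A {i..}\<close>, and \<open>E B {..i}\<close> meets \<open>E A {j..}\<close> only in \<open>0\<close> if \<open>i < j\<close>. Likewise for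
  \<open>Y\<close>, with \<open>A\<close> and \<open>B\<close> exchanged. Everything follows from this picture.

  \<^item> Surjectivity. On an irreducible module for \<open>A\<close> and \<open>B\<close> the sum over \<open>i\<close> of the spaces
    \<open>E B {..i} \<inter> E A {i + r..}\<close> is invariant, hence zero for \<open>r = 1\<close>, where it misses the lowest
    eigenspace of \<open>A\<close>, and everything for \<open>r = 0\<close>, where it contains the lowest eigenspace of \<open>B\<close>.
    So \<open>V\<close> is the direct sum of the \<open>U i\<close>, and \<open>X\<close> can be defined to be \<open>1 / \<theta> i\<close> on \<open>U i\<close>
    (\<open>weyl_operator_exists\<close>); the operator \<open>Y\<close> is obtained by exchanging \<open>A\<close> and \<open>B\<close>. The cubic
    relations between \<open>X\<close> and \<open>Y\<close> hold because \<open>Y\<close> maps \<open>E B {..i}\<close> into \<open>E B {..i + 1}\<close> and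
    \<open>E A {i..}\<close> into \<open>E A {i - 1..}\<close>, hence \<open>E X {i}\<close> into \<open>E X {i - 1..i + 1}\<close> (\<open>serre_X_Y\<close>).

  \<^item> Injectivity. If \<open>X\<close> and \<open>X'\<close> satisfy the same quadratic relations with \<open>A\<close> and \<open>B\<close>, then
    \<open>D = X - X'\<close> satisfies \<open>D A = q\<^sup>2 A D\<close> and \<open>B D = q\<^sup>2 D B\<close>. Its kernel is invariant under \<open>A\<close> and
    \<open>B\<close> and contains the lowest eigenvectors of \<open>B\<close>, so that \<open>D = 0\<close> if \<open>V\<close> is irreducible under
    \<open>A\<close> and \<open>B\<close> (\<open>weyl_operator_unique\<close>). An isomorphism of pullbacks therefore commutes with
    \<open>x\<^sub>1\<close> and \<open>x\<^sub>3\<close> too (\<open>weyl_operator_intertwined\<close>).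

  \<^item> The pullback of an irreducible module is irreducible. Let \<open>U\<close> be a minimal nonzero subspace
    invariant under \<open>A\<close> and \<open>B\<close>. Since \<open>E B {..j}\<close> and \<open>E A {i..}\<close> are disjoint for \<open>j < i\<close>, the lowest
    indices of eigenvalues of \<open>A\<close> and of \<open>B\<close> on \<open>U\<close> agree. Hence there is an operator \<open>X'\<close> on \<open>U\<close>
    satisfying the quadratic relations, and the argument for injectivity, applied to \<open>X - X'\<close> on \<open>U\<close>,
    shows that \<open>X\<close> preserves \<open>U\<close> (\<open>irreducible_pair_invariant\<close>). So does \<open>Y\<close>, whence \<open>U = V\<close>.

  Modules live on subspaces of an ambient vector space, so operators are functions on that space
  which are linear on the subspace in question.
\<close>

section \<open>Linear maps on a subspace\<close>

locale operator_space = vector_space scale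
  for scale :: "'a::field \<Rightarrow> 'b::ab_group_add \<Rightarrow> 'b" (infixr "*s" 75)
begin

definition lin_on :: "'b set \<Rightarrow> ('b \<Rightarrow> 'b) \<Rightarrow> bool" where
  "lin_on W T \<longleftrightarrow>
     (\<forall>v\<in>W. \<forall>w\<in>W. T (v + w) = T v + T w) \<and> (\<forall>c. \<forall>v\<in>W. T (c *s v) = c *s T v)"

definition endo :: "'b set \<Rightarrow> ('b \<Rightarrow> 'b) \<Rightarrow> bool" where
  "endo W T \<longleftrightarrow> lin_on W T \<and> (\<forall>v\<in>W. T v \<in> W)"

lemma lin_on_add: "lin_on W T \<Longrightarrow> v \<in> W \<Longrightarrow> w \<in> W \<Longrightarrow> T (v + w) = T v + T w"
  and lin_on_scale: "lin_on W T \<Longrightarrow> v \<in> W \<Longrightarrow> T (c *s v) = c *s T v"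
  by (auto simp: lin_on_def)

lemma lin_on_0: "lin_on W T \<Longrightarrow> subspace W \<Longrightarrow> T 0 = 0"
  using lin_on_scale[of W T 0 0] by (simp add: subspace_0)

lemma lin_on_diff:
  assumes "lin_on W T" "subspace W" "v \<in> W" "w \<in> W"
  shows "T (v - w) = T v - T w"
proof -
  have "T (v + (-1) *s w) = T v + T ((-1) *s w)"
    by (rule lin_on_add[OF assms(1)]) (use assms in \<open>auto simp: subspace_neg\<close>)
  also have "T ((-1) *s w) = (-1) *s T w"
    by (rule lin_on_scale[OF assms(1)]) (use assms in auto)
  finally show ?thesis by simp
qed

lemma lin_on_subset: "lin_on W T \<Longrightarrow> U \<subseteq> W \<Longrightarrow> lin_on U T"
  unfolding lin_on_def by blast

lemma endo_closed: "endo W T \<Longrightarrow> v \<in> W \<Longrightarrow> T v \<in> W"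
  and endo_lin: "endo W T \<Longrightarrow> lin_on W T"
  by (auto simp: endo_def)

lemma endo_restrict: "endo W T \<Longrightarrow> U \<subseteq> W \<Longrightarrow> (\<And>v. v \<in> U \<Longrightarrow> T v \<in> U) \<Longrightarrow> endo U T"
  unfolding endo_def using lin_on_subset by blast

lemma endo_add: "endo W T \<Longrightarrow> v \<in> W \<Longrightarrow> w \<in> W \<Longrightarrow> T (v + w) = T v + T w"
  and endo_scale: "endo W T \<Longrightarrow> v \<in> W \<Longrightarrow> T (c *s v) = c *s T v"
  by (auto simp: endo_def lin_on_def)

lemma endo_diff: "endo W T \<Longrightarrow> subspace W \<Longrightarrow> v \<in> W \<Longrightarrow> w \<in> W \<Longrightarrow> T (v - w) = T v - T w"
  using lin_on_diff endo_lin by blast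

lemma subspace_kernel:
  assumes "lin_on W T" "subspace W"
  shows "subspace {v \<in> W. T v = 0}"
  by (rule subspaceI)
    (use assms(2-) in \<open>auto simp: lin_on_add[OF assms(1)] lin_on_scale[OF assms(1)] lin_on_0[OF assms(1,2)]
      intro: subspace_0 subspace_add subspace_scale\<close>)

lemma subspace_preimage:
  assumes "lin_on W T" "subspace W" "subspace U"
  shows "subspace {v \<in> W. T v \<in> U}"
  by (rule subspaceI)
    (use assms(2-) in \<open>auto simp: lin_on_add[OF assms(1)] lin_on_scale[OF assms(1)] lin_on_0[OF assms(1,2)]
      intro: subspace_0 subspace_add subspace_scale\<close>)

lemma lin_on_span_image:
  assumes "lin_on W T" "subspace W" "subspace U" "G \<subseteq> W" "\<And>g. g \<in> G \<Longrightarrow> T g \<in> U" "v \<in> span G"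
  shows "T v \<in> U"
proof -
  have "span G \<subseteq> {v \<in> W. T v \<in> U}"
    by (rule span_minimal) (use assms subspace_preimage in auto)
  then show ?thesis using assms(6) by auto
qed

section \<open>Sums of eigenspaces\<close>

definition eigsum :: "'b set \<Rightarrow> ('b \<Rightarrow> 'b) \<Rightarrow> 'a set \<Rightarrow> 'b set" where
  "eigsum W T \<Theta> = span {v \<in> W. \<exists>\<theta>\<in>\<Theta>. T v = \<theta> *s v}"

lemma subspace_eigsum [simp]: "subspace (eigsum W T \<Theta>)"
  by (simp add: eigsum_def)

lemma eigsum_mono: "\<Theta> \<subseteq> \<Theta>' \<Longrightarrow> eigsum W T \<Theta> \<subseteq> eigsum W T \<Theta>'"
  unfolding eigsum_def by (rule span_mono) auto

lemma eigsum_mono_space: "W \<subseteq> W' \<Longrightarrow> eigsum W T \<Theta> \<subseteq> eigsum W' T \<Theta>"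
  unfolding eigsum_def by (rule span_mono) auto

lemma eigsum_subset: "subspace W \<Longrightarrow> eigsum W T \<Theta> \<subseteq> W"
  unfolding eigsum_def by (rule span_minimal) auto

lemma eigsum_empty [simp]: "eigsum W T {} = {0}"
  by (simp add: eigsum_def)

lemma eigsumI: "v \<in> W \<Longrightarrow> \<theta> \<in> \<Theta> \<Longrightarrow> T v = \<theta> *s v \<Longrightarrow> v \<in> eigsum W T \<Theta>"
  unfolding eigsum_def by (rule span_base) auto

lemma eigsum_minimal:
  "subspace U \<Longrightarrow> (\<And>v \<theta>. v \<in> W \<Longrightarrow> \<theta> \<in> \<Theta> \<Longrightarrow> T v = \<theta> *s v \<Longrightarrow> v \<in> U) \<Longrightarrow> eigsum W T \<Theta> \<subseteq> U"
  unfolding eigsum_def by (rule span_minimal) auto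

lemma eigsum_image:
  assumes "lin_on W X" "subspace W" "subspace U"
    and "\<And>v \<theta>. v \<in> W \<Longrightarrow> \<theta> \<in> \<Theta> \<Longrightarrow> T v = \<theta> *s v \<Longrightarrow> X v \<in> U"
    and "v \<in> eigsum W T \<Theta>"
  shows "X v \<in> U"
  by (rule lin_on_span_image[OF assms(1-3) _ _ assms(5)[unfolded eigsum_def]])
    (use assms(4) in auto)

lemma eigsum_invariant:
  assumes "endo W T" "subspace W" "v \<in> eigsum W T \<Theta>"
  shows "T v \<in> eigsum W T \<Theta>"
  by (rule eigsum_image[OF endo_lin[OF assms(1)] assms(2) subspace_eigsum _ assms(3)])
    (auto intro!: subspace_scale eigsumI)

text \<open>On the eigenspace for \<open>\<eta> \<noteq> \<theta>\<close> the operator \<open>T - \<theta>\<close> is multiplication by \<open>\<eta> - \<theta> \<noteq> 0\<close>.\<close>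

lemma eigsum_shift_surj:
  assumes "endo W T" "subspace W" "\<theta> \<notin> \<Theta>" "w \<in> eigsum W T \<Theta>"
  shows "\<exists>u\<in>eigsum W T \<Theta>. T u - \<theta> *s u = w"
proof -
  have "eigsum W T \<Theta> \<subseteq> {w. \<exists>u\<in>eigsum W T \<Theta>. T u - \<theta> *s u = w}"
  proof (rule eigsum_minimal)
    have sub: "u \<in> W" if "u \<in> eigsum W T \<Theta>" for u
      using that eigsum_subset[OF assms(2)] by blast
    show "subspace {w. \<exists>u\<in>eigsum W T \<Theta>. T u - \<theta> *s u = w}"
    proof (rule subspaceI; safe)
      show "\<exists>u\<in>eigsum W T \<Theta>. T u - \<theta> *s u = 0"
        using lin_on_0[OF endo_lin[OF assms(1)] assms(2)]
        by (intro bexI[of _ 0]) (auto intro: subspace_0)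
    next
      fix u v assume "u \<in> eigsum W T \<Theta>" "v \<in> eigsum W T \<Theta>"
      then show "\<exists>x\<in>eigsum W T \<Theta>. T x - \<theta> *s x = T u - \<theta> *s u + (T v - \<theta> *s v)"
        using sub assms(1)
        by (intro bexI[of _ "u + v"])
          (auto simp: endo_add[OF assms(1)] scale_right_distrib intro: subspace_add)
    next
      fix c u assume "u \<in> eigsum W T \<Theta>"
      then show "\<exists>x\<in>eigsum W T \<Theta>. T x - \<theta> *s x = c *s (T u - \<theta> *s u)"
        using sub assms(1)
        by (intro bexI[of _ "c *s u"])
          (auto simp: endo_scale[OF assms(1)] scale_right_diff_distrib mult.commute intro: subspace_scale)
    qed
  next
    fix v \<eta> assume v: "v \<in> W" "\<eta> \<in> \<Theta>" "T v = \<eta> *s v"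
    then have "\<eta> - \<theta> \<noteq> 0" using assms(3) by auto
    then have "T ((1 / (\<eta> - \<theta>)) *s v) - \<theta> *s ((1 / (\<eta> - \<theta>)) *s v) = v"
      using v assms(1)
      by (simp add: endo_scale[OF assms(1)] mult.commute flip: scale_left_diff_distrib diff_divide_distrib)
    then show "v \<in> {w. \<exists>u\<in>eigsum W T \<Theta>. T u - \<theta> *s u = w}"
      using v by (auto intro!: bexI[of _ "(1 / (\<eta> - \<theta>)) *s v"] subspace_scale eigsumI)
  qed
  then show ?thesis using assms(4) by blast
qed

text \<open>
  This is how membership in a sum of eigenspaces is established throughout: one linear factor
  \<open>T - \<theta>\<close> of an annihilating product is peeled off at a time.
\<close>

lemma eigsum_step:
  assumes "endo W T" "subspace W" "v \<in> W" "T v - \<theta> *s v \<in> eigsum W T \<Theta>" "\<theta> \<notin> \<Theta>"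
  shows "v \<in> eigsum W T (insert \<theta> \<Theta>)"
proof -
  obtain u where u: "u \<in> eigsum W T \<Theta>" "T u - \<theta> *s u = T v - \<theta> *s v"
    using eigsum_shift_surj[OF assms(1,2,5,4)] by blast
  have uW: "u \<in> W" using u(1) eigsum_subset[OF assms(2)] by blast
  have "T (v - u) = \<theta> *s (v - u)"
    using u(2) endo_diff[OF assms(1,2,3) uW] by (simp only: scale_right_diff_distrib) (simp add: algebra_simps)
  then have "v - u \<in> eigsum W T (insert \<theta> \<Theta>)"
    using assms(2,3) uW by (intro eigsumI[of _ _ \<theta>] subspace_diff) auto
  moreover have "u \<in> eigsum W T (insert \<theta> \<Theta>)"
    using u(1) eigsum_mono[of \<Theta> "insert \<theta> \<Theta>"] by blast
  ultimately have "(v - u) + u \<in> eigsum W T (insert \<theta> \<Theta>)"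
    by (rule subspace_add[OF subspace_eigsum])
  then show ?thesis by simp
qed

lemma eigsum_finite:
  assumes "v \<in> eigsum W T \<Theta>"
  obtains \<Theta>' where "finite \<Theta>'" "\<Theta>' \<subseteq> \<Theta>" "v \<in> eigsum W T \<Theta>'"
proof -
  have "eigsum W T \<Theta> \<subseteq> {v. \<exists>\<Theta>'. finite \<Theta>' \<and> \<Theta>' \<subseteq> \<Theta> \<and> v \<in> eigsum W T \<Theta>'}"
  proof (rule eigsum_minimal)
    show "subspace {v. \<exists>\<Theta>'. finite \<Theta>' \<and> \<Theta>' \<subseteq> \<Theta> \<and> v \<in> eigsum W T \<Theta>'}"
    proof (rule subspaceI; clarify)
      show "\<exists>\<Theta>'. finite \<Theta>' \<and> \<Theta>' \<subseteq> \<Theta> \<and> 0 \<in> eigsum W T \<Theta>'"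
        by (intro exI[of _ "{}"]) auto
    next
      fix x y \<Theta>1 \<Theta>2
      assume "finite \<Theta>1" "\<Theta>1 \<subseteq> \<Theta>" "x \<in> eigsum W T \<Theta>1" "finite \<Theta>2" "\<Theta>2 \<subseteq> \<Theta>" "y \<in> eigsum W T \<Theta>2"
      then show "\<exists>\<Theta>'. finite \<Theta>' \<and> \<Theta>' \<subseteq> \<Theta> \<and> x + y \<in> eigsum W T \<Theta>'"
        using eigsum_mono[of \<Theta>1 "\<Theta>1 \<union> \<Theta>2" W T] eigsum_mono[of \<Theta>2 "\<Theta>1 \<union> \<Theta>2" W T]
        by (intro exI[of _ "\<Theta>1 \<union> \<Theta>2"]) (auto intro!: subspace_add)
    next
      fix c x \<Theta>'
      assume "finite \<Theta>'" "\<Theta>' \<subseteq> \<Theta>" "x \<in> eigsum W T \<Theta>'"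
      then show "\<exists>\<Theta>'. finite \<Theta>' \<and> \<Theta>' \<subseteq> \<Theta> \<and> c *s x \<in> eigsum W T \<Theta>'"
        by (intro exI[of _ \<Theta>']) (auto intro!: subspace_scale)
    qed
  next
    fix v \<theta> assume "v \<in> W" "\<theta> \<in> \<Theta>" "T v = \<theta> *s v"
    then show "v \<in> {v. \<exists>\<Theta>'. finite \<Theta>' \<and> \<Theta>' \<subseteq> \<Theta> \<and> v \<in> eigsum W T \<Theta>'}"
      by (auto intro!: exI[of _ "{\<theta>}"] eigsumI)
  qed
  then show ?thesis using assms that by blast
qed

lemma eigsum_insertE:
  assumes "endo W T" "subspace W" "v \<in> eigsum W T (insert \<theta> \<Theta>)"
  shows "T v - \<theta> *s v \<in> eigsum W T \<Theta>"
proof -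
  have lin: "lin_on W (\<lambda>v. T v - \<theta> *s v)"
    unfolding lin_on_def
    by (auto simp: endo_add[OF assms(1)] endo_scale[OF assms(1)] scale_right_distrib scale_right_diff_distrib mult.commute)
  show ?thesis
  proof (rule eigsum_image[OF lin assms(2) subspace_eigsum _ assms(3)])
    fix v \<eta> assume v: "v \<in> W" "\<eta> \<in> insert \<theta> \<Theta>" "T v = \<eta> *s v"
    show "T v - \<theta> *s v \<in> eigsum W T \<Theta>"
    proof (cases "\<eta> = \<theta>")
      case True
      then show ?thesis using v by (simp add: subspace_0)
    next
      case False
      then have "v \<in> eigsum W T \<Theta>" using v by (auto intro: eigsumI)
      then show ?thesis using v by (auto intro!: subspace_diff subspace_scale)
    qed
  qed
qed

text \<open>Eigenvectors with different eigenvalues are linearly independent.\<close>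

lemma eigenvector_in_eigsum:
  assumes "endo W T" "subspace W" "v \<in> eigsum W T \<Theta>" "T v = \<theta> *s v" "\<theta> \<notin> \<Theta>"
  shows "v = 0"
proof -
  obtain \<Theta>' where "finite \<Theta>'" "\<Theta>' \<subseteq> \<Theta>" "v \<in> eigsum W T \<Theta>'"
    using eigsum_finite[OF assms(3)] .
  moreover have "v \<in> eigsum W T F \<Longrightarrow> \<theta> \<notin> F \<Longrightarrow> v = 0" if "finite F" for F
    using that
  proof (induction F)
    case (insert \<eta> F)
    have "T v - \<eta> *s v \<in> eigsum W T F"
      by (rule eigsum_insertE) (use assms insert.prems in auto)
    then have "(\<theta> - \<eta>) *s v \<in> eigsum W T F"
      by (simp add: assms(4) scale_left_diff_distrib)
    then have "(1 / (\<theta> - \<eta>)) *s ((\<theta> - \<eta>) *s v) \<in> eigsum W T F"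
      by (rule subspace_scale[OF subspace_eigsum])
    then have "v \<in> eigsum W T F" using insert.prems by simp
    then show ?case using insert by blast
  qed auto
  ultimately show ?thesis using assms(5) by blast
qed

text \<open>
  The eigencomponents of \<open>v\<close> are polynomials in \<open>T\<close> applied to \<open>v\<close>, so an invariant subspace that
  contains \<open>v\<close> contains them too. The induction on the number of eigenvalues avoids polynomials.
\<close>

lemma eigsum_Int_invariant:
  assumes T: "endo W T" and W: "subspace W" and U: "subspace U" "U \<subseteq> W" "\<And>u. u \<in> U \<Longrightarrow> T u \<in> U"
    and v: "v \<in> U" "v \<in> eigsum W T \<Theta>"
  shows "v \<in> eigsum U T \<Theta>"
proof -
  have TU: "endo U T" by (rule endo_restrict) (use T U in auto)
  obtain F where F: "finite F" "F \<subseteq> \<Theta>" "v \<in> eigsum W T F"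
    using eigsum_finite[OF v(2)] .
  have "v \<in> U \<Longrightarrow> v \<in> eigsum W T F \<Longrightarrow> v \<in> eigsum U T F" if "finite F" for F v
    using that
  proof (induction F arbitrary: v)
    case (insert \<theta> F)
    have "T v - \<theta> *s v \<in> eigsum W T F"
      by (rule eigsum_insertE[OF T W insert.prems(2)])
    moreover have "T v - \<theta> *s v \<in> U"
      using insert.prems(1) U by (auto intro: subspace_diff subspace_scale)
    ultimately have "T v - \<theta> *s v \<in> eigsum U T F" by (rule insert.IH[rotated])
    then show ?case using eigsum_step[OF TU U(1)] insert by blast
  qed auto
  then show ?thesis using F v(1) eigsum_mono[of F \<Theta> U T] by blast
qed

lemma eigsum_Int:
  assumes T: "endo W T" and W: "subspace W"
  shows "eigsum W T \<Theta> \<inter> eigsum W T \<Theta>' = eigsum W T (\<Theta> \<inter> \<Theta>')"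
proof
  show "eigsum W T (\<Theta> \<inter> \<Theta>') \<subseteq> eigsum W T \<Theta> \<inter> eigsum W T \<Theta>'"
    by (simp add: eigsum_mono)
  let ?U = "eigsum W T \<Theta>'"
  show "eigsum W T \<Theta> \<inter> eigsum W T \<Theta>' \<subseteq> eigsum W T (\<Theta> \<inter> \<Theta>')"
  proof safe
    fix v assume v: "v \<in> eigsum W T \<Theta>" "v \<in> ?U"
    have "v \<in> eigsum ?U T \<Theta>"
      by (rule eigsum_Int_invariant[OF T W])
        (use v eigsum_subset[OF W] eigsum_invariant[OF T W] in auto)
    moreover have "eigsum ?U T \<Theta> \<subseteq> eigsum W T (\<Theta> \<inter> \<Theta>')"
    proof (rule eigsum_minimal)
      fix u \<theta> assume u: "u \<in> ?U" "\<theta> \<in> \<Theta>" "T u = \<theta> *s u"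
      show "u \<in> eigsum W T (\<Theta> \<inter> \<Theta>')"
      proof (cases "\<theta> \<in> \<Theta>'")
        case True
        then show ?thesis using u eigsum_subset[OF W] by (intro eigsumI[of _ _ \<theta>]) auto
      next
        case False
        then have "u = 0" using eigenvector_in_eigsum[OF T W u(1,3)] by blast
        then show ?thesis by (simp add: subspace_0)
      qed
    qed simp
    ultimately show "v \<in> eigsum W T (\<Theta> \<inter> \<Theta>')" by blast
  qed
qed

lemma eigsum_eigenvalues:
  assumes "\<And>v \<theta>. v \<in> W \<Longrightarrow> v \<noteq> 0 \<Longrightarrow> \<theta> \<in> \<Theta> \<Longrightarrow> T v = \<theta> *s v \<Longrightarrow> \<theta> \<in> \<Theta>'"
  shows "eigsum W T \<Theta> \<subseteq> eigsum W T \<Theta>'"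
proof (rule eigsum_minimal)
  fix v \<theta> assume "v \<in> W" "\<theta> \<in> \<Theta>" "T v = \<theta> *s v"
  then show "v \<in> eigsum W T \<Theta>'"
    using assms by (cases "v = 0") (auto intro: eigsumI subspace_0)
qed simp

end

section \<open>Geometric sequences of eigenvalues\<close>

text \<open>
  The eigenvalues of the generators, ordered so that each is \<open>q\<^sup>2\<close> times the next. Indexing by all
  integers makes both ends of the spectrum invisible: an index outside the spectrum just has a zero
  eigenspace. Being injective encodes that \<open>q\<close> is not a root of unity.
\<close>

definition q_sequence :: "'f::field \<Rightarrow> (int \<Rightarrow> 'f) \<Rightarrow> bool" where
  "q_sequence q \<theta> \<longleftrightarrow> q \<noteq> 0 \<and> inj \<theta> \<and> (\<forall>i. \<theta> i \<noteq> 0 \<and> \<theta> (i + 1) = \<theta> i / q\<^sup>2)"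

lemma q_sequence_nonzero: "q_sequence q \<theta> \<Longrightarrow> \<theta> i \<noteq> 0" "q_sequence q \<theta> \<Longrightarrow> q \<noteq> 0"
  and q_sequence_Suc: "q_sequence q \<theta> \<Longrightarrow> \<theta> (i + 1) = \<theta> i / q\<^sup>2"
  and q_sequence_inj: "q_sequence q \<theta> \<Longrightarrow> inj \<theta>"
  by (auto simp: q_sequence_def)

lemma q_sequence_pred: "q_sequence q \<theta> \<Longrightarrow> \<theta> (i - 1) = \<theta> i * q\<^sup>2"
  using q_sequence_Suc[of q \<theta> "i - 1"] by (simp add: q_sequence_nonzero)

text \<open>
  The quadratic relation is unchanged if its two operators are exchanged and \<open>q\<close> is inverted. The
  next two lemmas adapt eigenvalue sequences to this symmetry, so that statements about \<open>A\<close> and \<open>X\<close>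
  also yield the ones about \<open>X\<close> and \<open>B\<close>, and statements about \<open>A\<close> the converse ones about \<open>X\<close>.
\<close>

lemma q_sequence_inverse: "q_sequence q \<theta> \<Longrightarrow> q_sequence (inverse q) (\<lambda>i. inverse (\<theta> i))"
  unfolding q_sequence_def inj_def by (auto simp: field_simps)

lemma q_sequence_reverse:
  assumes "q_sequence q \<theta>"
  shows "q_sequence (inverse q) (\<lambda>i. \<theta> (- i))"
  unfolding q_sequence_def
proof (intro conjI allI)
  show "inj (\<lambda>i. \<theta> (- i))"
    using injD[OF q_sequence_inj[OF assms]] by (intro injI) (metis neg_equal_iff_equal)
  show "\<theta> (- (i + 1)) = \<theta> (- i) / (inverse q)\<^sup>2" for i
  proof -
    have "- (i + 1) = - i - 1" by simp
    then show ?thesis using q_sequence_pred[OF assms, of "- i"] by (simp only:) (simp add: field_simps)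
  qed
qed (use q_sequence_nonzero[OF assms] in auto)

lemma q_sequence_powi:
  fixes q :: "'f::field"
  assumes "q \<noteq> 0" "not_root_of_unity q"
  shows "q_sequence q (\<lambda>i. q powi (k - 2 * i))"
  unfolding q_sequence_def
proof (intro conjI allI)
  show "inj (\<lambda>i. q powi (k - 2 * i))"
  proof (rule injI, rule ccontr)
    fix i j assume eq: "q powi (k - 2 * i) = q powi (k - 2 * j)" and "i \<noteq> j"
    have *: False if eq: "q powi (k - 2 * i) = q powi (k - 2 * j)" and "i < j" for i j
    proof -
      have "q powi (2 * (j - i)) = q powi ((k - 2 * i) - (k - 2 * j))"
        by (simp add: algebra_simps)
      also have "\<dots> = 1"
        using assms(1) eq by (simp add: power_int_diff)
      finally have "q ^ nat (2 * (j - i)) = 1"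
        using that(2) by (simp add: power_int_def)
      moreover have "nat (2 * (j - i)) > 0" using that(2) by simp
      ultimately show False using assms(2) unfolding not_root_of_unity_def by blast
    qed
    show False using *[OF eq] *[OF eq[symmetric]] \<open>i \<noteq> j\<close> by linarith
  qed
  show "q powi (k - 2 * (i + 1)) = q powi (k - 2 * i) / q\<^sup>2" for i
  proof -
    have "q powi (k - 2 * (i + 1)) = q powi ((k - 2 * i) - 2)" by (simp add: algebra_simps)
    also have "\<dots> = q powi (k - 2 * i) / q powi 2" using assms(1) by (simp only: power_int_diff simp_thms)
    finally show ?thesis by simp
  qed
qed (use assms in auto)

lemma q_sequence_q2:
  assumes "q_sequence q \<theta>"
  shows "q\<^sup>2 \<noteq> 1" "q - inverse q \<noteq> 0"
proof -
  have "\<theta> 1 \<noteq> \<theta> 0" using q_sequence_inj[OF assms] by (simp add: inj_eq)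
  then show *: "q\<^sup>2 \<noteq> 1" using q_sequence_Suc[OF assms, of 0] by auto
  show "q - inverse q \<noteq> 0"
    using * q_sequence_nonzero(2)[OF assms] by (auto simp: field_simps power2_eq_square)
qed

lemma q3_eq:
  fixes q :: "'f::field"
  assumes "q \<noteq> 0" "q - inverse q \<noteq> 0"
  shows "q3 q = q\<^sup>2 + 1 + inverse q ^ 2"
proof -
  have "q ^ 3 - inverse q ^ 3 = (q\<^sup>2 + 1 + inverse q ^ 2) * (q - inverse q)"
    using assms(1) by (simp add: field_simps power2_eq_square power3_eq_cube)
  then show ?thesis using assms(2) by (simp add: q3_def)
qed

lemma q3_inverse: "q3 (inverse q) = q3 q"
proof -
  have "q3 (inverse q) = (- (q ^ 3 - inverse q ^ 3)) / (- (q - inverse q))" by (simp add: q3_def)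
  then show ?thesis unfolding q3_def by (simp only: minus_divide_divide)
qed

text \<open>
  Vieta's formulas: on an eigenvector with eigenvalue \<open>\<theta> i\<close> the cubic relation is a cubic
  polynomial in the operator, and its roots are three consecutive terms of the sequence.
\<close>

lemma q_sequence_vieta:
  assumes "q_sequence q \<theta>"
  shows "\<theta> (i - 1) + \<theta> i + \<theta> (i + 1) = q3 q * \<theta> i"
    and "\<theta> (i - 1) * \<theta> i + \<theta> i * \<theta> (i + 1) + \<theta> (i + 1) * \<theta> (i - 1) = q3 q * \<theta> i * \<theta> i"
    and "\<theta> (i - 1) * \<theta> i * \<theta> (i + 1) = \<theta> i * \<theta> i * \<theta> i"
proof -
  note q = q_sequence_nonzero[OF assms] q_sequence_q2[OF assms]
  show "\<theta> (i - 1) + \<theta> i + \<theta> (i + 1) = q3 q * \<theta> i"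
    "\<theta> (i - 1) * \<theta> i + \<theta> i * \<theta> (i + 1) + \<theta> (i + 1) * \<theta> (i - 1) = q3 q * \<theta> i * \<theta> i"
    "\<theta> (i - 1) * \<theta> i * \<theta> (i + 1) = \<theta> i * \<theta> i * \<theta> i"
    unfolding q_sequence_pred[OF assms] q_sequence_Suc[OF assms] q3_eq[OF q(2,4)]
    using q by (simp_all add: field_simps power2_eq_square)
qed

lemma image_reverse: "(\<lambda>i. \<theta> (- i)) ` {- j..} = \<theta> ` {..j :: int}"
  "(\<lambda>i. \<theta> (- i)) ` {..- j} = \<theta> ` {j..}"
proof -
  have *: "(\<lambda>i. \<theta> (- i)) ` I = \<theta> ` uminus ` I" for I
    by (simp only: image_image)
  show "(\<lambda>i. \<theta> (- i)) ` {- j..} = \<theta> ` {..j}" "(\<lambda>i. \<theta> (- i)) ` {..- j} = \<theta> ` {j..}"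
    unfolding * by simp_all
qed

section \<open>The relations on eigenvectors\<close>

context operator_space
begin

definition q_weyl :: "'b set \<Rightarrow> 'a \<Rightarrow> ('b \<Rightarrow> 'b) \<Rightarrow> ('b \<Rightarrow> 'b) \<Rightarrow> bool" where
  "q_weyl W q A X \<longleftrightarrow>
     (\<forall>v\<in>W. q *s A (X v) - inverse q *s X (A v) = (q - inverse q) *s v)"

definition serre :: "'b set \<Rightarrow> 'a \<Rightarrow> ('b \<Rightarrow> 'b) \<Rightarrow> ('b \<Rightarrow> 'b) \<Rightarrow> bool" where
  "serre W q A B \<longleftrightarrow>
     (\<forall>v\<in>W. A (A (A (B v))) - q3 q *s A (A (B (A v))) + q3 q *s A (B (A (A v)))
        - B (A (A (A v))) = 0)"

definition irreducible_under :: "'b set \<Rightarrow> ('b \<Rightarrow> 'b) set \<Rightarrow> bool" where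
  "irreducible_under W \<F> \<longleftrightarrow> W \<noteq> {0} \<and>
     (\<forall>U. subspace U \<and> U \<subseteq> W \<and> (\<forall>T\<in>\<F>. \<forall>u\<in>U. T u \<in> U) \<longrightarrow> U = {0} \<or> U = W)"

lemma q_weyl_swap: "q_weyl W (inverse q) X A \<longleftrightarrow> q_weyl W q A X"
proof -
  have "inverse q *s X (A v) - q *s A (X v) = (inverse q - q) *s v \<longleftrightarrow>
      q *s A (X v) - inverse q *s X (A v) = (q - inverse q) *s v" for v
    unfolding minus_diff_eq[of q "inverse q", symmetric] scale_minus_left
      minus_diff_eq[of "q *s A (X v)" "inverse q *s X (A v)", symmetric] neg_equal_iff_equal ..
  then show ?thesis by (simp add: q_weyl_def)
qed

text \<open>
  Since \<open>A v = t v\<close>, the relation reads \<open>(A - t / q\<^sup>2) X v = (1 - 1 / q\<^sup>2) v\<close>, and the right-hand side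
  is \<open>(A - t / q\<^sup>2) (v / t)\<close>.
\<close>

lemma q_weyl_eigenvector:
  assumes "q_weyl W q A X" "endo W A" "endo W X" "subspace W" "q \<noteq> 0"
    and "v \<in> W" "A v = t *s v" "t \<noteq> 0"
  shows "A (X v - inverse t *s v) = (t / q\<^sup>2) *s (X v - inverse t *s v)"
proof -
  have "q *s A (X v) = (inverse q * t) *s X v + (q - inverse q) *s v"
    using assms(1,6) endo_scale[OF assms(3,6)] assms(7) unfolding q_weyl_def by (auto simp: diff_eq_eq)
  then have "inverse q *s (q *s A (X v)) =
      inverse q *s ((inverse q * t) *s X v + (q - inverse q) *s v)" by simp
  then have AX: "A (X v) = (t / q\<^sup>2) *s X v + (1 - 1 / q\<^sup>2) *s v"
    using assms(5) by (simp add: scale_right_distrib field_simps power2_eq_square)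
  have "A (X v - inverse t *s v) = A (X v) - inverse t *s A v"
    using endo_diff[OF assms(2,4) endo_closed[OF assms(3,6)] subspace_scale[OF assms(4,6)]]
      endo_scale[OF assms(2,6)] by simp
  also have "\<dots> = (t / q\<^sup>2) *s X v - (1 / q\<^sup>2) *s v"
    using assms(7,8) AX by (simp add: scale_left_diff_distrib)
  also have "\<dots> = (t / q\<^sup>2) *s (X v - inverse t *s v)"
    using assms(8) by (simp add: scale_right_diff_distrib)
  finally show ?thesis .
qed

lemma cubic_factor:
  fixes a b c :: 'a
  assumes "endo W A" "subspace W" "w \<in> W"
  defines "w1 \<equiv> A w - a *s w"
  defines "w2 \<equiv> A w1 - b *s w1"
  shows "A w2 - c *s w2 = A (A (A w)) - (a + b + c) *s A (A w) + (a * b + b * c + c * a) *s A w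
    - (a * b * c) *s w"
proof -
  note [simp] = endo_closed[OF assms(1)] subspace_scale[OF assms(2)] subspace_diff[OF assms(2)]
  have "w1 \<in> W" using assms(3) by (simp add: w1_def)
  have 1: "A w1 = A (A w) - a *s A w"
    using assms(3) unfolding w1_def by (simp add: endo_diff[OF assms(1,2)] endo_scale[OF assms(1)])
  have 2: "A w2 = A (A (A w)) - a *s A (A w) - b *s (A (A w) - a *s A w)"
    using assms(3) \<open>w1 \<in> W\<close> unfolding w2_def
    by (simp add: endo_diff[OF assms(1,2)] endo_scale[OF assms(1)] 1)
  show "A w2 - c *s w2 = A (A (A w)) - (a + b + c) *s A (A w) + (a * b + b * c + c * a) *s A w
    - (a * b * c) *s w"
    unfolding 2 unfolding w2_def 1 unfolding w1_def
    by (simp add: scale_right_diff_distrib scale_left_distrib algebra_simps)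
qed

text \<open>
  Applied to an eigenvector of \<open>A\<close>, the cubic relation says that \<open>(A - \<theta> (i - 1)) (A - \<theta> i) (A - \<theta> (i + 1))\<close>
  annihilates \<open>B v\<close>. If \<open>A\<close> is diagonalizable, it is equivalent to this property.
\<close>

lemma serre_eigenvector:
  assumes "serre W q A B" "endo W A" "endo W B" "subspace W" "q_sequence q \<theta>"
    and "v \<in> W" "A v = \<theta> i *s v"
  shows "B v \<in> eigsum W A (\<theta> ` {i - 1..i + 1})"
proof -
  let ?a = "\<theta> (i - 1)" and ?b = "\<theta> i" and ?c = "\<theta> (i + 1)"
  note c3 = q_sequence_vieta[OF assms(5), of i]
  have Bv: "B v \<in> W" using endo_closed[OF assms(3,6)] .
  define w1 where "w1 = A (B v) - ?a *s B v"
  define w2 where "w2 = A w1 - ?b *s w1"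
  note cub = cubic_factor[OF assms(2,4) Bv, of ?a ?b ?c, folded w1_def, folded w2_def]
  have cW: "w1 \<in> W" "w2 \<in> W"
    unfolding w2_def w1_def
    by (intro subspace_diff subspace_scale endo_closed[OF assms(2)] assms(4) Bv)+
  have tv: "t *s v \<in> W" for t using subspace_scale[OF assms(4,6)] .
  have A2: "A (A v) = (?b * ?b) *s v" and A3: "A (A (A v)) = (?b * ?b * ?b) *s v"
    using assms(7) by (simp_all add: endo_scale[OF assms(2)] assms(6) tv mult.assoc)
  have "A w2 - ?c *s w2 = 0"
    using bspec[OF assms(1)[unfolded serre_def] assms(6)] unfolding cub c3
    by (simp add: A2 A3 endo_scale[OF assms(2)] endo_scale[OF assms(3)] assms(6,7) tv Bv
        endo_closed[OF assms(2)] mult.assoc)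
  then have "w2 \<in> eigsum W A {?c}"
    using cW(2) by (intro eigsumI[of _ _ ?c]) auto
  then have "w1 \<in> eigsum W A {?b, ?c}"
    using q_sequence_inj[OF assms(5)]
    by (intro eigsum_step[OF assms(2,4) cW(1), of ?b "{?c}"]) (auto simp: w2_def inj_eq)
  then have "B v \<in> eigsum W A {?a, ?b, ?c}"
    using q_sequence_inj[OF assms(5)]
    by (intro eigsum_step[OF assms(2,4) Bv, of ?a "{?b, ?c}"]) (auto simp: w1_def inj_eq)
  moreover have "{?a, ?b, ?c} \<subseteq> \<theta> ` {i - 1..i + 1}" by auto
  ultimately show ?thesis using eigsum_mono by blast
qed

lemma serre_from_eigenvectors:
  assumes "endo W A" "endo W B" "subspace W" "q_sequence q \<theta>" "W \<subseteq> eigsum W A (range \<theta>)"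
    and tri: "\<And>i v. v \<in> W \<Longrightarrow> A v = \<theta> i *s v \<Longrightarrow> B v \<in> eigsum W A (\<theta> ` {i - 1..i + 1})"
  shows "serre W q A B"
proof -
  note [simp] = endo_closed[OF assms(1)] endo_closed[OF assms(2)] subspace_scale[OF assms(3)]
    subspace_diff[OF assms(3)] subspace_add[OF assms(3)]
  note lin = endo_add[OF assms(1)] endo_add[OF assms(2)] endo_scale[OF assms(1)]
    endo_scale[OF assms(2)]
  define S where "S v = A (A (A (B v))) - q3 q *s A (A (B (A v))) + q3 q *s A (B (A (A v)))
        - B (A (A (A v)))" for v
  have "lin_on W S"
    unfolding lin_on_def S_def
    by (auto simp: lin scale_right_distrib scale_right_diff_distrib mult.commute)
  moreover have "S v = 0" if v: "v \<in> W" "A v = \<theta> i *s v" for v i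
  proof -
    let ?a = "\<theta> (i - 1)" and ?b = "\<theta> i" and ?c = "\<theta> (i + 1)"
    note c3 = q_sequence_vieta[OF assms(4), of i]
    have Bv: "B v \<in> W" using v by simp
    define w1 where "w1 = A (B v) - ?a *s B v"
    define w2 where "w2 = A w1 - ?b *s w1"
    note cub = cubic_factor[OF assms(1,3) Bv, of ?a ?b ?c, folded w1_def, folded w2_def]
    have "{i - 1..i + 1} = {i - 1, i, i + 1}" by auto
    then have "B v \<in> eigsum W A {?a, ?b, ?c}" using tri[OF v] by simp
    then have "w1 \<in> eigsum W A {?b, ?c}"
      unfolding w1_def by (rule eigsum_insertE[OF assms(1,3)])
    then have "w2 \<in> eigsum W A {?c}"
      unfolding w2_def by (rule eigsum_insertE[OF assms(1,3)])
    then have "A w2 - ?c *s w2 \<in> eigsum W A {}"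
      by (rule eigsum_insertE[OF assms(1,3)])
    then have "A w2 - ?c *s w2 = 0" by simp
    moreover have "A (A v) = (?b * ?b) *s v" "A (A (A v)) = (?b * ?b * ?b) *s v"
      using v by (simp_all add: lin mult.assoc)
    ultimately show ?thesis
      using v unfolding S_def cub c3 by (simp add: lin mult.assoc)
  qed
  ultimately have "S v \<in> {0}" if "v \<in> eigsum W A (range \<theta>)" for v
    using that by (intro eigsum_image[of W S "{0}" "range \<theta>" A v]) (use assms(3) in auto)
  then have "S v = 0" if "v \<in> W" for v
    using that assms(5) by blast
  then show ?thesis by (simp add: serre_def S_def)
qed

text \<open>
  Descending induction: the hypothesis puts \<open>(X - \<phi> i) v\<close> one step further up, and beyond \<open>N\<close> there is
  nothing left.
\<close>

lemma flag_upward: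
  assumes X: "endo W X" and W: "subspace W" and A: "endo W A"
    and inj: "inj \<theta>" "inj \<phi>"
    and bound: "W \<subseteq> eigsum W A (\<theta> ` {..N::int})"
    and step: "\<And>i v. v \<in> W \<Longrightarrow> A v = \<theta> i *s v \<Longrightarrow>
        A (X v - \<phi> i *s v) = \<theta> (i + 1) *s (X v - \<phi> i *s v)"
  shows "eigsum W A (\<theta> ` {j..}) \<subseteq> eigsum W X (\<phi> ` {j..})"
proof (rule eigsum_minimal)
  have *: "v \<in> W \<Longrightarrow> A v = \<theta> i *s v \<Longrightarrow> v \<in> eigsum W X (\<phi> ` {i..})" for v i
  proof (induction "nat (N + 1 - i)" arbitrary: v i rule: less_induct)
    case less
    show ?case
    proof (cases "i \<le> N")
      case True
      have "X v - \<phi> i *s v \<in> W"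
        using less.prems by (intro subspace_diff subspace_scale W endo_closed[OF X])
      then have "X v - \<phi> i *s v \<in> eigsum W X (\<phi> ` {i + 1..})"
        using True step[OF less.prems] by (intro less.hyps) auto
      then have "v \<in> eigsum W X (insert (\<phi> i) (\<phi> ` {i + 1..}))"
        using less.prems inj(2) by (intro eigsum_step[OF X W]) (auto simp: inj_eq)
      moreover have "insert (\<phi> i) (\<phi> ` {i + 1..}) \<subseteq> \<phi> ` {i..}" by auto
      ultimately show ?thesis using eigsum_mono by blast
    next
      case False
      then have "\<theta> i \<notin> \<theta> ` {..N}" using inj(1) by (auto simp: inj_eq)
      then have "v = 0"
        using eigenvector_in_eigsum[OF A W _ less.prems(2)] bound less.prems(1) by blast
      then show ?thesis by (simp add: subspace_0)
    qed
  qed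
  fix v t assume v: "v \<in> W" "t \<in> \<theta> ` {j..}" "A v = t *s v"
  then obtain i where i: "t = \<theta> i" "j \<le> i" by auto
  then have "v \<in> eigsum W X (\<phi> ` {i..})" using * v by blast
  moreover have "\<phi> ` {i..} \<subseteq> \<phi> ` {j..}" using i by auto
  ultimately show "v \<in> eigsum W X (\<phi> ` {j..})" using eigsum_mono by blast
qed simp

lemma q_weyl_flag_upward:
  assumes "q_weyl W q A X" "endo W A" "endo W X" "subspace W" "q_sequence q \<theta>"
    and "W \<subseteq> eigsum W A (\<theta> ` {..N})"
  shows "eigsum W A (\<theta> ` {j..}) \<subseteq> eigsum W X ((\<lambda>i. inverse (\<theta> i)) ` {j..})"
proof (rule flag_upward[OF assms(3,4,2) q_sequence_inj[OF assms(5)]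
      q_sequence_inj[OF q_sequence_inverse[OF assms(5)]] assms(6)])
  fix i v assume v: "v \<in> W" "A v = \<theta> i *s v"
  note nz = q_sequence_nonzero[OF assms(5)]
  show "A (X v - inverse (\<theta> i) *s v) = \<theta> (i + 1) *s (X v - inverse (\<theta> i) *s v)"
    unfolding q_sequence_Suc[OF assms(5)]
    by (rule q_weyl_eigenvector[OF assms(1-4) nz(2) v nz(1)])
qed

lemma q_weyl_flag_downward:
  assumes "q_weyl W q X B" "endo W B" "endo W X" "subspace W" "q_sequence q \<theta>"
    and "W \<subseteq> eigsum W B (\<theta> ` {a..})"
  shows "eigsum W B (\<theta> ` {..j}) \<subseteq> eigsum W X ((\<lambda>i. inverse (\<theta> i)) ` {..j})"
  using q_weyl_flag_upward[of W "inverse q" B X "\<lambda>i. \<theta> (- i)" "- a" "- j"]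
    assms q_sequence_reverse[OF assms(5)]
  by (simp add: q_weyl_swap image_reverse image_reverse(1)[of "\<lambda>i. inverse (\<theta> i)"])

lemma q_weyl_step_up:
  assumes "q_weyl W q A X" "endo W A" "endo W X" "subspace W" "q_sequence q \<theta>"
    and "v \<in> W" "A v = \<theta> i *s v"
  shows "X v \<in> eigsum W A (\<theta> ` {i..i + 1})"
proof -
  note nz = q_sequence_nonzero[OF assms(5)]
  have "A (X v - inverse (\<theta> i) *s v) = \<theta> (i + 1) *s (X v - inverse (\<theta> i) *s v)"
    unfolding q_sequence_Suc[OF assms(5)]
    by (rule q_weyl_eigenvector[OF assms(1-4) nz(2) assms(6,7) nz(1)])
  then have "X v - inverse (\<theta> i) *s v \<in> eigsum W A (\<theta> ` {i..i + 1})"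
    by (intro eigsumI[of _ _ "\<theta> (i + 1)"] subspace_diff subspace_scale
        endo_closed[OF assms(3)] assms(4,6)) auto
  moreover have "inverse (\<theta> i) *s v \<in> eigsum W A (\<theta> ` {i..i + 1})"
    using assms(6,7) by (intro subspace_scale[OF subspace_eigsum] eigsumI[of _ _ "\<theta> i"]) auto
  ultimately have "X v - inverse (\<theta> i) *s v + inverse (\<theta> i) *s v \<in> eigsum W A (\<theta> ` {i..i + 1})"
    by (rule subspace_add[OF subspace_eigsum])
  then show ?thesis by simp
qed

lemma q_weyl_step_down:
  assumes "q_weyl W q X B" "endo W B" "endo W X" "subspace W" "q_sequence q \<theta>"
    and "v \<in> W" "B v = \<theta> i *s v"
  shows "X v \<in> eigsum W B (\<theta> ` {i - 1..i})"
proof -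
  have "X v \<in> eigsum W B ((\<lambda>i. \<theta> (- i)) ` {- i..- i + 1})"
    by (rule q_weyl_step_up[OF _ assms(2,3,4) q_sequence_reverse[OF assms(5)]])
      (use assms in \<open>simp_all add: q_weyl_swap\<close>)
  moreover have "(\<lambda>i. \<theta> (- i)) ` {- i..- i + 1} \<subseteq> \<theta> ` {i - 1..i}" by auto
  ultimately show ?thesis using eigsum_mono by blast
qed

section \<open>Existence of the intermediate operator\<close>

text \<open>
  The directness hypothesis is asymmetric because for the split decomposition below it is one
  instance of the vanishing of an intersection of flags.
\<close>

lemma operator_on_direct_sum:
  fixes U :: "nat \<Rightarrow> 'b set" and c :: "nat \<Rightarrow> 'a"
  assumes sub: "\<And>i. subspace (U i)" and indep: "\<And>i. U i \<inter> span (\<Union>k<i. U k) \<subseteq> {0}"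
  shows "\<exists>X. endo (span (\<Union>k<n. U k)) X \<and> (\<forall>i<n. \<forall>u\<in>U i. X u = c i *s u)"
proof (induction n)
  case 0
  show ?case by (intro exI[of _ "\<lambda>_. 0"]) (simp add: endo_def lin_on_def)
next
  case (Suc n)
  let ?S = "span (\<Union>k<n. U k)" and ?S' = "span (\<Union>k<Suc n. U k)"
  obtain X where X: "endo ?S X" "\<And>i u. i < n \<Longrightarrow> u \<in> U i \<Longrightarrow> X u = c i *s u"
    using Suc.IH by blast
  have "(\<Union>k<Suc n. U k) = (\<Union>k<n. U k) \<union> U n" by (auto simp: less_Suc_eq)
  then have S': "?S' = {x + y | x y. x \<in> ?S \<and> y \<in> U n}"
    using span_eq_iff[THEN iffD2, OF sub[of n]] by (simp only: span_Un)
  define p where "p v = (SOME (x, y). x \<in> ?S \<and> y \<in> U n \<and> v = x + y)" for v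
  define X' where "X' v = X (fst (p v)) + c n *s snd (p v)" for v
  have X': "X' (x + y) = X x + c n *s y" if xy: "x \<in> ?S" "y \<in> U n" for x y
  proof -
    have "\<exists>z. case z of (x', y') \<Rightarrow> x' \<in> ?S \<and> y' \<in> U n \<and> x + y = x' + y'"
      using xy by (intro exI[of _ "(x, y)"]) auto
    then have "case p (x + y) of (x', y') \<Rightarrow> x' \<in> ?S \<and> y' \<in> U n \<and> x + y = x' + y'"
      unfolding p_def by (rule someI_ex)
    then obtain x' y' where p: "p (x + y) = (x', y')" "x' \<in> ?S" "y' \<in> U n" "x + y = x' + y'"
      by (cases "p (x + y)") auto
    have "y - y' = x' - x" using p(4) by (simp add: algebra_simps)
    moreover have "y - y' \<in> U n" using xy p sub by (intro subspace_diff) auto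
    moreover have "x' - x \<in> ?S" using xy p by (intro span_diff) auto
    ultimately have "y - y' = 0" using indep[of n] by auto
    then show ?thesis using p unfolding X'_def by simp
  qed
  have "endo ?S' X'"
    unfolding endo_def lin_on_def
  proof (intro conjI ballI allI)
    fix v w assume "v \<in> ?S'" "w \<in> ?S'"
    then obtain x y x' y' where xy: "v = x + y" "x \<in> ?S" "y \<in> U n" "w = x' + y'" "x' \<in> ?S" "y' \<in> U n"
      unfolding S' by blast
    have "X' (v + w) = X' ((x + x') + (y + y'))" using xy by (simp add: algebra_simps)
    also have "\<dots> = X (x + x') + c n *s (y + y')"
      using xy sub by (intro X' subspace_add subspace_span) auto
    also have "\<dots> = X' v + X' w"
      using xy by (simp add: X' endo_add[OF X(1)] scale_right_distrib algebra_simps)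
    finally show "X' (v + w) = X' v + X' w" .
  next
    fix t v assume "v \<in> ?S'"
    then obtain x y where xy: "v = x + y" "x \<in> ?S" "y \<in> U n"
      unfolding S' by blast
    have "X' (t *s v) = X' (t *s x + t *s y)" using xy by (simp add: scale_right_distrib)
    also have "\<dots> = X (t *s x) + c n *s (t *s y)"
      using xy sub by (intro X' subspace_scale subspace_span) auto
    also have "\<dots> = t *s X' v"
      using xy by (simp add: X' endo_scale[OF X(1)] scale_right_distrib mult.commute)
    finally show "X' (t *s v) = t *s X' v" .
  next
    fix v assume "v \<in> ?S'"
    then obtain x y where xy: "v = x + y" "x \<in> ?S" "y \<in> U n"
      unfolding S' by blast
    then have "X' v = X x + c n *s y" by (simp add: X')
    moreover have "X x \<in> ?S" "c n *s y \<in> U n"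
      using xy sub by (auto intro: endo_closed[OF X(1)] subspace_scale)
    ultimately show "X' v \<in> ?S'" unfolding S' by blast
  qed
  moreover have "X' u = c i *s u" if "i < Suc n" "u \<in> U i" for i u
  proof (cases "i = n")
    case True
    have "X' (0 + u) = X 0 + c n *s u"
      using that True by (intro X' span_zero) auto
    then show ?thesis using True lin_on_0[OF endo_lin[OF X(1)]] by simp
  next
    case False
    then have "u \<in> ?S" using that by (intro span_base) auto
    then have "X' (u + 0) = X u + c n *s 0"
      using sub by (intro X' subspace_0) auto
    then show ?thesis using X(2) that False by simp
  qed
  ultimately show ?case by blast
qed

lemma eigsum_shift_upward:
  assumes "endo W A" "subspace W" "v \<in> eigsum W A (\<theta> ` {j::int..})"
  shows "A v - \<theta> j *s v \<in> eigsum W A (\<theta> ` {j + 1..})"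
proof -
  have "\<theta> ` {j..} = insert (\<theta> j) (\<theta> ` {j + 1..})"
    by (subst image_insert[symmetric], rule arg_cong[of _ _ "image \<theta>"]) auto
  then show ?thesis using eigsum_insertE[OF assms(1,2)] assms(3) by simp
qed

lemma eigsum_shift_downward:
  assumes "endo W B" "subspace W" "v \<in> eigsum W B (\<theta> ` {..j::int})"
  shows "B v - \<theta> j *s v \<in> eigsum W B (\<theta> ` {..j - 1})"
proof -
  have "\<theta> ` {..j} = insert (\<theta> j) (\<theta> ` {..j - 1})"
    by (subst image_insert[symmetric], rule arg_cong[of _ _ "image \<theta>"]) auto
  then show ?thesis using eigsum_insertE[OF assms(1,2)] assms(3) by simp
qed

lemma eigsum_Int_disjoint:
  assumes "endo W T" "subspace W" "inj \<theta>" "I \<inter> J = {}"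
    and "v \<in> eigsum W T (\<theta> ` I)" "v \<in> eigsum W T (\<theta> ` J)"
  shows "v = 0"
proof -
  have "v \<in> eigsum W T (\<theta> ` I \<inter> \<theta> ` J)"
    using assms(5,6) eigsum_Int[OF assms(1,2)] by blast
  also have "\<theta> ` I \<inter> \<theta> ` J = {}"
    using assms(3,4) by (auto simp: inj_eq)
  finally show ?thesis by simp
qed

text \<open>
  The operator \<open>X\<close> is \<open>1 / \<theta> i\<close> on the part \<open>E B {..i} \<inter> E A {i..}\<close> of the split decomposition. That
  these parts span the space and are independent both come from irreducibility, by comparing with
  the shifted intersections \<open>E B {..i} \<inter> E A {i + r..}\<close>. On the \<open>i\<close>-th part, \<open>A - \<theta> i\<close> raises and
  \<open>B - \<theta> i\<close> lowers the index by one; this gives the two quadratic relations.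
\<close>

lemma weyl_operator_exists:
  assumes q: "q_sequence q \<theta>" and W: "subspace W" and A: "endo W A" and B: "endo W B"
    and irr: "irreducible_under W {A, B}" and serre: "serre W q A B" "serre W q B A"
    and WA: "W \<subseteq> eigsum W A (\<theta> ` {a..N})" and WB: "W \<subseteq> eigsum W B (\<theta> ` {a..N})"
    and vA: "vA \<in> W" "vA \<noteq> 0" "A vA = \<theta> a *s vA"
    and vB: "vB \<in> W" "vB \<noteq> 0" "B vB = \<theta> a *s vB"
  shows "\<exists>X. endo W X \<and> q_weyl W q A X \<and> q_weyl W q X B"
proof -
  note inj = q_sequence_inj[OF q]
  define U where "U r i = eigsum W B (\<theta> ` {..i}) \<inter> eigsum W A (\<theta> ` {i + r..})" for r i :: int
  define Z where "Z r = span (\<Union>i. U r i)" for r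
  have sub: "subspace (U r i)" for r i
    unfolding U_def by (intro subspace_inter) auto
  have UW: "U r i \<subseteq> W" for r i
    unfolding U_def using eigsum_subset[OF W] by blast
  have UZ: "U r i \<subseteq> Z r" for r i
    unfolding Z_def by (intro order.trans[OF _ span_superset]) auto
  have ZW: "Z r \<subseteq> W" for r
    unfolding Z_def by (intro span_minimal W) (use UW in auto)
  have U_low: "u = 0" if "u \<in> U r i" "i < a" for u r i
    using that WB UW eigsum_Int_disjoint[OF B W inj, of "{..i}" "{a..N}" u]
    unfolding U_def by fastforce
  have U_high: "u = 0" if "u \<in> U 0 i" "i > N" for u i
    using that WA UW eigsum_Int_disjoint[OF A W inj, of "{i..}" "{a..N}" u]
    unfolding U_def by fastforce

  have raise: "A u - \<theta> (i + r) *s u \<in> U r (i + 1)" if u: "u \<in> U r i" for u r i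
  proof -
    have "A u \<in> eigsum W B (\<theta> ` {..i + 1})"
    proof (rule eigsum_image[OF endo_lin[OF A] W subspace_eigsum])
      show "u \<in> eigsum W B (\<theta> ` {..i})" using u by (simp add: U_def)
      fix v t assume v: "v \<in> W" "t \<in> \<theta> ` {..i}" "B v = t *s v"
      then obtain k where k: "k \<le> i" "B v = \<theta> k *s v" by auto
      have "A v \<in> eigsum W B (\<theta> ` {k - 1..k + 1})"
        by (rule serre_eigenvector[OF serre(2) B A W q v(1) k(2)])
      then show "A v \<in> eigsum W B (\<theta> ` {..i + 1})"
        using eigsum_mono[of "\<theta> ` {k - 1..k + 1}" "\<theta> ` {..i + 1}" W B] k(1) by force
    qed
    moreover have "u \<in> eigsum W B (\<theta> ` {..i + 1})"
      using u eigsum_mono[of "\<theta> ` {..i}" "\<theta> ` {..i + 1}" W B] unfolding U_def by force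
    ultimately have "A u - \<theta> (i + r) *s u \<in> eigsum W B (\<theta> ` {..i + 1})"
      by (intro subspace_diff subspace_scale subspace_eigsum)
    moreover have "A u - \<theta> (i + r) *s u \<in> eigsum W A (\<theta> ` {i + r + 1..})"
      using u unfolding U_def by (intro eigsum_shift_upward[OF A W]) auto
    ultimately show ?thesis unfolding U_def by (simp add: algebra_simps)
  qed
  have lower: "B u - \<theta> i *s u \<in> U r (i - 1)" if u: "u \<in> U r i" for u r i
  proof -
    have "B u \<in> eigsum W A (\<theta> ` {i + r - 1..})"
    proof (rule eigsum_image[OF endo_lin[OF B] W subspace_eigsum])
      show "u \<in> eigsum W A (\<theta> ` {i + r..})" using u by (simp add: U_def)
      fix v t assume v: "v \<in> W" "t \<in> \<theta> ` {i + r..}" "A v = t *s v"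
      then obtain k where k: "k \<ge> i + r" "A v = \<theta> k *s v" by auto
      have "B v \<in> eigsum W A (\<theta> ` {k - 1..k + 1})"
        by (rule serre_eigenvector[OF serre(1) A B W q v(1) k(2)])
      then show "B v \<in> eigsum W A (\<theta> ` {i + r - 1..})"
        using eigsum_mono[of "\<theta> ` {k - 1..k + 1}" "\<theta> ` {i + r - 1..}" W A] k(1) by force
    qed
    moreover have "u \<in> eigsum W A (\<theta> ` {i + r - 1..})"
      using u eigsum_mono[of "\<theta> ` {i + r..}" "\<theta> ` {i + r - 1..}" W A] unfolding U_def by force
    ultimately have "B u - \<theta> i *s u \<in> eigsum W A (\<theta> ` {i + r - 1..})"
      by (intro subspace_diff subspace_scale subspace_eigsum)
    moreover have "B u - \<theta> i *s u \<in> eigsum W B (\<theta> ` {..i - 1})"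
      using u unfolding U_def by (intro eigsum_shift_downward[OF B W]) auto
    ultimately show ?thesis unfolding U_def by (simp add: algebra_simps)
  qed

  have Z_cases: "Z r = {0} \<or> Z r = W" for r
  proof -
    have "A z \<in> Z r" if "z \<in> Z r" for z
    proof (rule lin_on_span_image[OF endo_lin[OF A] W _ _ _ that[unfolded Z_def]])
      fix u assume "u \<in> (\<Union>i. U r i)"
      then obtain i where u: "u \<in> U r i" by blast
      then have "(A u - \<theta> (i + r) *s u) + \<theta> (i + r) *s u \<in> Z r"
        using raise[OF u] UZ unfolding Z_def by (intro span_add span_scale) auto
      then show "A u \<in> Z r" by simp
    qed (use UW in \<open>auto simp: Z_def\<close>)
    moreover have "B z \<in> Z r" if "z \<in> Z r" for z
    proof (rule lin_on_span_image[OF endo_lin[OF B] W _ _ _ that[unfolded Z_def]])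
      fix u assume "u \<in> (\<Union>i. U r i)"
      then obtain i where u: "u \<in> U r i" by blast
      then have "(B u - \<theta> i *s u) + \<theta> i *s u \<in> Z r"
        using lower[OF u] UZ unfolding Z_def by (intro span_add span_scale) auto
      then show "B u \<in> Z r" by simp
    qed (use UW in \<open>auto simp: Z_def\<close>)
    moreover have "subspace (Z r)" by (simp add: Z_def)
    ultimately show ?thesis using irr ZW unfolding irreducible_under_def by blast
  qed
  \<comment> \<open>\<open>Z 1\<close> lies above the lowest eigenspace of \<open>A\<close>, so it is a proper subspace.\<close>
  have Z1: "Z 1 = {0}"
  proof -
    have "Z 1 \<subseteq> eigsum W A (\<theta> ` {a + 1..})"
      unfolding Z_def
    proof (rule span_minimal)
      show "(\<Union>i. U 1 i) \<subseteq> eigsum W A (\<theta> ` {a + 1..})"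
      proof safe
        fix u i assume u: "u \<in> U 1 i"
        show "u \<in> eigsum W A (\<theta> ` {a + 1..})"
        proof (cases "i < a")
          case True
          then show ?thesis using U_low[OF u] by (simp add: subspace_0)
        next
          case False
          then have "\<theta> ` {i + 1..} \<subseteq> \<theta> ` {a + 1..}" by auto
          then show ?thesis using u eigsum_mono unfolding U_def by blast
        qed
      qed
    qed simp
    moreover have "vA \<notin> eigsum W A (\<theta> ` {a + 1..})"
    proof
      assume "vA \<in> eigsum W A (\<theta> ` {a + 1..})"
      then have "vA = 0"
        using inj by (intro eigenvector_in_eigsum[OF A W _ vA(3)]) (auto simp: inj_eq)
      then show False using vA(2) by simp
    qed
    ultimately show ?thesis using Z_cases[of 1] vA(1) by blast
  qed
  \<comment> \<open>\<open>Z 0\<close> contains the lowest eigenspace of \<open>B\<close>.\<close>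
  have Z0: "Z 0 = W"
  proof -
    have "vB \<in> eigsum W B (\<theta> ` {..a})"
      by (rule eigsumI[of _ _ "\<theta> a"]) (use vB in auto)
    moreover have "vB \<in> eigsum W A (\<theta> ` {a..})"
      using vB(1) WA eigsum_mono[of "\<theta> ` {a..N}" "\<theta> ` {a..}" W A] by force
    ultimately have "vB \<in> Z 0" using UZ[of 0 a] by (auto simp: U_def)
    then show ?thesis using Z_cases[of 0] vB(2) by auto
  qed

  define n where "n = nat (N + 1 - a)"
  define U' where "U' k = U 0 (a + int k)" for k
  have "span (\<Union>k<n. U' k) = W"
  proof
    show "span (\<Union>k<n. U' k) \<subseteq> W"
      by (intro span_minimal W) (use UW in \<open>auto simp: U'_def\<close>)
    have "(\<Union>i. U 0 i) \<subseteq> span (\<Union>k<n. U' k)"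
    proof safe
      fix u i assume u: "u \<in> U 0 i"
      show "u \<in> span (\<Union>k<n. U' k)"
      proof (cases "a \<le> i \<and> i \<le> N")
        case True
        then have "nat (i - a) < n" "u \<in> U' (nat (i - a))"
          using u by (auto simp: n_def U'_def)
        then show ?thesis by (intro span_base) blast
      next
        case False
        then have "u = 0" using U_low[OF u] U_high[OF u] by linarith
        then show ?thesis by (simp add: span_zero)
      qed
    qed
    then have "Z 0 \<subseteq> span (\<Union>k<n. U' k)"
      unfolding Z_def by (intro span_minimal) auto
    then show "W \<subseteq> span (\<Union>k<n. U' k)" using Z0 by simp
  qed
  moreover have "U' k \<inter> span (\<Union>l<k. U' l) \<subseteq> {0}" for k
  proof -
    have "span (\<Union>l<k. U' l) \<subseteq> eigsum W B (\<theta> ` {..a + int k - 1})"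
    proof (rule span_minimal)
      show "(\<Union>l<k. U' l) \<subseteq> eigsum W B (\<theta> ` {..a + int k - 1})"
      proof safe
        fix u l assume "l < k" "u \<in> U' l"
        moreover from \<open>l < k\<close> have "\<theta> ` {..a + int l} \<subseteq> \<theta> ` {..a + int k - 1}" by auto
        ultimately show "u \<in> eigsum W B (\<theta> ` {..a + int k - 1})"
          using eigsum_mono unfolding U'_def U_def by blast
      qed
    qed simp
    then have "U' k \<inter> span (\<Union>l<k. U' l) \<subseteq> U 1 (a + int k - 1)"
      unfolding U'_def U_def by auto
    then show ?thesis using UZ[of 1 "a + int k - 1"] Z1 by blast
  qed
  ultimately obtain X where X: "endo W X"
    and XU': "\<And>k u. k < n \<Longrightarrow> u \<in> U' k \<Longrightarrow> X u = inverse (\<theta> (a + int k)) *s u"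
    using operator_on_direct_sum[of U' n "\<lambda>k. inverse (\<theta> (a + int k))"] sub
    unfolding U'_def by auto
  have XU: "X u = inverse (\<theta> i) *s u" if u: "u \<in> U 0 i" for u i
  proof (cases "a \<le> i \<and> i \<le> N")
    case True
    then have "nat (i - a) < n" "u \<in> U' (nat (i - a))"
      using u by (auto simp: n_def U'_def)
    then show ?thesis using XU'[of "nat (i - a)" u] True by simp
  next
    case False
    then have "u = 0" using U_low[OF u] U_high[OF u] by linarith
    then show ?thesis using lin_on_0[OF endo_lin[OF X] W] by simp
  qed

  note closed [simp] = endo_closed[OF A] endo_closed[OF B] endo_closed[OF X] subspace_scale[OF W]
    subspace_add[OF W]
  note lin = endo_add[OF A] endo_add[OF B] endo_add[OF X] endo_scale[OF A] endo_scale[OF B]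
    endo_scale[OF X]
  note nz = q_sequence_nonzero[OF q]
  have vanish: "D v = 0" if "lin_on W D" "\<And>u i. u \<in> U 0 i \<Longrightarrow> D u = 0" "v \<in> W" for D v
  proof -
    have "D v \<in> {0}"
    proof (rule lin_on_span_image[OF that(1) W, of "{0}" "\<Union>i. U 0 i"])
      show "v \<in> span (\<Union>i. U 0 i)" using that(3) Z0 by (simp add: Z_def)
    qed (use UW that(2) in auto)
    then show ?thesis by simp
  qed
  have "q_weyl W q A X"
  proof -
    define D where "D v = q *s A (X v) - inverse q *s X (A v) - (q - inverse q) *s v" for v
    have "lin_on W D"
      unfolding lin_on_def D_def
      by (auto simp: lin scale_right_distrib scale_right_diff_distrib mult.commute)
    moreover have "D u = 0" if u: "u \<in> U 0 i" for u i
    proof -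
      define u' where "u' = A u - \<theta> i *s u"
      have uW: "u \<in> W" "u' \<in> W" and u': "u' \<in> U 0 (i + 1)"
        using u UW raise[OF u] by (auto simp: u'_def)
      have Au: "A u = \<theta> i *s u + u'" by (simp add: u'_def)
      have Xu': "inverse q *s X u' = (q * inverse (\<theta> i)) *s u'"
        unfolding XU[OF u'] q_sequence_Suc[OF q] using nz by (simp add: field_simps power2_eq_square)
      have "inverse q *s X (A u) = inverse q *s u + (q * inverse (\<theta> i)) *s u'"
        using uW nz Xu' by (simp add: Au lin XU[OF u] scale_right_distrib)
      moreover have "q *s A (X u) = q *s u + (q * inverse (\<theta> i)) *s u'"
        using uW nz by (simp add: Au lin XU[OF u] scale_right_distrib)
      ultimately show ?thesis
        unfolding D_def by (simp add: scale_left_diff_distrib)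
    qed
    ultimately have "D v = 0" if "v \<in> W" for v using vanish that by blast
    then show ?thesis by (simp add: q_weyl_def D_def)
  qed
  moreover have "q_weyl W q X B"
  proof -
    define D where "D v = q *s X (B v) - inverse q *s B (X v) - (q - inverse q) *s v" for v
    have "lin_on W D"
      unfolding lin_on_def D_def
      by (auto simp: lin scale_right_distrib scale_right_diff_distrib mult.commute)
    moreover have "D u = 0" if u: "u \<in> U 0 i" for u i
    proof -
      define u' where "u' = B u - \<theta> i *s u"
      have uW: "u \<in> W" "u' \<in> W" and u': "u' \<in> U 0 (i - 1)"
        using u UW lower[OF u] by (auto simp: u'_def)
      have Bu: "B u = \<theta> i *s u + u'" by (simp add: u'_def)
      have Xu': "q *s X u' = (inverse q * inverse (\<theta> i)) *s u'"
        unfolding XU[OF u'] q_sequence_pred[OF q] using nz by (simp add: field_simps power2_eq_square)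
      have "q *s X (B u) = q *s u + (inverse q * inverse (\<theta> i)) *s u'"
        using uW nz Xu' by (simp add: Bu lin XU[OF u] scale_right_distrib)
      moreover have "inverse q *s B (X u) = inverse q *s u + (inverse q * inverse (\<theta> i)) *s u'"
        using uW nz by (simp add: Bu lin XU[OF u] scale_right_distrib)
      ultimately show ?thesis
        unfolding D_def by (simp add: scale_left_diff_distrib)
    qed
    ultimately have "D v = 0" if "v \<in> W" for v using vanish that by blast
    then show ?thesis by (simp add: q_weyl_def D_def)
  qed
  ultimately show ?thesis using X by blast
qed

end

section \<open>The flags of the four operators\<close>

text \<open>
  An operator \<open>X\<close> between \<open>A\<close> and \<open>B\<close> as \<open>x\<^sub>1\<close> is between \<open>x\<^sub>0\<close> and \<open>x\<^sub>2\<close>. The operators \<open>A\<close> and \<open>B\<close> are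
  diagonalizable; which of \<open>\<theta> a, \<dots>, \<theta> N\<close> are their eigenvalues is left open. Comments in this part
  write \<open>E T I\<close> as at the top of the file.
\<close>

locale weyl_chain = operator_space scale
  for scale :: "'a::field \<Rightarrow> 'b::ab_group_add \<Rightarrow> 'b" (infixr "*s" 75) +
  fixes W :: "'b set" and q :: 'a and \<theta> :: "int \<Rightarrow> 'a" and a N :: int
    and A X B :: "'b \<Rightarrow> 'b"
  assumes q: "q_sequence q \<theta>" and W: "subspace W"
    and A: "endo W A" and X: "endo W X" and B: "endo W B"
    and AX: "q_weyl W q A X" and XB: "q_weyl W q X B"
    and WA: "W \<subseteq> eigsum W A (\<theta> ` {a..N})" and WB: "W \<subseteq> eigsum W B (\<theta> ` {a..N})"
begin

abbreviation \<phi> :: "int \<Rightarrow> 'a" where "\<phi> \<equiv> \<lambda>i. inverse (\<theta> i)"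

lemma q_inv: "q_sequence (inverse q) \<phi>" using q_sequence_inverse[OF q] .

lemma WA_upper: "W \<subseteq> eigsum W A (\<theta> ` {..N})" and WA_lower: "W \<subseteq> eigsum W A (\<theta> ` {a..})"
  and WB_upper: "W \<subseteq> eigsum W B (\<theta> ` {..N})" and WB_lower: "W \<subseteq> eigsum W B (\<theta> ` {a..})"
  using WA WB eigsum_mono[of "\<theta> ` {a..N}" "\<theta> ` {..N}" W]
    eigsum_mono[of "\<theta> ` {a..N}" "\<theta> ` {a..}" W] by force+

lemma WX_lower: "W \<subseteq> eigsum W X (\<phi> ` {a..})" and WX_upper: "W \<subseteq> eigsum W X (\<phi> ` {..N})"
  using WA_lower WB_upper q_weyl_flag_upward[OF AX A X W q WA_upper, of a]
    q_weyl_flag_downward[OF XB B X W q WB_lower, of N] by blast+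

lemma WX: "W \<subseteq> eigsum W X (\<phi> ` {a..N})"
proof -
  have "\<phi> ` {a..} \<inter> \<phi> ` {..N} = \<phi> ` ({a..} \<inter> {..N})"
    by (rule image_Int[symmetric]) (rule q_sequence_inj[OF q_inv])
  also have "{a..} \<inter> {..N} = {a..N}" by auto
  finally show ?thesis
    using WX_lower WX_upper eigsum_Int[OF X W, of "\<phi> ` {a..}" "\<phi> ` {..N}"] by auto
qed

text \<open>
  Each of \<open>A\<close> and \<open>X\<close> moves the eigenspaces of the other upwards; \<open>X\<close> and \<open>B\<close> move each other's
  eigenspaces downwards.
\<close>

lemma flag_upward_eq: "eigsum W A (\<theta> ` {j..}) = eigsum W X (\<phi> ` {j..})"
proof
  show "eigsum W A (\<theta> ` {j..}) \<subseteq> eigsum W X (\<phi> ` {j..})"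
    by (rule q_weyl_flag_upward[OF AX A X W q WA_upper])
  have "eigsum W X (\<phi> ` {j..}) \<subseteq> eigsum W A ((\<lambda>i. inverse (\<phi> i)) ` {j..})"
    by (rule q_weyl_flag_upward[OF _ X A W q_inv WX_upper]) (simp add: q_weyl_swap AX)
  then show "eigsum W X (\<phi> ` {j..}) \<subseteq> eigsum W A (\<theta> ` {j..})" by simp
qed

lemma flag_downward_eq: "eigsum W B (\<theta> ` {..j}) = eigsum W X (\<phi> ` {..j})"
proof
  show "eigsum W B (\<theta> ` {..j}) \<subseteq> eigsum W X (\<phi> ` {..j})"
    by (rule q_weyl_flag_downward[OF XB B X W q WB_lower])
  have "eigsum W X (\<phi> ` {..j}) \<subseteq> eigsum W B ((\<lambda>i. inverse (\<phi> i)) ` {..j})"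
    by (rule q_weyl_flag_downward[OF _ X B W q_inv WX_lower]) (simp add: q_weyl_swap XB)
  then show "eigsum W X (\<phi> ` {..j}) \<subseteq> eigsum W B (\<theta> ` {..j})" by simp
qed

text \<open>Both spaces are invariant under \<open>X\<close>, and no eigenvalue of \<open>X\<close> occurs on both.\<close>

lemma flags_opposite:
  assumes "i < j" "v \<in> eigsum W B (\<theta> ` {..i})" "v \<in> eigsum W A (\<theta> ` {j..})"
  shows "v = 0"
  using assms
  by (intro eigsum_Int_disjoint[OF X W q_sequence_inj[OF q_inv], of "{..i}" "{j..}"])
    (auto simp: flag_upward_eq flag_downward_eq)

text \<open>
  If \<open>1 / \<theta> i\<close> were not an eigenvalue of \<open>X\<close>, then \<open>E X {i..} = E X {i + 1..}\<close>, and the same would hold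
  for \<open>A\<close>.
\<close>

lemma eigenvalue_X:
  assumes "v \<in> W" "v \<noteq> 0" "A v = \<theta> i *s v"
  shows "\<exists>w\<in>W. w \<noteq> 0 \<and> X w = \<phi> i *s w"
proof (rule ccontr)
  assume *: "\<not> (\<exists>w\<in>W. w \<noteq> 0 \<and> X w = \<phi> i *s w)"
  have "eigsum W X (\<phi> ` {i..}) \<subseteq> eigsum W X (\<phi> ` {i + 1..})"
  proof (rule eigsum_eigenvalues)
    fix w t assume w: "w \<in> W" "w \<noteq> 0" "t \<in> \<phi> ` {i..}" "X w = t *s w"
    then obtain k where k: "k \<ge> i" "t = \<phi> k" by auto
    then have "k \<noteq> i" using * w by auto
    then show "t \<in> \<phi> ` {i + 1..}" using k by auto
  qed
  moreover have "v \<in> eigsum W A (\<theta> ` {i..})"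
    using assms by (intro eigsumI[of _ _ "\<theta> i"]) auto
  ultimately have "v \<in> eigsum W A (\<theta> ` {i + 1..})"
    by (auto simp: flag_upward_eq)
  then have "v = 0"
    using q_sequence_inj[OF q]
    by (intro eigenvector_in_eigsum[OF A W _ assms(3)]) (auto simp: inj_eq)
  then show False using assms(2) by simp
qed

lemma eigenvalue_X_range:
  assumes "v \<in> W" "v \<noteq> 0" "X v = t *s v"
  shows "t \<in> \<phi> ` {a..N}"
  using eigenvector_in_eigsum[OF X W _ assms(3), of "\<phi> ` {a..N}"] WX assms(1,2) by blast

lemma eigenvalues_X:
  assumes "\<And>i. i \<in> {a..N} \<Longrightarrow> \<exists>v\<in>W. v \<noteq> 0 \<and> A v = \<theta> i *s v"
  shows "{t. \<exists>v\<in>W. v \<noteq> 0 \<and> X v = t *s v} = \<phi> ` {a..N}"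
  using eigenvalue_X_range eigenvalue_X assms by blast

end

locale weyl_square = weyl_chain +
  fixes Y
  assumes Y: "endo W Y" and BY: "q_weyl W q B Y" and YA: "q_weyl W q Y A"
begin

text \<open>Half a turn of the square: every fact about \<open>X\<close> also holds for \<open>Y\<close>.\<close>

lemma opposite: "weyl_square scale W q \<theta> a N B Y A X"
  by unfold_locales (fact q W A X B AX XB WA WB Y BY YA)+

text \<open>
  An eigenvector of \<open>X\<close> with index \<open>i\<close> lies in \<open>E B {..i} \<inter> E A {i..}\<close>. Since \<open>Y\<close> moves the eigenspaces of
  \<open>B\<close> up and those of \<open>A\<close> down by one step, its image lies in \<open>E B {..i + 1} \<inter> E A {i - 1..}\<close>, which is
  \<open>E X {i - 1..i + 1}\<close>.
\<close>

lemma serre_X_Y: "serre W q X Y"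
proof -
  have "serre W (inverse q) X Y"
  proof (rule serre_from_eigenvectors[OF X Y W q_inv])
    show "W \<subseteq> eigsum W X (range \<phi>)"
      using WX eigsum_mono[of "\<phi> ` {a..N}" "range \<phi>" W X] by force
    fix i v assume v: "v \<in> W" "X v = \<phi> i *s v"
    have "Y v \<in> eigsum W B (\<theta> ` {..i + 1})"
    proof (rule eigsum_image[OF endo_lin[OF Y] W subspace_eigsum])
      have "v \<in> eigsum W X (\<phi> ` {..i})"
        using v by (intro eigsumI[of _ _ "\<phi> i"]) auto
      then show "v \<in> eigsum W B (\<theta> ` {..i})" by (simp add: flag_downward_eq)
      fix u t assume u: "u \<in> W" "t \<in> \<theta> ` {..i}" "B u = t *s u"
      then obtain k where k: "k \<le> i" "B u = \<theta> k *s u" by auto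
      then have "\<theta> ` {k..k + 1} \<subseteq> \<theta> ` {..i + 1}" by auto
      then show "Y u \<in> eigsum W B (\<theta> ` {..i + 1})"
        using q_weyl_step_up[OF BY B Y W q u(1) k(2)] eigsum_mono by blast
    qed
    moreover have "Y v \<in> eigsum W A (\<theta> ` {i - 1..})"
    proof (rule eigsum_image[OF endo_lin[OF Y] W subspace_eigsum])
      have "v \<in> eigsum W X (\<phi> ` {i..})"
        using v by (intro eigsumI[of _ _ "\<phi> i"]) auto
      then show "v \<in> eigsum W A (\<theta> ` {i..})" by (simp add: flag_upward_eq)
      fix u t assume u: "u \<in> W" "t \<in> \<theta> ` {i..}" "A u = t *s u"
      then obtain k where k: "k \<ge> i" "A u = \<theta> k *s u" by auto
      then have "\<theta> ` {k - 1..k} \<subseteq> \<theta> ` {i - 1..}" by auto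
      then show "Y u \<in> eigsum W A (\<theta> ` {i - 1..})"
        using q_weyl_step_down[OF YA A Y W q u(1) k(2)] eigsum_mono by blast
    qed
    ultimately have "Y v \<in> eigsum W X (\<phi> ` {..i + 1} \<inter> \<phi> ` {i - 1..})"
      unfolding flag_upward_eq flag_downward_eq using eigsum_Int[OF X W] by blast
    also have "\<phi> ` {..i + 1} \<inter> \<phi> ` {i - 1..} = \<phi> ` ({..i + 1} \<inter> {i - 1..})"
      by (rule image_Int[symmetric]) (rule q_sequence_inj[OF q_inv])
    also have "{..i + 1} \<inter> {i - 1..} = {i - 1..i + 1}" by auto
    finally show "Y v \<in> eigsum W X (\<phi> ` {i - 1..i + 1})" .
  qed
  then show ?thesis by (simp add: serre_def q3_inverse)
qed

end

section \<open>Uniqueness of the intermediate operator\<close>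

context operator_space
begin

lemma vanishing_on_irreducible:
  assumes irr: "irreducible_under W {A, B}" and W: "subspace W"
    and D: "lin_on W D" and cl: "\<And>v. v \<in> W \<Longrightarrow> A v \<in> W" "\<And>v. v \<in> W \<Longrightarrow> B v \<in> W"
    and ker: "\<And>v. v \<in> W \<Longrightarrow> D v = 0 \<Longrightarrow> D (A v) = 0" "\<And>v. v \<in> W \<Longrightarrow> D v = 0 \<Longrightarrow> D (B v) = 0"
    and v0: "v0 \<in> W" "v0 \<noteq> 0" "D v0 = 0"
  shows "\<forall>v\<in>W. D v = 0"
proof -
  let ?K = "{v \<in> W. D v = 0}"
  have "subspace ?K" by (rule subspace_kernel[OF D W])
  then have "?K = {0} \<or> ?K = W"
    using irr cl ker unfolding irreducible_under_def by blast
  moreover have "?K \<noteq> {0}" using v0 by blast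
  ultimately show ?thesis by blast
qed

lemma weyl_difference:
  assumes X: "q_weyl W q A X" "q_weyl W q X B" and X': "q_weyl W q A X'" "q_weyl W q X' B"
    and q: "q \<noteq> 0" and S: "subspace S" "endo S A" "endo S B"
    and v: "v \<in> W" and cl: "X v \<in> S" "X' v \<in> S"
  shows "X (A v) - X' (A v) = q\<^sup>2 *s A (X v - X' v)"
    and "B (X v - X' v) = q\<^sup>2 *s (X (B v) - X' (B v))"
proof -
  note d = endo_diff[OF S(2,1) cl] endo_diff[OF S(3,1) cl]
  have "q *s A (X v) - inverse q *s X (A v) = q *s A (X' v) - inverse q *s X' (A v)"
    using X X' v unfolding q_weyl_def by simp
  then have "inverse q *s (X (A v) - X' (A v)) = q *s A (X v - X' v)"
    by (simp add: d scale_right_diff_distrib algebra_simps)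
  then have "q *s (inverse q *s (X (A v) - X' (A v))) = q *s (q *s A (X v - X' v))" by simp
  then show "X (A v) - X' (A v) = q\<^sup>2 *s A (X v - X' v)"
    using q by (simp add: power2_eq_square)
  have "q *s X (B v) - inverse q *s B (X v) = q *s X' (B v) - inverse q *s B (X' v)"
    using X X' v unfolding q_weyl_def by simp
  then have "inverse q *s B (X v - X' v) = q *s (X (B v) - X' (B v))"
    by (simp add: d scale_right_diff_distrib algebra_simps)
  then have "q *s (inverse q *s B (X v - X' v)) = q *s (q *s (X (B v) - X' (B v)))" by simp
  then show "B (X v - X' v) = q\<^sup>2 *s (X (B v) - X' (B v))"
    using q by (simp add: power2_eq_square)
qed

lemma lowest_eigenvector:
  assumes A: "endo W A" "subspace W" and W: "W \<noteq> {0}" "W \<subseteq> eigsum W A (\<theta> ` {a..N::int})"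
  obtains i v where "v \<in> W" "v \<noteq> 0" "A v = \<theta> i *s v" "W \<subseteq> eigsum W A (\<theta> ` {i..N})"
proof -
  define I where "I = {i \<in> {a..N}. \<exists>v\<in>W. v \<noteq> 0 \<and> A v = \<theta> i *s v}"
  have fin: "finite I" by (rule finite_subset[of _ "{a..N}"]) (auto simp: I_def)
  have WI: "W \<subseteq> eigsum W A (\<theta> ` I)"
    using W(2) eigsum_eigenvalues[of W "\<theta> ` {a..N}" A "\<theta> ` I"] unfolding I_def by fastforce
  have "I \<noteq> {}"
  proof
    assume "I = {}"
    then have "W \<subseteq> {0}" using WI by simp
    then show False using W(1) subspace_0[OF A(2)] by blast
  qed
  then have m: "Min I \<in> I" "I \<subseteq> {Min I..}" using fin by auto
  then have "I \<subseteq> {Min I..N}" by (auto simp: I_def)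
  then have "W \<subseteq> eigsum W A (\<theta> ` {Min I..N})"
    using WI eigsum_mono[OF image_mono[of I "{Min I..N}" \<theta>], of W A] by blast
  moreover obtain v where "v \<in> W" "v \<noteq> 0" "A v = \<theta> (Min I) *s v"
    using m(1) unfolding I_def by auto
  ultimately show ?thesis using that by blast
qed

text \<open>
  By \<open>weyl_difference\<close>, the operator \<open>D = X - X'\<close> lowers the indices of eigenvectors of \<open>B\<close>, so it kills
  those of lowest index.
\<close>

lemma weyl_operator_unique:
  assumes irr: "irreducible_under W {A, B}"
    and "weyl_chain scale W q \<theta> a N A X B" and "weyl_chain scale W q \<theta> a N A X' B" and v: "v \<in> W"
  shows "X v = X' v"
proof -
  interpret C: weyl_chain scale W q \<theta> a N A X B by fact
  interpret C': weyl_chain scale W q \<theta> a N A X' B by fact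
  have "W \<noteq> {0}" using irr unfolding irreducible_under_def by blast
  then obtain i u where u: "u \<in> W" "u \<noteq> 0" "B u = \<theta> i *s u" "W \<subseteq> eigsum W B (\<theta> ` {i..N})"
    using lowest_eigenvector[OF C.B C.W _ C.WB] by metis
  define D where "D v = X v - X' v" for v
  note nz = q_sequence_nonzero[OF C.q]
  have diff: "D (A w) = q\<^sup>2 *s A (D w)" "B (D w) = q\<^sup>2 *s D (B w)" if "w \<in> W" for w
    unfolding D_def
    by (rule weyl_difference[OF C.AX C.XB C'.AX C'.XB nz(2) C.W C.A C.B that
          endo_closed[OF C.X that] endo_closed[OF C'.X that]])+
  have D: "endo W D"
    unfolding endo_def lin_on_def D_def
    by (auto simp: endo_add[OF C.X] endo_add[OF C'.X] endo_scale[OF C.X] endo_scale[OF C'.X]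
        scale_right_diff_distrib intro!: subspace_diff[OF C.W] endo_closed[OF C.X] endo_closed[OF C'.X])
  have "B (D u) = \<theta> (i - 1) *s D u"
    using diff(2)[OF u(1)] u(1,3) by (simp add: endo_scale[OF D] q_sequence_pred[OF C.q] mult.commute)
  moreover have "D u \<in> eigsum W B (\<theta> ` {i..N})" using endo_closed[OF D u(1)] u(4) by blast
  ultimately have "D u = 0"
    using q_sequence_inj[OF C.q] by (intro eigenvector_in_eigsum[OF C.B C.W]) (auto simp: inj_eq)
  moreover have "D (A w) = 0" if "w \<in> W" "D w = 0" for w
    using diff(1)[OF that(1)] that(2) lin_on_0[OF endo_lin[OF C.A] C.W] by simp
  moreover have "D (B w) = 0" if "w \<in> W" "D w = 0" for w
    using diff(2)[OF that(1)] that(2) lin_on_0[OF endo_lin[OF C.B] C.W] nz by simp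
  ultimately have "D v = 0"
    using vanishing_on_irreducible[OF irr C.W endo_lin[OF D] endo_closed[OF C.A] endo_closed[OF C.B]
        _ _ u(1,2)] v by blast
  then show ?thesis by (simp add: D_def)
qed

text \<open>Uniqueness, applied to \<open>X\<close> and to the operator \<open>inv f \<circ> X' \<circ> f\<close> transported from the other space.\<close>

lemma weyl_operator_intertwined:
  assumes irr: "irreducible_under W {A, B}" and chain: "weyl_chain scale W q \<theta> a N A X B"
    and W': "subspace W'" "endo W' A'" "endo W' X'" "endo W' B'"
    and rel: "q_weyl W' q A' X'" "q_weyl W' q X' B'"
    and f: "bij_betw f W W'" "lin_on W f"
    and fA: "\<And>v. v \<in> W \<Longrightarrow> f (A v) = A' (f v)" and fB: "\<And>v. v \<in> W \<Longrightarrow> f (B v) = B' (f v)"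
    and v: "v \<in> W"
  shows "f (X v) = X' (f v)"
proof -
  interpret C: weyl_chain scale W q \<theta> a N A X B by fact
  define g where "g = inv_into W f"
  have fW: "f v \<in> W'" if "v \<in> W" for v using f(1) that by (rule bij_betwE[THEN bspec])
  have gW: "g w \<in> W" and fg: "f (g w) = w" if "w \<in> W'" for w
    using that f(1) unfolding g_def bij_betw_def by (auto intro: inv_into_into f_inv_into_f)
  have inj: "v = w" if "f v = f w" "v \<in> W" "w \<in> W" for v w
    using f(1) that unfolding bij_betw_def inj_on_def by blast
  define Z where "Z v = g (X' (f v))" for v
  have ZW: "Z v \<in> W" and fZ: "f (Z v) = X' (f v)" if "v \<in> W" for v
    unfolding Z_def using gW fg endo_closed[OF W'(3) fW[OF that]] by blast+
  note fl = lin_on_add[OF f(2)] lin_on_scale[OF f(2)] lin_on_diff[OF f(2) C.W]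
  note [simp] = subspace_add[OF C.W] subspace_scale[OF C.W] subspace_diff[OF C.W] ZW fZ fW
    endo_closed[OF C.A] endo_closed[OF C.B] fA fB
  have "endo W Z"
    unfolding endo_def lin_on_def
  proof (intro conjI ballI allI)
    fix v w assume "v \<in> W" "w \<in> W"
    then show "Z (v + w) = Z v + Z w"
      by - (rule inj, simp_all add: fl endo_add[OF W'(3)])
  next
    fix c v assume "v \<in> W"
    then show "Z (c *s v) = c *s Z v"
      by - (rule inj, simp_all add: fl endo_scale[OF W'(3)])
  qed simp
  moreover have "q_weyl W q A Z"
    unfolding q_weyl_def
  proof
    fix v assume "v \<in> W"
    then show "q *s A (Z v) - inverse q *s Z (A v) = (q - inverse q) *s v"
      using rel(1) unfolding q_weyl_def by - (rule inj, simp_all add: fl)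
  qed
  moreover have "q_weyl W q Z B"
    unfolding q_weyl_def
  proof
    fix v assume "v \<in> W"
    then show "q *s Z (B v) - inverse q *s B (Z v) = (q - inverse q) *s v"
      using rel(2) unfolding q_weyl_def by - (rule inj, simp_all add: fl)
  qed
  ultimately have "weyl_chain scale W q \<theta> a N A Z B"
    by unfold_locales (use C.q C.W C.A C.B C.WA C.WB in auto)
  then have "X v = Z v" using weyl_operator_unique[OF irr chain] v by blast
  then show ?thesis using v by simp
qed

section \<open>Irreducibility under the even generators\<close>

lemma exists_irreducible_invariant:
  assumes "finite G" "U \<subseteq> span G" "subspace U" "U \<noteq> {0}" "\<And>T u. T \<in> \<F> \<Longrightarrow> u \<in> U \<Longrightarrow> T u \<in> U"
  shows "\<exists>W. subspace W \<and> W \<subseteq> U \<and> (\<forall>T\<in>\<F>. \<forall>w\<in>W. T w \<in> W) \<and> irreducible_under W \<F>"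
  using assms(2-)
proof (induction "dim U" arbitrary: U rule: less_induct)
  case less
  show ?case
  proof (cases "irreducible_under U \<F>")
    case True
    then show ?thesis using less.prems by blast
  next
    case False
    then obtain W where W: "subspace W" "W \<subseteq> U" "\<forall>T\<in>\<F>. \<forall>w\<in>W. T w \<in> W" "W \<noteq> {0}" "W \<noteq> U"
      using less.prems unfolding irreducible_under_def by blast
    obtain BU where BU: "BU \<subseteq> U" "independent BU" "U \<subseteq> span BU" "card BU = dim U"
      using basis_exists[of U] by blast
    obtain BW where BW: "BW \<subseteq> W" "independent BW" "W \<subseteq> span BW" "card BW = dim W"
      using basis_exists[of W] by blast
    have finU: "finite BU"
      using independent_span_bound[OF assms(1) BU(2)] BU(1) less.prems(1) by blast
    obtain x where x: "x \<in> U" "x \<notin> W" using W by blast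
    have "span BW \<subseteq> W" using BW(1) W(1) by (rule span_minimal)
    then have "x \<notin> span BW" using x by blast
    then have ind: "independent (insert x BW)" using BW(2) by (rule independent_insertI)
    have "insert x BW \<subseteq> span BU" using x BW(1) W(2) BU(3) by blast
    note bound = independent_span_bound[OF finU ind this]
    then have "finite (insert x BW)" "card (insert x BW) \<le> card BU" by simp_all
    moreover have "x \<notin> BW" using x BW(1) by blast
    ultimately have "dim W < dim U" using BW(4) BU(4) by simp
    then have "\<exists>W'. subspace W' \<and> W' \<subseteq> W \<and> (\<forall>T\<in>\<F>. \<forall>w\<in>W'. T w \<in> W') \<and> irreducible_under W' \<F>"
      using W less.prems(1) by (intro less.hyps) auto
    then show ?thesis using W(2) by blast
  qed
qed

lemma q_weyl_subset: "q_weyl W q A X \<Longrightarrow> U \<subseteq> W \<Longrightarrow> q_weyl U q A X"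
  and serre_subset: "serre W q A X \<Longrightarrow> U \<subseteq> W \<Longrightarrow> serre U q A X"
  unfolding q_weyl_def serre_def by blast+

text \<open>The sum of the eigenspaces is an invariant subspace.\<close>

lemma diagonalizable_if_irreducible:
  assumes "irreducible_under W \<F>" "subspace W" "endo W A" "inj \<theta>"
    and "\<And>T. T \<in> \<F> \<Longrightarrow> endo W T"
    and "\<And>T v i. T \<in> \<F> \<Longrightarrow> v \<in> W \<Longrightarrow> A v = \<theta> i *s v \<Longrightarrow> T v \<in> eigsum W A (range \<theta>)"
    and "v0 \<in> W" "v0 \<noteq> 0" "A v0 = \<theta> (i0::int) *s v0"
    and spec: "\<And>v i. v \<in> W \<Longrightarrow> v \<noteq> 0 \<Longrightarrow> A v = \<theta> i *s v \<Longrightarrow> i \<in> {a..N}"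
  shows "W \<subseteq> eigsum W A (\<theta> ` {a..N})"
proof -
  let ?E = "eigsum W A (range \<theta>)"
  have "v0 \<in> ?E" by (rule eigsumI[of _ _ "\<theta> i0"]) (use assms in auto)
  moreover have "T v \<in> ?E" if T: "T \<in> \<F>" and v: "v \<in> ?E" for T v
    by (rule eigsum_image[OF endo_lin[OF assms(5)[OF T]] assms(2) subspace_eigsum _ v])
      (use assms(6)[OF T] in auto)
  ultimately have "?E = W"
    using assms(1,8) eigsum_subset[OF assms(2)] unfolding irreducible_under_def
    by (metis singletonD subspace_eigsum)
  moreover have "?E \<subseteq> eigsum W A (\<theta> ` {a..N})"
    by (rule eigsum_eigenvalues) (use spec in blast)
  ultimately show ?thesis by blast
qed

lemma serre_pair_diagonalizable:
  assumes irr: "irreducible_under W {A, B}" and W: "subspace W" and A: "endo W A" and B: "endo W B"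
    and \<theta>: "q_sequence q \<theta>" and serre: "serre W q A B"
    and v0: "v0 \<in> W" "v0 \<noteq> 0" "A v0 = \<theta> i0 *s v0"
    and spec: "\<And>v i. v \<in> W \<Longrightarrow> v \<noteq> 0 \<Longrightarrow> A v = \<theta> i *s v \<Longrightarrow> i \<in> {a..N}"
  shows "W \<subseteq> eigsum W A (\<theta> ` {a..N})"
proof (rule diagonalizable_if_irreducible[OF irr W A q_sequence_inj[OF \<theta>] _ _ v0 spec])
  fix T v i assume T: "T \<in> {A, B}" and v: "v \<in> W" "A v = \<theta> i *s v"
  have "A v \<in> eigsum W A (range \<theta>)" using v by (auto intro!: subspace_scale eigsumI)
  moreover have "B v \<in> eigsum W A (range \<theta>)"
    using serre_eigenvector[OF serre A B W \<theta> v]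
      eigsum_mono[of "\<theta> ` {i - 1..i + 1}" "range \<theta>" W A] by blast
  ultimately show "T v \<in> eigsum W A (range \<theta>)" using T by blast
qed (use A B in auto)

end

context weyl_square
begin

text \<open>A common vector of \<open>E B {..j}\<close> and \<open>E A {i..}\<close> with \<open>j < i\<close> would contradict \<open>flags_opposite\<close>.\<close>

lemma lowest_index_le:
  assumes U: "U \<subseteq> W" "U \<subseteq> eigsum U A (\<theta> ` {i..N})" and v: "v \<in> U" "v \<noteq> 0" "B v = \<theta> j *s v"
  shows "i \<le> j"
proof (rule ccontr)
  assume "\<not> i \<le> j"
  moreover have "v \<in> eigsum W B (\<theta> ` {..j})"
    using U v by (intro eigsumI[of _ _ "\<theta> j"]) auto
  moreover have "v \<in> eigsum W A (\<theta> ` {i..})"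
    using U v eigsum_mono_space[OF U(1), of A "\<theta> ` {i..N}"]
      eigsum_mono[of "\<theta> ` {i..N}" "\<theta> ` {i..}" W A] by force
  ultimately show False using flags_opposite[of j i v] v(2) by simp
qed

text \<open>
  The lowest indices of eigenvalues of \<open>A\<close> and of \<open>B\<close> on \<open>U\<close> agree by \<open>lowest_index_le\<close> for the square and
  the opposite square. This is what the existence of an operator \<open>X'\<close> on \<open>U\<close> requires. The difference
  \<open>D = X - X'\<close> takes values in the whole space \<open>W\<close>, where the eigenvectors of \<open>B\<close> of index \<open>i - 1\<close> may be
  nonzero; that \<open>D\<close> kills a lowest eigenvector \<open>w\<close> of \<open>B\<close> in \<open>U\<close> now follows since \<open>D w\<close> also lies in
  the opposite flag \<open>E A {i..}\<close>.
\<close>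

lemma irreducible_pair_invariant:
  assumes U: "subspace U" "U \<subseteq> W" and cl: "\<And>u. u \<in> U \<Longrightarrow> A u \<in> U" "\<And>u. u \<in> U \<Longrightarrow> B u \<in> U"
    and irr: "irreducible_under U {A, B}" and serre: "serre W q A B" "serre W q B A"
    and u: "u \<in> U"
  shows "X u \<in> U"
proof -
  interpret opp: weyl_square scale W q \<theta> a N B Y A X by (rule opposite)
  have UA: "endo U A" and UB: "endo U B"
    using endo_restrict[OF A U(2) cl(1)] endo_restrict[OF B U(2) cl(2)] by blast+
  have U0: "U \<noteq> {0}" using irr unfolding irreducible_under_def by blast
  have EA: "U \<subseteq> eigsum U A (\<theta> ` {a..N})"
    using eigsum_Int_invariant[OF A W U cl(1)] U(2) WA by blast
  have EB: "U \<subseteq> eigsum U B (\<theta> ` {a..N})"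
    using eigsum_Int_invariant[OF B W U cl(2)] U(2) WB by blast
  obtain i v where v: "v \<in> U" "v \<noteq> 0" "A v = \<theta> i *s v" "U \<subseteq> eigsum U A (\<theta> ` {i..N})"
    using lowest_eigenvector[OF UA U(1) U0 EA] by metis
  obtain j w where w: "w \<in> U" "w \<noteq> 0" "B w = \<theta> j *s w" "U \<subseteq> eigsum U B (\<theta> ` {j..N})"
    using lowest_eigenvector[OF UB U(1) U0 EB] by metis
  have "i \<le> j" by (rule lowest_index_le[OF U(2) v(4) w(1-3)])
  moreover have "j \<le> i" by (rule opp.lowest_index_le[OF U(2) w(4) v(1-3)])
  ultimately have [simp]: "j = i" by simp
  obtain X' where X': "endo U X'" "q_weyl U q A X'" "q_weyl U q X' B"
    using weyl_operator_exists[OF q U(1) UA UB irr serre_subset[OF serre(1) U(2)]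
        serre_subset[OF serre(2) U(2)] v(4) _ v(1-3) w(1,2)] w by auto
  define D where "D v = X v - X' v" for v
  note nz = q_sequence_nonzero[OF q]
  have clS: "X v \<in> W" "X' v \<in> W" if "v \<in> U" for v
    using that U(2) endo_closed[OF X] endo_closed[OF X'(1)] by auto
  have diff: "D (A w) = q\<^sup>2 *s A (D w)" "B (D w) = q\<^sup>2 *s D (B w)" if "w \<in> U" for w
    unfolding D_def
    by (rule weyl_difference[OF q_weyl_subset[OF AX U(2)] q_weyl_subset[OF XB U(2)] X'(2,3) nz(2)
          W A B that clS[OF that]])+
  have linX: "lin_on U X" using lin_on_subset[OF endo_lin[OF X] U(2)] .
  have D: "lin_on U D"
    unfolding lin_on_def D_def
    by (auto simp: lin_on_add[OF linX] lin_on_scale[OF linX] endo_add[OF X'(1)] endo_scale[OF X'(1)]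
        scale_right_diff_distrib)
  have "D w = 0"
  proof (rule flags_opposite[of "i - 1" i])
    have "B (D w) = \<theta> (i - 1) *s D w"
      using diff(2)[OF w(1)] w(1,3) by (simp add: lin_on_scale[OF D] q_sequence_pred[OF q] mult.commute)
    then show "D w \<in> eigsum W B (\<theta> ` {..i - 1})"
      using clS[OF w(1)] W unfolding D_def by (intro eigsumI[of _ _ "\<theta> (i - 1)"] subspace_diff) auto
    have UE: "U \<subseteq> eigsum W A (\<theta> ` {i..})"
      using v(4) eigsum_mono_space[OF U(2), of A "\<theta> ` {i..N}"]
        eigsum_mono[of "\<theta> ` {i..N}" "\<theta> ` {i..}" W A] by force
    have "X w \<in> eigsum W A (\<theta> ` {i..})"
      using UE w(1) unfolding flag_upward_eq by (intro eigsum_invariant[OF X W]) auto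
    moreover have "X' w \<in> eigsum W A (\<theta> ` {i..})"
      using UE endo_closed[OF X'(1) w(1)] by blast
    ultimately show "D w \<in> eigsum W A (\<theta> ` {i..})"
      unfolding D_def by (rule subspace_diff[OF subspace_eigsum])
  qed simp
  moreover have "D (A w) = 0" if "w \<in> U" "D w = 0" for w
    using diff(1)[OF that(1)] that(2) lin_on_0[OF endo_lin[OF A] W] by simp
  moreover have "D (B w) = 0" if "w \<in> U" "D w = 0" for w
    using diff(2)[OF that(1)] that(2) lin_on_0[OF endo_lin[OF B] W] nz by simp
  ultimately have "D u = 0"
    using vanishing_on_irreducible[OF irr U(1) D cl _ _ w(1,2)] u by blast
  then show ?thesis using endo_closed[OF X'(1) u] by (simp add: D_def)
qed

lemma irreducible_pair:
  assumes fin: "finite G" "W \<subseteq> span G"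
    and irr: "irreducible_under W {A, X, B, Y}" and serre: "serre W q A B" "serre W q B A"
  shows "irreducible_under W {A, B}"
  unfolding irreducible_under_def
proof (intro conjI allI impI)
  show "W \<noteq> {0}" using irr unfolding irreducible_under_def by blast
  fix U assume U: "subspace U \<and> U \<subseteq> W \<and> (\<forall>T\<in>{A, B}. \<forall>u\<in>U. T u \<in> U)"
  show "U = {0} \<or> U = W"
  proof (cases "U = {0}")
    case False
    then have "\<exists>V. subspace V \<and> V \<subseteq> U \<and> (\<forall>T\<in>{A, B}. \<forall>v\<in>V. T v \<in> V) \<and> irreducible_under V {A, B}"
      using U fin by (intro exists_irreducible_invariant[of G]) auto
    then obtain V where V: "subspace V" "V \<subseteq> U" "\<And>v. v \<in> V \<Longrightarrow> A v \<in> V" "\<And>v. v \<in> V \<Longrightarrow> B v \<in> V"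
      "irreducible_under V {A, B}" by auto
    have VW: "V \<subseteq> W" using U V(2) by blast
    interpret opp: weyl_square scale W q \<theta> a N B Y A X by (rule opposite)
    have V': "irreducible_under V {B, A}" using V(5) by (subst insert_commute)
    have "X v \<in> V" if "v \<in> V" for v
      by (rule irreducible_pair_invariant[OF V(1) VW V(3,4,5) serre that])
    moreover have "Y v \<in> V" if "v \<in> V" for v
      by (rule opp.irreducible_pair_invariant[OF V(1) VW V(4,3) V' serre(2,1) that])
    ultimately have "V = {0} \<or> V = W"
      using irr V VW unfolding irreducible_under_def by auto
    moreover have "V \<noteq> {0}" using V(5) unfolding irreducible_under_def by blast
    ultimately show ?thesis using V(2) U by blast
  qed simp
qed

end

section \<open>Modules over presented algebras as families of operators\<close>

lemma free_alg_generated [case_names one gen scalar add]: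
  fixes p :: "('g, 'f::field) free_alg"
  assumes "P 1" "\<And>g p. P p \<Longrightarrow> P (gen g * p)" "\<And>c p. P p \<Longrightarrow> P (scalar c * p)"
    "\<And>p p'. P p \<Longrightarrow> P p' \<Longrightarrow> P (p + p')"
  shows "P p"
proof (induction p rule: free_alg_induct)
  case zero
  then show ?case using assms(3)[OF assms(1), of 0] by simp
next
  case (single w c)
  have "P (Poly_Mapping.single (Monomial l) 1)" for l
  proof (induction l)
    case Nil
    have "Poly_Mapping.single (Monomial []) 1 = (1 :: ('g, 'f) free_alg)"
      by (simp flip: zero_monomial_def)
    then show ?case using assms(1) by simp
  next
    case (Cons g l)
    have "Poly_Mapping.single (Monomial (g # l)) 1 =
        (gen g * Poly_Mapping.single (Monomial l) 1 :: ('g, 'f) free_alg)"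
      by (simp add: gen_def mult_single plus_monomial_def)
    then show ?case using assms(2)[OF Cons] by simp
  qed
  from assms(3)[OF this, of c "letters w"] show ?case
    by (simp add: scalar_def mult_single)
next
  case (add a b)
  then show ?case by (rule assms(4))
qed

lemma scalar_uminus_1: "scalar (- 1) = (- 1 :: ('g, 'f::field) free_alg)"
  by (simp add: scalar_def single_uminus)

context operator_space
begin

text \<open>
  Both the action of a presented algebra, lifted to the free algebra, and the action of the free
  algebra that is determined by operators for the generators are of this form.
\<close>

definition algebra_rep :: "'b set \<Rightarrow> (('g, 'a) free_alg \<Rightarrow> 'b \<Rightarrow> 'b) \<Rightarrow> bool" where
  "algebra_rep S \<rho> \<longleftrightarrow> subspace S \<and> (\<forall>p. endo S (\<rho> p)) \<and> (\<forall>v\<in>S. \<rho> 1 v = v) \<and>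
     (\<forall>p p'. \<forall>v\<in>S. \<rho> (p + p') v = \<rho> p v + \<rho> p' v \<and> \<rho> (p * p') v = \<rho> p (\<rho> p' v)) \<and>
     (\<forall>c p. \<forall>v\<in>S. \<rho> (scalar c * p) v = c *s \<rho> p v)"

lemma algebra_repD:
  assumes "algebra_rep S \<rho>"
  shows "subspace S" "endo S (\<rho> p)" "v \<in> S \<Longrightarrow> \<rho> p v \<in> S" "v \<in> S \<Longrightarrow> \<rho> 1 v = v"
    "v \<in> S \<Longrightarrow> \<rho> (p + p') v = \<rho> p v + \<rho> p' v" "v \<in> S \<Longrightarrow> \<rho> (p * p') v = \<rho> p (\<rho> p' v)"
    "v \<in> S \<Longrightarrow> \<rho> (scalar c * p) v = c *s \<rho> p v"
  using assms by (auto simp: algebra_rep_def endo_closed)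

lemma algebra_rep_scalar:
  assumes "algebra_rep S \<rho>" "v \<in> S"
  shows "\<rho> (scalar c) v = c *s v"
  using algebra_repD(7)[OF assms, of c 1] algebra_repD(4)[OF assms] by simp

lemma algebra_rep_diff:
  assumes "algebra_rep S \<rho>" "v \<in> S"
  shows "\<rho> (p - p') v = \<rho> p v - \<rho> p' v"
proof -
  have "p - p' = p + scalar (- 1) * p'" by (simp add: scalar_uminus_1)
  then have "\<rho> (p - p') v = \<rho> p v + (- 1) *s \<rho> p' v"
    by (simp only: algebra_repD(5,7)[OF assms])
  then show ?thesis by simp
qed

lemma algebra_rep_0:
  assumes "algebra_rep S \<rho>" "v \<in> S"
  shows "\<rho> 0 v = 0"
  using algebra_rep_diff[OF assms, of 0 0] by simp

lemma algebra_rep_serre: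
  assumes "algebra_rep S \<rho>"
  shows "(\<forall>v\<in>S. \<rho> (q_serre q a b) v = 0) \<longleftrightarrow> serre S q (\<rho> a) (\<rho> b)"
proof -
  note r = algebra_repD(3-6)[OF assms] algebra_rep_scalar[OF assms] algebra_rep_diff[OF assms]
  have "\<rho> (q_serre q a b) v = \<rho> a (\<rho> a (\<rho> a (\<rho> b v))) - q3 q *s \<rho> a (\<rho> a (\<rho> b (\<rho> a v)))
      + q3 q *s \<rho> a (\<rho> b (\<rho> a (\<rho> a v))) - \<rho> b (\<rho> a (\<rho> a (\<rho> a v)))" if "v \<in> S" for v
    using that by (simp add: q_serre_def power2_eq_square power3_eq_cube r mult.assoc)
  then show ?thesis by (simp add: serre_def)
qed

lemma algebra_rep_weyl:
  assumes "algebra_rep S \<rho>" "q - inverse q \<noteq> 0"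
  shows "(\<forall>v\<in>S. \<rho> (scalar (1 / (q - inverse q)) *
           (scalar q * a * b - scalar (inverse q) * b * a) - 1) v = 0) \<longleftrightarrow>
         q_weyl S q (\<rho> a) (\<rho> b)"
proof -
  note r = algebra_repD(3-6)[OF assms(1)] algebra_rep_scalar[OF assms(1)] algebra_rep_diff[OF assms(1)]
    subspace_scale[OF algebra_repD(1)[OF assms(1)]] subspace_diff[OF algebra_repD(1)[OF assms(1)]]
  have "\<rho> (scalar (1 / (q - inverse q)) *
           (scalar q * a * b - scalar (inverse q) * b * a) - 1) v = 0 \<longleftrightarrow>
      q *s \<rho> a (\<rho> b v) - inverse q *s \<rho> b (\<rho> a v) = (q - inverse q) *s v" if v: "v \<in> S" for v
  proof -
    let ?w = "q *s \<rho> a (\<rho> b v) - inverse q *s \<rho> b (\<rho> a v)"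
    have "\<rho> (scalar (1 / (q - inverse q)) *
           (scalar q * a * b - scalar (inverse q) * b * a) - 1) v = (1 / (q - inverse q)) *s ?w - v"
      using v by (simp add: r mult.assoc)
    also have "\<dots> = 0 \<longleftrightarrow> (q - inverse q) *s ((1 / (q - inverse q)) *s ?w) = (q - inverse q) *s v"
      using assms(2) by (simp only: scale_left_imp_eq scale_cancel_left eq_iff_diff_eq_0[symmetric]) simp
    also have "(q - inverse q) *s ((1 / (q - inverse q)) *s ?w) = ?w"
      using assms(2) by (simp only: scale_scale) simp
    finally show ?thesis .
  qed
  then show ?thesis by (simp add: q_weyl_def)
qed

lemma module_iff_algebra_rep:
  "is_module scale (presented_algebra R) M \<longleftrightarrow>
     algebra_rep (vspace M) (\<lambda>p. action M (residue_class R p))"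
  unfolding is_module_def algebra_rep_def endo_def lin_on_def presented_algebra_simps(1)
  by (simp only: ball_simps presented_algebra_simps(2-6) all_simps) blast

lemma module_relator:
  assumes "is_module scale (presented_algebra R) M" "r \<in> R" "v \<in> vspace M"
  shows "action M (residue_class R r) v = 0"
proof -
  have "residue_class R r = residue_class R 0"
    using relator_in_ideal[OF assms(2)] by (simp add: residue_class_eq_iff)
  then show ?thesis
    using algebra_rep_0[OF assms(1)[unfolded module_iff_algebra_rep] assms(3)] by simp
qed

lemma algebra_rep_invariant:
  assumes "algebra_rep S \<rho>" "subspace U" "U \<subseteq> S" "\<And>g u. u \<in> U \<Longrightarrow> \<rho> (gen g) u \<in> U" "u \<in> U"
  shows "\<rho> p u \<in> U"
  using assms(5)
proof (induction p arbitrary: u rule: free_alg_generated)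
  case (add p p')
  then have "\<rho> p u + \<rho> p' u \<in> U" by (intro subspace_add[OF assms(2)]) auto
  then show ?case using algebra_repD(5)[OF assms(1)] add assms(3) by (metis subsetD)
qed (use assms(3,4) in \<open>auto simp: algebra_repD(4,6)[OF assms(1)] algebra_rep_scalar[OF assms(1)] subset_eq
      intro: subspace_scale[OF assms(2)]\<close>)

lemma irreducible_module_iff:
  assumes "is_module scale (presented_algebra R) M"
  shows "irreducible_module scale (presented_algebra R) M \<longleftrightarrow>
    irreducible_under (vspace M) (range (\<lambda>g. action M (residue_class R (gen g))))"
proof -
  note rep = assms[unfolded module_iff_algebra_rep]
  have "(\<forall>a\<in>carrier (presented_algebra R). \<forall>w\<in>U. action M a w \<in> U) \<longleftrightarrow>
      (\<forall>T\<in>range (\<lambda>g. action M (residue_class R (gen g))). \<forall>w\<in>U. T w \<in> U)"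
    if "subspace U" "U \<subseteq> vspace M" for U
    using algebra_rep_invariant[OF rep that] by (auto simp: presented_algebra_simps(1))
  then show ?thesis
    unfolding irreducible_module_def irreducible_under_def by (metis (no_types, lifting))
qed

lemma intertwine_generated:
  assumes \<rho>: "algebra_rep S \<rho>" and \<sigma>: "algebra_rep S' \<sigma>" and f: "lin_on S f" "\<And>v. v \<in> S \<Longrightarrow> f v \<in> S'"
    and "\<And>g v. v \<in> S \<Longrightarrow> f (\<rho> (gen g) v) = \<sigma> (gen g) (f v)" and "v \<in> S"
  shows "f (\<rho> p v) = \<sigma> p (f v)"
  using assms(6)
  by (induction p arbitrary: v rule: free_alg_generated)
    (simp_all add: assms(5) f algebra_repD(3-6)[OF \<rho>] algebra_repD(3-6)[OF \<sigma>]
      algebra_rep_scalar[OF \<rho>] algebra_rep_scalar[OF \<sigma>]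
      lin_on_add[OF f(1)] lin_on_scale[OF f(1)])

definition free_action :: "('g \<Rightarrow> 'b \<Rightarrow> 'b) \<Rightarrow> ('g, 'a) free_alg \<Rightarrow> 'b \<Rightarrow> 'b" where
  "free_action T p v =
     (\<Sum>w\<in>Poly_Mapping.keys p. Poly_Mapping.lookup p w *s foldr T (letters w) v)"

lemma free_action_superset:
  assumes "finite K" "Poly_Mapping.keys p \<subseteq> K"
  shows "free_action T p v = (\<Sum>w\<in>K. Poly_Mapping.lookup p w *s foldr T (letters w) v)"
  unfolding free_action_def
  by (rule sum.mono_neutral_left) (use assms in \<open>auto simp: in_keys_iff\<close>)

lemma free_action_add: "free_action T (p + p') v = free_action T p v + free_action T p' v"
proof -
  let ?K = "Poly_Mapping.keys p \<union> Poly_Mapping.keys p'"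
  have K: "finite ?K" "Poly_Mapping.keys p \<subseteq> ?K" "Poly_Mapping.keys p' \<subseteq> ?K"
    "Poly_Mapping.keys (p + p') \<subseteq> ?K"
    by (simp_all add: Poly_Mapping.keys_add)
  show ?thesis
    unfolding free_action_superset[OF K(1,2)] free_action_superset[OF K(1,3)]
      free_action_superset[OF K(1,4)]
    by (simp only: lookup_add scale_left_distrib sum.distrib)
qed

lemma free_action_single: "free_action T (Poly_Mapping.single w c) v = c *s foldr T (letters w) v"
  by (cases "c = 0") (simp_all add: free_action_def)

lemma free_action_scalar: "free_action T (scalar c * p) v = c *s free_action T p v"
proof (induction p rule: free_alg_induct)
  case (single w d)
  then show ?case by (simp add: scalar_def mult_single free_action_single)
qed (simp_all add: free_action_def[of _ 0] distrib_left free_action_add scale_right_distrib)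

lemma free_action_algebra_rep:
  fixes T :: "'g \<Rightarrow> 'b \<Rightarrow> 'b"
  assumes S: "subspace S" and T: "\<And>g. endo S (T g)"
  shows "algebra_rep S (free_action T)"
proof -
  have word: "endo S (foldr T l)" for l
    by (induction l) (auto simp: endo_def lin_on_def endo_closed[OF T] endo_add[OF T] endo_scale[OF T])
  have endo: "endo S (free_action T p)" for p
    unfolding endo_def lin_on_def free_action_def
    by (auto simp: endo_add[OF word] endo_scale[OF word] scale_right_distrib sum.distrib
        scale_sum_right mult.commute intro!: subspace_sum[OF S] subspace_scale[OF S] endo_closed[OF word])
  have mult: "free_action T (p * p') v = free_action T p (free_action T p' v)" if "v \<in> S" for p p' v
  proof (induction p rule: free_alg_induct)
    case (single u c)
    show ?case
    proof (induction p' rule: free_alg_induct)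
      case zero
      show ?case
        using lin_on_0[OF endo_lin[OF word[of "letters u"]] S]
        by (simp add: free_action_def[of _ 0] free_action_single)
    next
      case (single w d)
      have "foldr T (letters w) v \<in> S" using endo_closed[OF word that] .
      then show ?case
        by (simp add: mult_single free_action_single plus_monomial_def endo_scale[OF word])
    next
      case (add p1 p2)
      have "free_action T p1 v \<in> S" "free_action T p2 v \<in> S" using endo_closed[OF endo that] by auto
      then show ?case
        by (simp add: add distrib_left free_action_add endo_add[OF endo])
    qed
  qed (simp_all add: free_action_def[of _ 0] distrib_right free_action_add)
  have "free_action T 1 v = v" for v
    using free_action_single[of T 0 1 v] by simp (simp add: zero_monomial_def)
  then show ?thesis
    unfolding algebra_rep_def using S endo mult by (simp add: free_action_add free_action_scalar)
qed

lemma free_action_gen: "free_action T (gen g) v = T g v"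
  by (simp add: gen_def free_action_single)

text \<open>The annihilator of a module is an ideal.\<close>

lemma relation_ideal_acts_trivially:
  assumes \<rho>: "algebra_rep S \<rho>" and R: "\<And>r v. r \<in> R \<Longrightarrow> v \<in> S \<Longrightarrow> \<rho> r v = 0"
    and p: "p \<in> relation_ideal R" and v: "v \<in> S"
  shows "\<rho> p v = 0"
proof -
  let ?K = "{p. \<forall>v\<in>S. \<rho> p v = 0}"
  note r = algebra_repD[OF \<rho>] algebra_rep_diff[OF \<rho>] algebra_rep_0[OF \<rho>]
  have \<rho>0: "\<rho> p 0 = 0" for p using lin_on_0[OF endo_lin[OF r(2)] r(1)] .
  have inv: "inv\<^bsub>add_monoid free_algebra\<^esub> a = - a" for a :: "('c, 'a) free_alg"
  proof -
    interpret ring "free_algebra :: ('a, ('c, 'a) free_alg) module" by (rule ring_free_algebra)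
    show ?thesis using minus_equality[of "- a" a] by (simp add: a_inv_def)
  qed
  have "ideal ?K free_algebra"
  proof (rule idealI)
    show "subgroup ?K (add_monoid free_algebra)"
    proof (rule group.subgroupI)
      show "Group.group (add_monoid (free_algebra :: ('a, ('c, 'a) free_alg) module))"
        using ring_free_algebra ring.is_abelian_group abelian_group.a_group by blast
      show "?K \<noteq> {}" using r(9) by blast
      show "inv\<^bsub>add_monoid free_algebra\<^esub> a \<in> ?K" if "a \<in> ?K" for a
        unfolding inv using that r(8)[of _ 0 a] by (simp add: r(9))
    qed (simp_all add: r)
  qed (simp_all add: ring_free_algebra r \<rho>0)
  then have "relation_ideal R \<subseteq> ?K"
    unfolding relation_ideal_def using R by (intro ring.genideal_minimal[OF ring_free_algebra]) auto
  then show ?thesis using p v by blast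
qed

text \<open>
  A residue class acts through any of its representatives; \<open>relation_ideal_acts_trivially\<close> makes the choice
  immaterial.
\<close>

lemma module_from_algebra_rep:
  assumes \<rho>: "algebra_rep S \<rho>" and R: "\<And>r v. r \<in> R \<Longrightarrow> v \<in> S \<Longrightarrow> \<rho> r v = 0"
  obtains M where "vspace M = S" "is_module scale (presented_algebra R) M"
    "\<And>p v. v \<in> S \<Longrightarrow> action M (residue_class R p) v = \<rho> p v"
proof -
  define M where "M = \<lparr>vspace = S, action = (\<lambda>C. \<rho> (SOME p. p \<in> C))\<rparr>"
  have act: "action M (residue_class R p) v = \<rho> p v" if v: "v \<in> S" for p v
  proof -
    let ?p = "SOME p'. p' \<in> residue_class R p"
    have "p \<in> residue_class R p" unfolding residue_class_mem_iff ..
    then have "?p \<in> residue_class R p" by (rule someI)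
    then have "?p - p \<in> relation_ideal R" unfolding residue_class_mem_iff residue_class_eq_iff .
    then have "\<rho> (?p - p) v = 0" using relation_ideal_acts_trivially[OF \<rho> R] v by blast
    then show ?thesis using algebra_rep_diff[OF \<rho> v] by (simp add: M_def)
  qed
  have S: "vspace M = S" by (simp add: M_def)
  have "algebra_rep S (\<lambda>p. action M (residue_class R p))"
    using \<rho> unfolding algebra_rep_def endo_def lin_on_def 
    by (simp add: act subspace_add subspace_scale algebra_repD(3)[OF \<rho>] algebra_rep_scalar[OF \<rho>])
  then show ?thesis using that[of M] S act by (simp add: module_iff_algebra_rep)
qed

section \<open>Isomorphism classes\<close>

lemma module_iso_refl: "module_iso scale A M M"
  unfolding module_iso_def by (intro exI[of _ id]) auto

lemma module_iso_trans:
  assumes "module_iso scale A M N" "module_iso scale A N L"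
  shows "module_iso scale A M L"
proof -
  obtain f where f: "bij_betw f (vspace M) (vspace N)"
    "\<forall>v\<in>vspace M. \<forall>w\<in>vspace M. f (v + w) = f v + f w"
    "\<forall>c. \<forall>v\<in>vspace M. f (c *s v) = c *s f v"
    "\<forall>a\<in>carrier A. \<forall>v\<in>vspace M. f (action M a v) = action N a (f v)"
    using assms(1) unfolding module_iso_def by blast
  obtain g where g: "bij_betw g (vspace N) (vspace L)"
    "\<forall>v\<in>vspace N. \<forall>w\<in>vspace N. g (v + w) = g v + g w"
    "\<forall>c. \<forall>v\<in>vspace N. g (c *s v) = c *s g v"
    "\<forall>a\<in>carrier A. \<forall>v\<in>vspace N. g (action N a v) = action L a (g v)"
    using assms(2) unfolding module_iso_def by blast
  have "f v \<in> vspace N" if "v \<in> vspace M" for v using f(1) that by (rule bij_betwE[THEN bspec])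
  then show ?thesis
    unfolding module_iso_def
    using f(2-) g(2-) bij_betw_trans[OF f(1) g(1)] by (intro exI[of _ "g \<circ> f"]) simp
qed

lemma module_iso_sym:
  assumes M: "is_module scale A M" and iso: "module_iso scale A M N"
  shows "module_iso scale A N M"
proof -
  obtain f where f: "bij_betw f (vspace M) (vspace N)"
    "\<And>v w. v\<in>vspace M \<Longrightarrow> w\<in>vspace M \<Longrightarrow> f (v + w) = f v + f w"
    "\<And>c v. v\<in>vspace M \<Longrightarrow> f (c *s v) = c *s f v"
    "\<And>a v. a\<in>carrier A \<Longrightarrow> v\<in>vspace M \<Longrightarrow> f (action M a v) = action N a (f v)"
    using iso unfolding module_iso_def by blast
  define g where "g = inv_into (vspace M) f"
  have g: "bij_betw g (vspace N) (vspace M)" unfolding g_def by (rule bij_betw_inv_into[OF f(1)])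
  have gM: "g w \<in> vspace M" if "w \<in> vspace N" for w using g that by (rule bij_betwE[THEN bspec])
  have fg: "f (g w) = w" if "w \<in> vspace N" for w
    using f(1) that unfolding g_def by (rule bij_betw_inv_into_right)
  have gf: "g (f v) = v" if "v \<in> vspace M" for v
    using f(1) that unfolding g_def by (rule bij_betw_inv_into_left)
  have sub: "subspace (vspace M)"
    and cl: "\<And>a v. a \<in> carrier A \<Longrightarrow> v \<in> vspace M \<Longrightarrow> action M a v \<in> vspace M"
    using M unfolding is_module_def by auto
  have "g (v + w) = g v + g w" if "v \<in> vspace N" "w \<in> vspace N" for v w
    using gf[of "g v + g w"] f(2)[OF gM gM] fg that subspace_add[OF sub gM gM] by simp
  moreover have "g (c *s v) = c *s g v" if "v \<in> vspace N" for c v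
    using gf[of "c *s g v"] f(3)[OF gM] fg that subspace_scale[OF sub gM] by simp
  moreover have "g (action N a v) = action M a (g v)" if "a \<in> carrier A" "v \<in> vspace N" for a v
    using gf[of "action M a (g v)"] f(4)[OF that(1) gM] fg that cl[OF that(1) gM] by simp
  ultimately show ?thesis
    unfolding module_iso_def using g by blast
qed

lemma iso_class_eq_iff:
  assumes "is_module scale A M" "is_module scale A N"
  shows "iso_class scale A M = iso_class scale A N \<longleftrightarrow> module_iso scale A M N"
proof
  assume "iso_class scale A M = iso_class scale A N"
  then show "module_iso scale A M N"
    using assms(2) module_iso_refl[of A N] unfolding iso_class_def by blast
next
  assume "module_iso scale A M N"
  then show "iso_class scale A M = iso_class scale A N"
    using module_iso_sym[OF assms(1)] module_iso_trans unfolding iso_class_def by blast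
qed

end

section \<open>Pullback along \<open>\<kappa>\<close>\<close>

lemma four_eq_0: "(4 :: 4) = 0"
  using bit0.of_int_eq[of 4, where 'a = 2] bit0.of_int_eq[of 0, where 'a = 2] by simp

lemma cyclic_successors:
  "(0 :: 4) + 1 = 1" "(1 :: 4) + 1 = 2" "(2 :: 4) + 1 = 3" "(3 :: 4) + 1 = 0"
  "(0 :: 4) + 2 = 2" "(1 :: 4) + 2 = 3" "(2 :: 4) + 2 = 0" "(3 :: 4) + 2 = 1"
  using four_eq_0 by simp_all

lemma cyclic_exhaust: "(k :: 4) = j \<or> k = j + 1 \<or> k = j + 2 \<or> k = j + 3"
proof -
  have "n = 0 \<or> n = 1 \<or> n = 2 \<or> n = 3" for n :: 4
  proof (induct n)
    case (of_int z)
    then have "z = 0 \<or> z = 1 \<or> z = 2 \<or> z = 3" by force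
    then show ?case by auto
  qed
  from this[of "k - j"] show ?thesis by (auto simp: diff_eq_eq add.commute)
qed

lemma q_string_1: "q_string q d 1 = (\<lambda>i. q powi (int d - 2 * i)) ` {0..int d}"
proof -
  have "{0..int d} = int ` {..d}" by (simp add: image_int_atLeastAtMost flip: atLeast0AtMost)
  then show ?thesis unfolding q_string_def by (auto simp: image_image)
qed

lemma q_string_inverse:
  "(\<lambda>i. inverse (q powi (int d - 2 * i))) ` {0..int d} = q_string q d 1"
proof -
  have "(\<lambda>i. inverse (q powi (int d - 2 * i))) ` {0..int d} =
      (\<lambda>i. q powi (int d - 2 * i)) ` (\<lambda>i. int d - i) ` {0..int d}"
    unfolding image_image by (intro image_cong) (simp_all add: algebra_simps flip: power_int_minus)
  also have "(\<lambda>i. int d - i) ` {0..int d} = {0..int d}" by simp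
  finally show ?thesis by (simp add: q_string_1)
qed

context operator_space
begin

lemma square_relations:
  assumes "is_module scale (square_q q) M" "q - inverse q \<noteq> 0"
  shows "endo (vspace M) (action M (square_gen q i))"
    and "q_weyl (vspace M) q (action M (square_gen q i)) (action M (square_gen q (i + 1)))"
    and "serre (vspace M) q (action M (square_gen q i)) (action M (square_gen q (i + 2)))"
proof -
  note rep = assms(1)[unfolded module_iff_algebra_rep]
  note rel = module_relator[OF assms(1)]
  show "endo (vspace M) (action M (square_gen q i))"
    unfolding square_gen_def using algebra_repD(2)[OF rep] .
  show "q_weyl (vspace M) q (action M (square_gen q i)) (action M (square_gen q (i + 1)))"
    unfolding square_gen_def algebra_rep_weyl[OF rep assms(2), symmetric]
    by (intro ballI rel) (auto simp: square_relators_def)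
  show "serre (vspace M) q (action M (square_gen q i)) (action M (square_gen q (i + 2)))"
    unfolding square_gen_def algebra_rep_serre[OF rep, symmetric]
    by (intro ballI rel) (auto simp: square_relators_def)
qed

lemma uq_relations:
  assumes "is_module scale (uq_plus q) M"
  shows "endo (vspace M) (action M (uq_gen q g))"
    and "serre (vspace M) q (action M (uq_gen q GenX)) (action M (uq_gen q GenY))"
    and "serre (vspace M) q (action M (uq_gen q GenY)) (action M (uq_gen q GenX))"
proof -
  note rep = assms(1)[unfolded module_iff_algebra_rep]
  note rel = module_relator[OF assms(1)]
  show "endo (vspace M) (action M (uq_gen q g))"
    unfolding uq_gen_def using algebra_repD(2)[OF rep] .
  show "serre (vspace M) q (action M (uq_gen q GenX)) (action M (uq_gen q GenY))"
    "serre (vspace M) q (action M (uq_gen q GenY)) (action M (uq_gen q GenX))"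
    unfolding uq_gen_def algebra_rep_serre[OF rep, symmetric]
    by (intro ballI rel; simp add: uq_relators_def)+
qed

lemma irreducible_square_module_iff:
  assumes "is_module scale (square_q q) M"
  shows "irreducible_module scale (square_q q) M \<longleftrightarrow>
    irreducible_under (vspace M) (range (\<lambda>i. action M (square_gen q i)))"
  using irreducible_module_iff[OF assms] by (simp add: square_gen_def)

lemma irreducible_uq_module_iff:
  assumes "is_module scale (uq_plus q) M"
  shows "irreducible_module scale (uq_plus q) M \<longleftrightarrow>
    irreducible_under (vspace M) {action M (uq_gen q GenX), action M (uq_gen q GenY)}"
proof -
  have UNIV: "(UNIV :: uq_generator set) = {GenX, GenY}"
    using uq_generator.exhaust by blast
  show ?thesis using irreducible_module_iff[OF assms] unfolding UNIV by (simp add: uq_gen_def)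
qed

lemma eigenvalues_boundD:
  assumes "eigenvalues scale M a = \<theta> ` {0..int d}" "inj \<theta>"
  shows "\<exists>v\<in>vspace M. v \<noteq> 0 \<and> action M a v = \<theta> 0 *s v"
    and "v \<in> vspace M \<Longrightarrow> v \<noteq> 0 \<Longrightarrow> action M a v = \<theta> i *s v \<Longrightarrow> i \<in> {0..int d}"
proof -
  have "\<theta> 0 \<in> eigenvalues scale M a" unfolding assms(1) by auto
  then show "\<exists>v\<in>vspace M. v \<noteq> 0 \<and> action M a v = \<theta> 0 *s v" unfolding eigenvalues_def by blast
  assume "v \<in> vspace M" "v \<noteq> 0" "action M a v = \<theta> i *s v"
  then have "\<theta> i \<in> eigenvalues scale M a" unfolding eigenvalues_def by blast
  then show "i \<in> {0..int d}" unfolding assms(1) using assms(2) by (auto simp: inj_eq)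
qed

text \<open>
  Each of the four generators maps an eigenvector of \<open>x\<^sub>j\<close> to a sum of eigenvectors of \<open>x\<^sub>j\<close>, by the
  quadratic relations for the neighbours of \<open>x\<^sub>j\<close> and the cubic one for the generator opposite to it.
\<close>

lemma square_module_diagonalizable:
  assumes "is_module scale (square_q q) M" "irreducible_module scale (square_q q) M"
    and \<theta>: "q_sequence q \<theta>" and ev: "eigenvalues scale M (square_gen q j) = \<theta> ` {0..int d}"
  shows "vspace M \<subseteq> eigsum (vspace M) (action M (square_gen q j)) (\<theta> ` {0..int d})"
proof -
  let ?S = "vspace M" and ?x = "\<lambda>i. action M (square_gen q i)"
  note rel = square_relations[OF assms(1) q_sequence_q2(2)[OF \<theta>]]
  have S: "subspace ?S" using assms(1) unfolding is_module_def by blast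
  note ev' = eigenvalues_boundD[OF ev q_sequence_inj[OF \<theta>]]
  obtain v0 where v0: "v0 \<in> ?S" "v0 \<noteq> 0" "?x j v0 = \<theta> 0 *s v0" using ev'(1) by blast
  show ?thesis
  proof (rule diagonalizable_if_irreducible[OF assms(2)[unfolded irreducible_square_module_iff[OF assms(1)]]
      S rel(1) q_sequence_inj[OF \<theta>] _ _ v0 ev'(2)])
    fix T v i assume "T \<in> range ?x" and v: "v \<in> ?S" "?x j v = \<theta> i *s v"
    then obtain k where T: "T = ?x k" by blast
    have mono: "w \<in> eigsum ?S (?x j) (\<theta> ` I) \<Longrightarrow> w \<in> eigsum ?S (?x j) (range \<theta>)" for w I
      using eigsum_mono[of "\<theta> ` I" "range \<theta>" ?S "?x j"] by blast
    have j3: "j + 3 + 1 = j" using four_eq_0 by (simp add: add.assoc)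
    from cyclic_exhaust[of k j] consider "k = j" | "k = j + 1" | "k = j + 2" | "k = j + 3" by blast
    then show "T v \<in> eigsum ?S (?x j) (range \<theta>)"
    proof cases
      case 1
      then show ?thesis using v T by (auto intro!: subspace_scale eigsumI)
    next
      case 2
      then show ?thesis using q_weyl_step_up[OF rel(2) rel(1) rel(1) S \<theta> v] T mono by blast
    next
      case 3
      then show ?thesis using serre_eigenvector[OF rel(3) rel(1) rel(1) S \<theta> v] T mono by blast
    next
      case 4
      have "q_weyl ?S q (?x (j + 3)) (?x j)" using rel(2)[of "j + 3"] unfolding j3 .
      then show ?thesis using q_weyl_step_down[OF _ rel(1) rel(1) S \<theta> v] T mono 4 by blast
    qed
  qed (use rel(1) in auto)
qed

lemma square_module_weyl_square:
  assumes q: "q \<noteq> 0" "not_root_of_unity q"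
    and M: "is_module scale (square_q q) M" "fin_dim scale M"
      "irreducible_module scale (square_q q) M" "square_type scale q M 1"
  defines "x \<equiv> \<lambda>i. action M (square_gen q i)"
  obtains \<theta> d where "weyl_square scale (vspace M) q \<theta> 0 (int d) (x 0) (x 1) (x 2) (x 3)"
    "irreducible_under (vspace M) {x 0, x 2}"
    "eigenvalues scale M (square_gen q 0) = q_string q d 1"
    "eigenvalues scale M (square_gen q 2) = q_string q d 1"
proof -
  obtain d where ev: "eigenvalues scale M (square_gen q 0) = q_string q d 1"
    "eigenvalues scale M (square_gen q 2) = q_string q d 1"
    using M(4) unfolding square_type_def by blast
  define \<theta> where "\<theta> = (\<lambda>i. q powi (int d - 2 * i))"
  have \<theta>: "q_sequence q \<theta>" unfolding \<theta>_def by (rule q_sequence_powi[OF q])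
  have str: "q_string q d 1 = \<theta> ` {0..int d}" unfolding \<theta>_def by (rule q_string_1)
  have x: "action M (square_gen q i) = x i" for i by (simp add: x_def)
  note rel = square_relations[OF M(1) q_sequence_q2(2)[OF \<theta>], unfolded x]
  have S: "subspace (vspace M)" using M(1) unfolding is_module_def by blast
  have sq: "weyl_square scale (vspace M) q \<theta> 0 (int d) (x 0) (x 1) (x 2) (x 3)"
  proof
    show "vspace M \<subseteq> eigsum (vspace M) (x 0) (\<theta> ` {0..int d})"
      "vspace M \<subseteq> eigsum (vspace M) (x 2) (\<theta> ` {0..int d})"
      using square_module_diagonalizable[OF M(1,3) \<theta>] ev unfolding str x_def by auto
    show "q_weyl (vspace M) q (x 0) (x 1)" "q_weyl (vspace M) q (x 1) (x 2)"
      "q_weyl (vspace M) q (x 2) (x 3)" "q_weyl (vspace M) q (x 3) (x 0)"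
      using rel(2)[of 0] rel(2)[of 1] rel(2)[of 2] rel(2)[of 3] by (simp_all only: cyclic_successors)
  qed (use \<theta> S rel(1) in auto)
  interpret sq: weyl_square scale "vspace M" q \<theta> 0 "int d" "x 0" "x 1" "x 2" "x 3" by (rule sq)
  obtain G where G: "finite G" "span G = vspace M" using M(2) unfolding fin_dim_def by blast
  have "k \<in> {0, 1, 2, 3}" for k :: 4 using cyclic_exhaust[of k 0] by simp
  then have UNIV: "UNIV = {0, 1, 2, 3 :: 4}" by blast
  have "range x = {x 0, x 1, x 2, x 3}" by (simp only: UNIV image_insert image_empty)
  then have "irreducible_under (vspace M) {x 0, x 1, x 2, x 3}"
    using M(3) unfolding irreducible_square_module_iff[OF M(1)] x_def by simp
  moreover have "serre (vspace M) q (x 0) (x 2)" "serre (vspace M) q (x 2) (x 0)"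
    using rel(3)[of 0] rel(3)[of 2] by (simp_all only: cyclic_successors)
  ultimately have "irreducible_under (vspace M) {x 0, x 2}"
    using sq.irreducible_pair[OF G(1)] G(2) by blast
  then show ?thesis using that sq ev by blast
qed

lemma pullback_kappa_action:
  "action (pullback (kappa q) M) (residue_class (uq_relators q) p) =
   action M (residue_class (square_relators q) (free_ext kappa_gen p))"
  by (simp add: pullback_def kappa_residue_class)

lemma pullback_kappa_gen:
  "action (pullback (kappa q) M) (uq_gen q GenX) = action M (square_gen q 0)"
  "action (pullback (kappa q) M) (uq_gen q GenY) = action M (square_gen q 2)"
  by (simp_all add: pullback_def kappa_generators)

lemma vspace_pullback [simp]: "vspace (pullback h M) = vspace M"
  by (simp add: pullback_def)

lemma pullback_kappa_module:
  assumes "is_module scale (square_q q) M"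
  shows "is_module scale (uq_plus q) (pullback (kappa q) M)"
  using assms unfolding module_iff_algebra_rep pullback_kappa_action vspace_pullback algebra_rep_def
  by (auto simp: free_ext_add free_ext_mult)

lemma pullback_kappa_iso:
  assumes "module_iso scale (square_q q) M N"
  shows "module_iso scale (uq_plus q) (pullback (kappa q) M) (pullback (kappa q) N)"
proof -
  have "kappa q a \<in> carrier (square_q q)" if "a \<in> carrier (uq_plus q)" for a
    using ring_hom_closed[OF kappa_hom(1) that] .
  then show ?thesis using assms unfolding module_iso_def by (auto simp: pullback_def)
qed

lemma kappa_sharp_iso_class:
  assumes "is_module scale (square_q q) M"
  shows "kappa_sharp scale q (iso_class scale (square_q q) M) =
    iso_class scale (uq_plus q) (pullback (kappa q) M)"
proof -
  have "iso_class scale (uq_plus q) (pullback (kappa q) N) =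
      iso_class scale (uq_plus q) (pullback (kappa q) M)"
    if "N \<in> iso_class scale (square_q q) M" for N
  proof -
    have N: "is_module scale (square_q q) N" and "module_iso scale (square_q q) M N"
      using that by (simp_all add: iso_class_def)
    then show ?thesis
      using iso_class_eq_iff[OF pullback_kappa_module[OF assms] pullback_kappa_module[OF N]]
        pullback_kappa_iso by blast
  qed
  moreover have "M \<in> iso_class scale (square_q q) M"
    using assms module_iso_refl unfolding iso_class_def by blast
  ultimately show ?thesis unfolding kappa_sharp_def by blast
qed

lemma pullback_kappa_properties:
  assumes q: "q \<noteq> 0" "not_root_of_unity q"
    and M: "is_module scale (square_q q) M" "fin_dim scale M"
      "irreducible_module scale (square_q q) M" "square_type scale q M 1"
  shows "fin_dim scale (pullback (kappa q) M)"
    and "irreducible_module scale (uq_plus q) (pullback (kappa q) M)"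
    and "NonNil q (pullback (kappa q) M)" and "uq_type scale q (pullback (kappa q) M) (1, 1)"
proof -
  let ?x = "\<lambda>i. action M (square_gen q i)"
  obtain \<theta> d where "weyl_square scale (vspace M) q \<theta> 0 (int d) (?x 0) (?x 1) (?x 2) (?x 3)"
    and sq: "irreducible_under (vspace M) {?x 0, ?x 2}"
    and ev: "eigenvalues scale M (square_gen q 0) = q_string q d 1"
    "eigenvalues scale M (square_gen q 2) = q_string q d 1"
    by (rule square_module_weyl_square[OF assms])
  show "fin_dim scale (pullback (kappa q) M)" using M(2) by (simp add: fin_dim_def)
  show "irreducible_module scale (uq_plus q) (pullback (kappa q) M)"
    unfolding irreducible_uq_module_iff[OF pullback_kappa_module[OF M(1)]] pullback_kappa_gen vspace_pullback
    by (rule sq)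
  have not_nil: "\<not> nilpotent_on M (square_gen q i)"
    if "eigenvalues scale M (square_gen q i) = q_string q d 1" for i
  proof
    let ?T = "action M (square_gen q i)"
    assume "nilpotent_on M (square_gen q i)"
    then obtain n where n: "\<And>v. v \<in> vspace M \<Longrightarrow> (?T ^^ n) v = 0"
      unfolding nilpotent_on_def by blast
    have "q powi int d \<in> eigenvalues scale M (square_gen q i)"
      unfolding that q_string_1 by (auto intro!: image_eqI[of _ _ 0])
    then obtain v where v: "v \<in> vspace M" "v \<noteq> 0" "?T v = (q powi int d) *s v"
      unfolding eigenvalues_def by blast
    have endo: "endo (vspace M) ?T"
      using M(1) algebra_repD(2) unfolding module_iff_algebra_rep square_gen_def by blast
    have "(?T ^^ m) v = ((q powi int d) ^ m) *s v" for m
      by (induction m) (simp_all add: endo_scale[OF endo v(1)] v(3) mult.commute)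
    then show False using n[OF v(1)] v(2) q(1) by simp
  qed
  show "NonNil q (pullback (kappa q) M)"
    using not_nil[OF ev(1)] not_nil[OF ev(2)]
    unfolding NonNil_def nilpotent_on_def pullback_kappa_gen vspace_pullback by blast
  show "uq_type scale q (pullback (kappa q) M) (1, 1)"
    using ev unfolding uq_type_def eigenvalues_def pullback_kappa_gen vspace_pullback by auto
qed

text \<open>The generators \<open>x\<^sub>1\<close> and \<open>x\<^sub>3\<close> are determined by \<open>x\<^sub>0\<close> and \<open>x\<^sub>2\<close>, so every isomorphism respects them.\<close>

lemma pullback_kappa_reflects_iso:
  assumes q: "q \<noteq> 0" "not_root_of_unity q"
    and M: "is_module scale (square_q q) M" "fin_dim scale M"
      "irreducible_module scale (square_q q) M" "square_type scale q M 1"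
    and N: "is_module scale (square_q q) N"
    and iso: "module_iso scale (uq_plus q) (pullback (kappa q) M) (pullback (kappa q) N)"
  shows "module_iso scale (square_q q) M N"
proof -
  let ?x = "\<lambda>i. action M (square_gen q i)" and ?y = "\<lambda>i. action N (square_gen q i)"
  obtain \<theta> d where sq: "weyl_square scale (vspace M) q \<theta> 0 (int d) (?x 0) (?x 1) (?x 2) (?x 3)"
    and irr: "irreducible_under (vspace M) {?x 0, ?x 2}"
    and "eigenvalues scale M (square_gen q 0) = q_string q d 1"
    "eigenvalues scale M (square_gen q 2) = q_string q d 1"
    by (rule square_module_weyl_square[OF q M])
  interpret sq: weyl_square scale "vspace M" q \<theta> 0 "int d" "?x 0" "?x 1" "?x 2" "?x 3" by (rule sq)
  interpret op: weyl_square scale "vspace M" q \<theta> 0 "int d" "?x 2" "?x 3" "?x 0" "?x 1"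
    by (rule sq.opposite)
  obtain f where f: "bij_betw f (vspace M) (vspace N)" "lin_on (vspace M) f"
    and fa: "\<And>a v. a \<in> carrier (uq_plus q) \<Longrightarrow> v \<in> vspace M \<Longrightarrow>
      f (action (pullback (kappa q) M) a v) = action (pullback (kappa q) N) a (f v)"
    using iso unfolding module_iso_def lin_on_def by auto
  have gen: "uq_gen q g \<in> carrier (uq_plus q)" for g
    by (simp add: uq_gen_def presented_algebra_simps)
  have f0: "f (?x 0 v) = ?y 0 (f v)" and f2: "f (?x 2 v) = ?y 2 (f v)" if "v \<in> vspace M" for v
    using fa[OF gen[of GenX] that] fa[OF gen[of GenY] that] unfolding pullback_kappa_gen by auto
  have N_sub: "subspace (vspace N)" using N unfolding is_module_def by blast
  note rel = square_relations[OF N q_sequence_q2(2)[OF sq.q]]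
  have w: "q_weyl (vspace N) q (?y 0) (?y 1)" "q_weyl (vspace N) q (?y 1) (?y 2)"
    "q_weyl (vspace N) q (?y 2) (?y 3)" "q_weyl (vspace N) q (?y 3) (?y 0)"
    using rel(2)[of 0] rel(2)[of 1] rel(2)[of 2] rel(2)[of 3] by (simp_all only: cyclic_successors)
  have f1: "f (?x 1 v) = ?y 1 (f v)" if "v \<in> vspace M" for v
    by (rule weyl_operator_intertwined[OF irr sq.weyl_chain_axioms N_sub rel(1) rel(1) rel(1)
          w(1,2) f f0 f2 that])
  have irr': "irreducible_under (vspace M) {?x 2, ?x 0}" using irr by (subst insert_commute)
  have f3: "f (?x 3 v) = ?y 3 (f v)" if "v \<in> vspace M" for v
    by (rule weyl_operator_intertwined[OF irr' op.weyl_chain_axioms N_sub rel(1) rel(1) rel(1)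
          w(3,4) f f2 f0 that])
  have fg: "f (?x i v) = ?y i (f v)" if "v \<in> vspace M" for i v
    using cyclic_exhaust[of i 0] f0 f1 f2 f3 that by auto
  have fN: "f v \<in> vspace N" if "v \<in> vspace M" for v using f(1) that by (rule bij_betwE[THEN bspec])
  have "f (action M (residue_class (square_relators q) p) v) =
      action N (residue_class (square_relators q) p) (f v)" if "v \<in> vspace M" for p v
    by (rule intertwine_generated[OF M(1)[unfolded module_iff_algebra_rep]
          N[unfolded module_iff_algebra_rep] f(2) fN _ that])
      (use fg in \<open>auto simp: square_gen_def\<close>)
  then show ?thesis
    unfolding module_iso_def presented_algebra_simps(1)
    using f unfolding lin_on_def by (intro exI[of _ f]) blast
qed

text \<open>
  On the space of the given module, \<open>x\<^sub>1\<close> and \<open>x\<^sub>3\<close> act by the operators from \<open>weyl_operator_exists\<close> for the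
  pairs \<open>(x, y)\<close> and \<open>(y, x)\<close>. The resulting module has the given one as its pullback, up to the values
  of the action outside the space and the algebra.
\<close>

lemma uq_module_extends:
  assumes q: "q \<noteq> 0" "not_root_of_unity q"
    and L: "is_module scale (uq_plus q) L" "fin_dim scale L"
      "irreducible_module scale (uq_plus q) L" "uq_type scale q L (1, 1)"
  obtains M where "is_module scale (square_q q) M" "fin_dim scale M"
    "irreducible_module scale (square_q q) M" "square_type scale q M 1"
    "module_iso scale (uq_plus q) (pullback (kappa q) M) L"
proof -
  let ?S = "vspace L" and ?A = "action L (uq_gen q GenX)" and ?B = "action L (uq_gen q GenY)"
  obtain d where ev: "eigenvalues scale L (uq_gen q GenX) = q_string q d 1"
    "eigenvalues scale L (uq_gen q GenY) = q_string q d 1"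
    using L(4) unfolding uq_type_def by auto
  define \<theta> where "\<theta> = (\<lambda>i. q powi (int d - 2 * i))"
  have \<theta>: "q_sequence q \<theta>" unfolding \<theta>_def by (rule q_sequence_powi[OF q])
  have str: "q_string q d 1 = \<theta> ` {0..int d}" unfolding \<theta>_def by (rule q_string_1)
  have S: "subspace ?S" using L(1) unfolding is_module_def by blast
  have irr: "irreducible_under ?S {?A, ?B}" using L(3) irreducible_uq_module_iff[OF L(1)] by blast
  have irr': "irreducible_under ?S {?B, ?A}" using irr by (subst insert_commute)
  note A = uq_relations(1)[OF L(1), of GenX] and B = uq_relations(1)[OF L(1), of GenY]
    and serre = uq_relations(2,3)[OF L(1)]
  note evA = eigenvalues_boundD[OF ev(1)[unfolded str] q_sequence_inj[OF \<theta>]]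
    and evB = eigenvalues_boundD[OF ev(2)[unfolded str] q_sequence_inj[OF \<theta>]]
  obtain vA where vA: "vA \<in> ?S" "vA \<noteq> 0" "?A vA = \<theta> 0 *s vA" using evA(1) by blast
  obtain vB where vB: "vB \<in> ?S" "vB \<noteq> 0" "?B vB = \<theta> 0 *s vB" using evB(1) by blast
  have SA: "?S \<subseteq> eigsum ?S ?A (\<theta> ` {0..int d})"
    by (rule serre_pair_diagonalizable[OF irr S A B \<theta> serre(1) vA evA(2)])
  have SB: "?S \<subseteq> eigsum ?S ?B (\<theta> ` {0..int d})"
    by (rule serre_pair_diagonalizable[OF irr' S B A \<theta> serre(2) vB evB(2)])
  obtain X where X: "endo ?S X" "q_weyl ?S q ?A X" "q_weyl ?S q X ?B"
    using weyl_operator_exists[OF \<theta> S A B irr serre SA SB vA vB] by blast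
  obtain Y where Y: "endo ?S Y" "q_weyl ?S q ?B Y" "q_weyl ?S q Y ?A"
    using weyl_operator_exists[OF \<theta> S B A irr' serre(2,1) SB SA vB vA] by blast
  interpret sq: weyl_square scale ?S q \<theta> 0 "int d" ?A X ?B Y
    by unfold_locales (fact \<theta> S A X B Y SA SB)+
  interpret op: weyl_square scale ?S q \<theta> 0 "int d" ?B Y ?A X by (rule sq.opposite)

  define T :: "4 \<Rightarrow> 'b \<Rightarrow> 'b" where
    "T i = (if i = 0 then ?A else if i = 1 then X else if i = 2 then ?B else Y)" for i
  have "(1 :: 4) \<noteq> 0" "(2 :: 4) \<noteq> 0" "(3 :: 4) \<noteq> 0" "(2 :: 4) \<noteq> 1" "(3 :: 4) \<noteq> 1" "(3 :: 4) \<noteq> 2"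
    by simp_all
  then have T: "T 0 = ?A" "T 1 = X" "T 2 = ?B" "T 3 = Y" by (simp_all add: T_def)
  have T_endo: "endo ?S (T i)" for i using A B X Y by (simp add: T_def)
  have rep: "algebra_rep ?S (free_action T)" by (rule free_action_algebra_rep[OF S T_endo])
  have all4: "P i" if "P 0" "P 1" "P 2" "P 3" for P and i :: 4
    using cyclic_exhaust[of i 0] that by auto
  have gen: "free_action T (gen i) = T i" for i by (rule ext) (rule free_action_gen)
  have weyl: "q_weyl ?S q (T i) (T (i + 1))" for i
    by (rule all4[of "\<lambda>i. q_weyl ?S q (T i) (T (i + 1))"]) (simp_all only: cyclic_successors T X Y)
  have serreT: "serre ?S q (T i) (T (i + 2))" for i
    by (rule all4[of "\<lambda>i. serre ?S q (T i) (T (i + 2))"])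
      (simp_all only: cyclic_successors T serre sq.serre_X_Y op.serre_X_Y)
  have "free_action T r v = 0" if "r \<in> square_relators q" "v \<in> ?S" for r v
    using that algebra_rep_weyl[OF rep q_sequence_q2(2)[OF \<theta>], of "gen _" "gen _"]
      algebra_rep_serre[OF rep, of q "gen _" "gen _"] weyl serreT
    unfolding gen square_relators_def by blast
  then obtain M where M: "vspace M = ?S" "is_module scale (square_q q) M"
    and act: "\<And>p v. v \<in> ?S \<Longrightarrow> action M (residue_class (square_relators q) p) v = free_action T p v"
    using module_from_algebra_rep[OF rep] by metis
  have actT: "action M (square_gen q i) v = T i v" if "v \<in> ?S" for i v
    using act[OF that, of "gen i"] by (simp add: square_gen_def gen)
  note act4 = actT[of _ 0, unfolded T] actT[of _ 1, unfolded T] actT[of _ 2, unfolded T]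
    actT[of _ 3, unfolded T]
  have "fin_dim scale M" using L(2) M(1) by (simp add: fin_dim_def)
  moreover have "irreducible_module scale (square_q q) M"
    unfolding irreducible_square_module_iff[OF M(2)] M(1) irreducible_under_def
  proof (intro conjI allI impI)
    show "?S \<noteq> {0}" using vA by blast
    fix U assume U: "subspace U \<and> U \<subseteq> ?S \<and>
      (\<forall>t\<in>range (\<lambda>i. action M (square_gen q i)). \<forall>u\<in>U. t u \<in> U)"
    have cl: "T i u \<in> U" if "u \<in> U" for i u
    proof -
      have "action M (square_gen q i) u \<in> U" using U that by auto
      moreover have "u \<in> ?S" using U that by auto
      ultimately show ?thesis by (simp add: actT)
    qed
    have "?A u \<in> U" "?B u \<in> U" if "u \<in> U" for u
      using cl[OF that, of 0] cl[OF that, of 2] by (simp_all only: T)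
    then have "\<forall>t\<in>{?A, ?B}. \<forall>u\<in>U. t u \<in> U" by auto
    moreover have "subspace U" "U \<subseteq> ?S" using U by auto
    ultimately show "U = {0} \<or> U = ?S"
      using irr[unfolded irreducible_under_def, THEN conjunct2, rule_format, of U] by simp
  qed
  moreover have "square_type scale q M 1"
  proof -
    have evM: "eigenvalues scale M (square_gen q i) = {t. \<exists>v\<in>?S. v \<noteq> 0 \<and> T i v = t *s v}" for i
      unfolding eigenvalues_def M(1) using actT by auto
    have "\<exists>v\<in>?S. v \<noteq> 0 \<and> ?A v = \<theta> i *s v" "\<exists>v\<in>?S. v \<noteq> 0 \<and> ?B v = \<theta> i *s v"
      if "i \<in> {0..int d}" for i
    proof -
      have "\<theta> i \<in> eigenvalues scale L (uq_gen q GenX)" "\<theta> i \<in> eigenvalues scale L (uq_gen q GenY)"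
        using that unfolding ev str by auto
      then show "\<exists>v\<in>?S. v \<noteq> 0 \<and> ?A v = \<theta> i *s v" "\<exists>v\<in>?S. v \<noteq> 0 \<and> ?B v = \<theta> i *s v"
        unfolding eigenvalues_def by auto
    qed
    note eig = this
    have str': "(\<lambda>i. inverse (\<theta> i)) ` {0..int d} = q_string q d 1"
      unfolding \<theta>_def by (rule q_string_inverse)
    have X_ev: "{t. \<exists>v\<in>?S. v \<noteq> 0 \<and> X v = t *s v} = q_string q d 1"
      using sq.eigenvalues_X[OF eig(1)] str' by simp
    have Y_ev: "{t. \<exists>v\<in>?S. v \<noteq> 0 \<and> Y v = t *s v} = q_string q d 1"
      using op.eigenvalues_X[OF eig(2)] str' by simp
    show ?thesis
      unfolding square_type_def evM T inverse_1 X_ev Y_ev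
      using ev unfolding eigenvalues_def by auto
  qed
  moreover have "module_iso scale (uq_plus q) (pullback (kappa q) M) L"
    unfolding module_iso_def
  proof (intro exI[of _ id] conjI ballI allI)
    show "bij_betw id (vspace (pullback (kappa q) M)) ?S" by (simp add: M(1))
    fix a v assume a: "a \<in> carrier (uq_plus q)" and "v \<in> vspace (pullback (kappa q) M)"
    then have v: "v \<in> ?S" by (simp add: M(1))
    obtain p where p: "a = residue_class (uq_relators q) p"
      using a by (auto simp: presented_algebra_simps(1))
    have repM: "algebra_rep ?S (\<lambda>p. action (pullback (kappa q) M) (residue_class (uq_relators q) p))"
      using pullback_kappa_module[OF M(2)] unfolding module_iff_algebra_rep by (simp add: M(1))
    have "id (action (pullback (kappa q) M) (residue_class (uq_relators q) p) v) =
        action L (residue_class (uq_relators q) p) (id v)"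
    proof (rule intertwine_generated[OF repM L(1)[unfolded module_iff_algebra_rep] _ _ _ v])
      fix g w assume w: "w \<in> ?S"
      show "id (action (pullback (kappa q) M) (residue_class (uq_relators q) (gen g)) w) =
          action L (residue_class (uq_relators q) (gen g)) (id w)"
        using pullback_kappa_gen[of q M] act4(1)[OF w] act4(3)[OF w]
        by (cases g) (simp_all add: uq_gen_def)
    qed (simp_all add: lin_on_def)
    then show "id (action (pullback (kappa q) M) a v) = action L a (id v)" unfolding p .
  qed simp_all
  ultimately show ?thesis using that M(2) by blast
qed

end

theorem theorem8p4:
  fixes q :: "'f::{alg_closed_field, field_char_0}"
    and scale :: "'f \<Rightarrow> 'v::ab_group_add \<Rightarrow> 'v"
  assumes "vector_space scale"
    and "q \<noteq> 0"
    and "not_root_of_unity q"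
  shows "bij_betw (kappa_sharp scale q) (square_classes scale q) (uq_classes scale q)"
proof -
  interpret operator_space scale using assms(1) by (rule operator_space.intro)
  note q = assms(2,3)
  show ?thesis
    unfolding bij_betw_def
  proof
    show "inj_on (kappa_sharp scale q) (square_classes scale q)"
    proof (rule inj_onI)
      fix C D assume C: "C \<in> square_classes scale q" and D: "D \<in> square_classes scale q"
        and eq: "kappa_sharp scale q C = kappa_sharp scale q D"
      from C obtain M where M: "C = iso_class scale (square_q q) M" "is_module scale (square_q q) M"
        "fin_dim scale M" "irreducible_module scale (square_q q) M" "square_type scale q M 1"
        unfolding square_classes_def by blast
      from D obtain N where N: "D = iso_class scale (square_q q) N" "is_module scale (square_q q) N"
        unfolding square_classes_def by blast
      have "module_iso scale (uq_plus q) (pullback (kappa q) M) (pullback (kappa q) N)"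
        using eq unfolding M(1) N(1) kappa_sharp_iso_class[OF M(2)] kappa_sharp_iso_class[OF N(2)]
          iso_class_eq_iff[OF pullback_kappa_module[OF M(2)] pullback_kappa_module[OF N(2)]] .
      then have "module_iso scale (square_q q) M N"
        by (rule pullback_kappa_reflects_iso[OF q M(2-5) N(2)])
      then show "C = D" unfolding M(1) N(1) iso_class_eq_iff[OF M(2) N(2)] .
    qed
    show "kappa_sharp scale q ` square_classes scale q = uq_classes scale q"
    proof (intro equalityI subsetI)
      fix K assume "K \<in> kappa_sharp scale q ` square_classes scale q"
      then obtain M where M: "K = kappa_sharp scale q (iso_class scale (square_q q) M)"
        "is_module scale (square_q q) M" "fin_dim scale M"
        "irreducible_module scale (square_q q) M" "square_type scale q M 1"
        unfolding square_classes_def by blast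
      show "K \<in> uq_classes scale q"
        unfolding M(1) kappa_sharp_iso_class[OF M(2)] uq_classes_def
        using pullback_kappa_module[OF M(2)] pullback_kappa_properties[OF q M(2-5)] by blast
    next
      fix K assume "K \<in> uq_classes scale q"
      then obtain L where L: "K = iso_class scale (uq_plus q) L" "is_module scale (uq_plus q) L"
        "fin_dim scale L" "irreducible_module scale (uq_plus q) L" "uq_type scale q L (1, 1)"
        unfolding uq_classes_def by blast
      obtain M where M: "is_module scale (square_q q) M" "fin_dim scale M"
        "irreducible_module scale (square_q q) M" "square_type scale q M 1"
        and iso: "module_iso scale (uq_plus q) (pullback (kappa q) M) L"
        using uq_module_extends[OF q L(2-5)] .
      have "K = kappa_sharp scale q (iso_class scale (square_q q) M)"
        unfolding L(1) kappa_sharp_iso_class[OF M(1)]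
        using iso_class_eq_iff[OF pullback_kappa_module[OF M(1)] L(2)] iso by blast
      then show "K \<in> kappa_sharp scale q ` square_classes scale q"
        using M unfolding square_classes_def by blast
    qed
  qed
qed

end
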